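(* Let $G$ be a connected, melon-free Feynman graph of genus $g(G)=g\ge 2$. Case $\ell(G)=1$. (1a) If $G$ is 2PI, then $G$ can be obtained by insertion of a connecting N-dipole or connecting N-ladder into a connected, melon-free Feynman graph of grade $1$ and genus $g-1$. (1b) If $G$ is 2PR, then $G$ can be obtained by insertion of a separating dipole, a separating ladder, or a two-edge-connection in between two connected, melon-free Feynman graphs $G_1$ and $G_2$ with $\ell(G_1)=1$, $\ell(G_2)=0$, $0\le g(G_1)<g$, $0<g(G_2)\le g$ and $g(G_1)+g(G_2)=g$. Case $\ell(G)=2$. (2a) If $G$ is 2PI, then $G$ can be obtained either by insertion of a connecting N-dipole or connecting N-ladder into a connected, melon-free Feynman graph of grade $2$ and genus $g-1$, or by insertion of a rearranging N-dipole or rearranging N-ladder into a connected, melon-free Feynman graph of grade $0$ and genus $g-1$. (2b) If $G$ is 2PR, then at least one of the following holds: $G$ can be obtained by insertion of a separating dipole, a separating ladder, or a two-edge-connection in between two connected, melon-free Feynman graphs $G_1,G_2$ with $\ell(G_1)=2$, $\ell(G_2)=0$, $0\le g(G_1)\le g-1$, $0<g(G_2)\le g$ and $g(G_1)+g(G_2)=g$; or $G$ can be obtained by insertion of a separating dipole, a separating ladder, or a two-edge-connection in between two connected, melon-free Feynman graphs $G_1,G_2$ with $\ell(G_1)=\ell(G_2)=1$ and $g(G_1)+g(G_2)=g$.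
   Context: Feynman graphs. A Feynman graph is a connected 4-regular map on a closed oriented surface (a connected graph with a cyclic order of half-edges at each vertex; self-loops and multiple edges allowed) whose edges are directed so that around each vertex the half-edges alternate ingoing, outgoing, ingoing, outgoing. In addition the cycle graph (one closed directed edge without vertices, with $v=0$, $f=2$, $\varphi=1$) is a Feynman graph. Let $v$ be the number of vertices and $f$ the number of faces of the map; each face lies either to the left of all its boundary edges (L-face) or to the right of all of them (R-face). An $\mathrm{O}(D)$-loop is a closed walk that goes straight at each vertex (it leaves through the half-edge opposite to the one through which it arrives); every edge lies in exactly one $\mathrm{O}(D)$-loop, $\varphi$ is the number of $\mathrm{O}(D)$-loops, and the length of such a loop is its number of edges. The genus $g$ is defined by $2-2g=-v+f$ and the grade $\ell$ by $\frac{\ell}{2}=2+v-\frac f2-\varphi=1+g+\frac v2-\varphi$. A graph is 2PR if it contains a two-edge-cut (two edges whose removal disconnects it), and 2PI otherwise. Melons. An elementary melonic 2-point subgraph consists of two distinct vertices $a,b$ joined by three edges $p,q,r$, with cyclic order $(\mathrm{leg}_a,p,q,r)$ at $a$ and $(\mathrm{leg}_b,r,q,p)$ at $b$. A Feynman graph is melon-free if it contains no such subgraph. Dipoles. A dipole is formed by two edges $e_1,e_2$ joining two distinct vertices $a,b$ and bounding a face (L, R or straight) of length two: an N-dipole if $e_1,e_2$ form an $\mathrm{O}(D)$-loop of length 2; an L-dipole (R-dipole) if they bound an L-face (R-face) of length 2. The four remaining half-edges at $a,b$ (external legs) are split into two sides: for an N-dipole, the two legs to the left of the $\mathrm{O}(D)$-loop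 (traversed in a fixed sense) and the two legs to its right; for an L- or R-dipole, the two legs opposite to $e_1$ (at $a$ and at $b$) and the two legs opposite to $e_2$. On each side one leg is ingoing and one is outgoing. Ladders. A ladder is a sequence of $n\ge2$ dipoles (rungs) $(d_1,\dots,d_n)$ such that consecutive dipoles $d_i,d_{i+1}$ are connected by two edges joining the two legs of one side of $d_i$ to the two legs of one side of $d_{i+1}$. The two remaining sides (of $d_1$ and $d_n$) are the sides of the ladder. It is an N-ladder if all rungs are N-dipoles. Contraction and insertion. Contracting a dipole or ladder $X$ means removing it and reconnecting, on each side of $X$, the two half-edges that were attached to that side (a closed edge without vertices produced in this way is a cycle graph). $X$ is separating if this increases the number of connected components by one (giving $G_1,G_2$), and non-separating otherwise (giving $G'$). Insertion is the reverse operation: $G$ is obtained by insertion of $X$ into $G'$ (respectively in between $G_1$ and $G_2$) if contracting $X$ in $G$ yields $G'$ (respectively $G_1\sqcup G_2$). For a non-separating N-dipole or N-ladder $X$, let $\sigma$ be the number of $\mathrm{O}(D)$-loops running through the reconnected edges in $G'$ minus the number of $\mathrm{O}(D)$-loops of $G$ running through the external legs of $X$, so that $\varphi(G')=\varphi(G)-n+\sigma$ with $n$ the number of rungs ($n=1$ for a dipole). $X$ is connecting if $\sigma=-1$ and rearranging if $\sigma=0$. Two-edge-connection. Insertion of a two-edge-connection in between $G_1$ and $G_2$ means cutting one edge of $G_1$ and one edge of $G_2$ and reconnecting the four half-edges by two edges joining $G_1$ to $G_2$, respecting directions; its result is a graph with a two-edge-cut separating two non-empty pieces. *)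

theory Defs
  imports Complex_Main "HOL-Combinatorics.Orbits"
begin

text \<open>
  A finite directed 4-regular map is given by its half-edges: \<open>rot\<close> sends a half-edge to the next
  one counterclockwise around its vertex, \<open>mate\<close> sends a half-edge to the other half of its edge,
  and \<open>outs\<close> is the set of half-edges directed away from their vertex. Both maps are the identity
  off \<open>halves\<close>, so that equal maps are equal as records. Closed directed edges without vertices
  carry no half-edge and are only counted, by \<open>circles\<close>.
\<close>

record 'h fmap =
  halves :: "'h set"
  rot :: "'h \<Rightarrow> 'h"
  mate :: "'h \<Rightarrow> 'h"
  outs :: "'h set"
  circles :: nat

definition vertex :: "'h fmap \<Rightarrow> 'h \<Rightarrow> 'h set" where
  "vertex G d = orbit (rot G) d"

definition edges :: "'h fmap \<Rightarrow> 'h set set" where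
  "edges G = (\<lambda>d. {d, mate G d}) ` halves G"

definition is_fmap :: "'h fmap \<Rightarrow> bool" where
  "is_fmap G \<longleftrightarrow>
     finite (halves G) \<and> outs G \<subseteq> halves G \<and>
     rot G permutes halves G \<and> mate G permutes halves G \<and>
     (\<forall>d\<in>halves G. card (vertex G d) = 4 \<and> (rot G d \<in> outs G \<longleftrightarrow> d \<notin> outs G)) \<and>
     (\<forall>d\<in>halves G. mate G (mate G d) = d \<and> (mate G d \<in> outs G \<longleftrightarrow> d \<notin> outs G))"

definition components :: "'h fmap \<Rightarrow> 'h set set" where
  "components G =
     (\<lambda>d. {(x, y). x \<in> halves G \<and> (y = rot G x \<or> y = mate G x)}\<^sup>* `` {d}) ` halves G"

definition num_components :: "'h fmap \<Rightarrow> nat" where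
  "num_components G = card (components G) + circles G"

definition feynman_graph :: "'h fmap \<Rightarrow> bool" where
  "feynman_graph G \<longleftrightarrow> is_fmap G \<and> num_components G = 1"

text \<open>
  A step leaves through \<open>d\<close>, follows its edge and turns left at the other end, so that the face is on
  the left of the walk. The half-edges of such a walk are either all outgoing (the face is on
  the left of all its edges: an L-face) or all ingoing (an R-face).
\<close>

definition face_step :: "'h fmap \<Rightarrow> 'h \<Rightarrow> 'h" where
  "face_step G d = inv (rot G) (mate G d)"

definition face :: "'h fmap \<Rightarrow> 'h \<Rightarrow> 'h set" where
  "face G d = orbit (face_step G) d"

text \<open>
  The straight walk leaving through \<open>d\<close> and the reverse walk are two different orbits; the
  O(D)-loop consists of all half-edges of its edges. (An O(D)-loop is traversed alternately along
  and against the edge directions, because opposite half-edges have the same direction.)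
\<close>

definition od_loop :: "'h fmap \<Rightarrow> 'h \<Rightarrow> 'h set" where
  "od_loop G d =
     (let W = orbit (\<lambda>x. (rot G ^^ 2) (mate G x)) d in W \<union> mate G ` W)"

definition od_loops :: "'h fmap \<Rightarrow> 'h set set" where
  "od_loops G = od_loop G ` halves G"

definition od_length :: "'h fmap \<Rightarrow> 'h set \<Rightarrow> nat" where
  "od_length G l = card {e \<in> edges G. e \<subseteq> l}"

text \<open>A circle has no vertex, two faces and one O(D)-loop.\<close>

definition num_vertices :: "'h fmap \<Rightarrow> nat" where
  "num_vertices G = card (vertex G ` halves G)"

definition num_faces :: "'h fmap \<Rightarrow> nat" where
  "num_faces G = card (face G ` halves G) + 2 * circles G"

definition num_od_loops :: "'h fmap \<Rightarrow> nat" where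
  "num_od_loops G = card (od_loops G) + circles G"

definition genus :: "'h fmap \<Rightarrow> real" where
  "genus G = (2 + real (num_vertices G) - real (num_faces G)) / 2"

definition grade :: "'h fmap \<Rightarrow> real" where
  "grade G =
     2 * (2 + real (num_vertices G) - real (num_faces G) / 2 - real (num_od_loops G))"

text \<open>Removing edges leaves their half-edges dangling: these become fixed points of \<open>mate\<close>.\<close>

definition delete_edges :: "'h fmap \<Rightarrow> 'h set \<Rightarrow> 'h fmap" where
  "delete_edges G D = G\<lparr>mate := (\<lambda>d. if d \<in> D then d else mate G d)\<rparr>"

definition two_PR :: "'h fmap \<Rightarrow> bool" where
  "two_PR G \<longleftrightarrow>
     (\<exists>e\<in>edges G. \<exists>e'\<in>edges G. e \<noteq> e' \<and>
        num_components (delete_edges G (e \<union> e')) > num_components G)"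

abbreviation two_PI :: "'h fmap \<Rightarrow> bool" where
  "two_PI G \<equiv> \<not> two_PR G"

text \<open>Here \<open>x\<close> and \<open>y\<close> are the legs at the two vertices.\<close>

definition melon_free :: "'h fmap \<Rightarrow> bool" where
  "melon_free G \<longleftrightarrow>
     \<not> (\<exists>x\<in>halves G. \<exists>y\<in>halves G. vertex G x \<noteq> vertex G y \<and>
          mate G (rot G x) = (rot G ^^ 3) y \<and>
          mate G ((rot G ^^ 2) x) = (rot G ^^ 2) y \<and>
          mate G ((rot G ^^ 3) x) = rot G y)"

text \<open>
  A dipole or ladder is given by all half-edges at its vertices and by its two sides, each of which
  is a pair of legs, a leg being one of these half-edges. The order of the two sides, and of the
  two legs on a side, does not matter: the predicates for dipoles and ladders below hold for
  all the orders needed.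
\<close>

record 'h piece =
  body :: "'h set"
  side1 :: "'h \<times> 'h"
  side2 :: "'h \<times> 'h"

definition legs_of :: "'h \<times> 'h \<Rightarrow> 'h set" where
  "legs_of s = {fst s, snd s}"

text \<open>
  The O(D)-loop arrives at the first vertex through \<open>p\<close>, leaves it opposite to \<open>p\<close> and arrives at the
  second vertex through \<open>q\<close>. The legs on its right are those following \<open>p\<close> and \<open>q\<close>
  counterclockwise. The two senses of traversal give the two orders of the sides.
\<close>

definition N_dipole :: "'h fmap \<Rightarrow> 'h piece \<Rightarrow> bool" where
  "N_dipole G X \<longleftrightarrow>
     (\<exists>p\<in>halves G. let q = mate G ((rot G ^^ 2) p) in
        vertex G p \<noteq> vertex G q \<and> od_length G (od_loop G p) = 2 \<and>
        X = \<lparr>body = vertex G p \<union> vertex G q,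
             side1 = (rot G p, rot G q),
             side2 = ((rot G ^^ 3) p, (rot G ^^ 3) q)\<rparr>)"

text \<open>
  The edges are \<open>e\<^sub>1\<close>, from \<open>d\<close> to \<open>rot d'\<close>, and \<open>e\<^sub>2\<close>, from \<open>d'\<close> to \<open>rot d\<close>, where \<open>d\<close> and \<open>d'\<close> are the
  two half-edges of the walk around the face. The first side is opposite to \<open>e\<^sub>1\<close>, the second one
  to \<open>e\<^sub>2\<close>. Exchanging \<open>d\<close> and \<open>d'\<close> exchanges the sides.
\<close>

definition face_dipole_at :: "'h fmap \<Rightarrow> 'h \<Rightarrow> 'h piece \<Rightarrow> bool" where
  "face_dipole_at G d X \<longleftrightarrow>
     (let d' = face_step G d in
        vertex G d \<noteq> vertex G d' \<and> card (face G d) = 2 \<and>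
        X = \<lparr>body = vertex G d \<union> vertex G d',
             side1 = ((rot G ^^ 2) d, (rot G ^^ 3) d'),
             side2 = ((rot G ^^ 3) d, (rot G ^^ 2) d')\<rparr>)"

definition L_dipole :: "'h fmap \<Rightarrow> 'h piece \<Rightarrow> bool" where
  "L_dipole G X \<longleftrightarrow> (\<exists>d\<in>outs G. face_dipole_at G d X)"

definition R_dipole :: "'h fmap \<Rightarrow> 'h piece \<Rightarrow> bool" where
  "R_dipole G X \<longleftrightarrow> (\<exists>d\<in>halves G - outs G. face_dipole_at G d X)"

definition dipole :: "'h fmap \<Rightarrow> 'h piece \<Rightarrow> bool" where
  "dipole G X \<longleftrightarrow> N_dipole G X \<or> L_dipole G X \<or> R_dipole G X"

definition ladder_of :: "('h piece \<Rightarrow> bool) \<Rightarrow> 'h fmap \<Rightarrow> 'h piece \<Rightarrow> bool" where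
  "ladder_of P G X \<longleftrightarrow>
     (\<exists>ds. length ds \<ge> 2 \<and> (\<forall>D\<in>set ds. P D) \<and>
        (\<forall>i j. i < j \<and> j < length ds \<longrightarrow> body (ds ! i) \<inter> body (ds ! j) = {}) \<and>
        (\<forall>i. Suc i < length ds \<longrightarrow>
           mate G ` legs_of (side2 (ds ! i)) = legs_of (side1 (ds ! Suc i))) \<and>
        X = \<lparr>body = (\<Union>D\<in>set ds. body D), side1 = side1 (hd ds), side2 = side2 (last ds)\<rparr>)"

definition ladder :: "'h fmap \<Rightarrow> 'h piece \<Rightarrow> bool" where
  "ladder G X \<longleftrightarrow> ladder_of (dipole G) G X"

definition N_ladder :: "'h fmap \<Rightarrow> 'h piece \<Rightarrow> bool" where
  "N_ladder G X \<longleftrightarrow> ladder_of (N_dipole G) G X"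

text \<open>
  Reconnection of one side \<open>(a, b)\<close>: drop the legs \<open>a\<close> and \<open>b\<close> and join the half-edges attached to
  them. If \<open>a\<close> and \<open>b\<close> are attached to each other, this creates a circle. Reconnecting the two
  sides one after the other also covers the case where a leg of one side is attached to a leg of
  the other.
\<close>

fun reconnect :: "'h \<times> 'h \<Rightarrow> ('h \<Rightarrow> 'h) \<times> nat \<Rightarrow> ('h \<Rightarrow> 'h) \<times> nat" where
  "reconnect (a, b) (m, c) =
     (if m a = b then (m(a := a, b := b), Suc c)
      else (m(m a := m b, m b := m a, a := a, b := b), c))"

definition contract :: "'h fmap \<Rightarrow> 'h piece \<Rightarrow> 'h fmap" where
  "contract G X =
     (let (m, c) = reconnect (side2 X) (reconnect (side1 X) (mate G, circles G)) in
        \<lparr>halves = halves G - body X,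
         rot = (\<lambda>d. if d \<in> body X then d else rot G d),
         mate = (\<lambda>d. if d \<in> body X then d else m d),
         outs = outs G - body X,
         circles = c\<rparr>)"

definition separating :: "'h fmap \<Rightarrow> 'h piece \<Rightarrow> bool" where
  "separating G X \<longleftrightarrow> num_components (contract G X) = num_components G + 1"

definition disjoint_union :: "'h fmap \<Rightarrow> 'h fmap \<Rightarrow> 'h fmap" where
  "disjoint_union G1 G2 =
     \<lparr>halves = halves G1 \<union> halves G2,
      rot = (\<lambda>d. if d \<in> halves G1 then rot G1 d else rot G2 d),
      mate = (\<lambda>d. if d \<in> halves G1 then mate G1 d else mate G2 d),
      outs = outs G1 \<union> outs G2,
      circles = circles G1 + circles G2\<rparr>"

definition inserted_into :: "'h fmap \<Rightarrow> 'h piece \<Rightarrow> 'h fmap \<Rightarrow> bool" where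
  "inserted_into G X G' \<longleftrightarrow> \<not> separating G X \<and> contract G X = G'"

definition inserted_between :: "'h fmap \<Rightarrow> 'h piece \<Rightarrow> 'h fmap \<Rightarrow> 'h fmap \<Rightarrow> bool" where
  "inserted_between G X G1 G2 \<longleftrightarrow>
     separating G X \<and> halves G1 \<inter> halves G2 = {} \<and> contract G X = disjoint_union G1 G2"

text \<open>
  The reconnected edges of the contracted graph are the newly created circles and the edges of
  those half-edges that were attached to a leg.
\<close>

definition sigma :: "'h fmap \<Rightarrow> 'h piece \<Rightarrow> int" where
  "sigma G X =
     (let G' = contract G X in
        int (card {l \<in> od_loops G'. \<exists>d\<in>l. mate G d \<in> body X})
        + (int (circles G') - int (circles G))
        - int (card {l \<in> od_loops G. l \<inter> (legs_of (side1 X) \<union> legs_of (side2 X)) \<noteq> {}}))"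

definition connecting :: "'h fmap \<Rightarrow> 'h piece \<Rightarrow> bool" where
  "connecting G X \<longleftrightarrow> \<not> separating G X \<and> sigma G X = -1"

definition rearranging :: "'h fmap \<Rightarrow> 'h piece \<Rightarrow> bool" where
  "rearranging G X \<longleftrightarrow> \<not> separating G X \<and> sigma G X = 0"

text \<open>
  The edges cut are those of the outgoing half-edges \<open>d1\<close> and \<open>d2\<close>. Both graphs are required to have
  half-edges, hence vertices, so that both pieces are non-empty.
\<close>

definition two_edge_connection :: "'h fmap \<Rightarrow> 'h fmap \<Rightarrow> 'h fmap \<Rightarrow> bool" where
  "two_edge_connection G G1 G2 \<longleftrightarrow>
     halves G1 \<inter> halves G2 = {} \<and>
     (\<exists>d1\<in>outs G1. \<exists>d2\<in>outs G2.
        G = (let U = disjoint_union G1 G2 in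
             U\<lparr>mate := (mate U)(d1 := mate G2 d2, mate G2 d2 := d1,
                                d2 := mate G1 d1, mate G1 d1 := d2)\<rparr>))"

definition obtained_between :: "'h fmap \<Rightarrow> 'h fmap \<Rightarrow> 'h fmap \<Rightarrow> bool" where
  "obtained_between G G1 G2 \<longleftrightarrow>
     (\<exists>X. (dipole G X \<or> ladder G X) \<and> inserted_between G X G1 G2)
     \<or> two_edge_connection G G1 G2"

end

theory Submission
  imports Defs
begin

text \<open>
  The half-edges at a vertex carry an action of the Klein four-group such that L-faces, R-faces and
  O(D)-loops are the cycles of the edge involution with one of its three involutions. For any two of
  the three kinds of cycles, \<open>v + 2 C - E - E'\<close> is non-negative (\<open>C\<close> components, \<open>E\<close> and \<open>E'\<close> cycles);
  \<open>2 g\<close> is the value for the L- and R-faces, and \<open>\<ell>\<close> is the sum of the other two values.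
  O(D)-loops have even length, so without N-dipole there are at most \<open>v / 2\<close> of them, which
  gives \<open>\<ell> \<ge> 2 + 2 g\<close>; hence the graphs considered here have N-dipoles.

  Contracting a ladder amounts to exchanging the partners of the two legs on its first side (a flip)
  and then removing a ladder closed at one end, which changes none of the above values. If the flip
  disconnects the graph, it creates one cycle of each kind, and genus and grade are additive.
  Otherwise, for an N-ladder, it creates one L-face, one R-face and \<open>\<sigma>\<close> O(D)-loops, so that \<open>g\<close> drops
  by 1 and \<open>\<ell>\<close> by \<open>2 + 2 \<sigma>\<close>; since \<open>\<ell> \<le> 2\<close> stays non-negative, \<open>\<sigma> \<le> 0\<close>.

  A melon in the contracted graph uses a reconnected edge, and if it uses only one, its two other
  edges form a dipole that prolongs the ladder. Contracting a ladder of maximal length therefore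
  leaves melon-free graphs. In the 2PI case only N-dipoles may be added to the ladder, but
  the remaining configurations produce a two-edge-cut, genus 1, or \<open>\<sigma> = 1\<close>. In the 2PR case, a two-edge-cut
  whose two closures are not both melon-free is a side of a separating dipole. Finally, a non-empty
  melon-free graph of grade 0 has positive genus, by induction on the number of vertices: contract a
  longest ladder through an N-dipole.
\<close>

section \<open>Counting connected components\<close>

text \<open>By definition \<open>\<ell> = 2 + 2 g + v - 2 \<phi>\<close>, so every upper bound on
  the number of O(D)-loops is a lower bound on the grade. Contraction changes the set of half-edges,
  whereas a flip keeps it and only re-pairs four end points; factoring contraction through flips
  makes all cycle counts comparable. The extra L-face and R-face for an N-ladder arise because the
  two legs on its first side are already joined inside the first rung by a segment of an L-face and
  by a segment of an R-face; joining the legs themselves closes both segments. A ladder of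
  \<open>n\<close> rungs closed at both ends has \<open>2 n\<close> vertices and
  \<open>n + 1\<close> cycles of each kind, one of which is created when it is split off. So its
  removal costs \<open>2 n\<close> vertices and \<open>n\<close> cycles of each kind, and
  \<open>v - E - E'\<close> stays the same. The difficulty lies in degenerate attachments: legs
  attached to each other or across the ladder, circles produced by reconnection, short O(D)-loops at
  a single vertex, and melons using both reconnected edges.\<close>

definition eqc :: "('a \<times> 'a) set \<Rightarrow> ('a \<times> 'a) set" where
  "eqc R = (R \<union> R\<inverse>)\<^sup>*"

text \<open>Classes are formed in the whole type and \<open>H\<close> only selects which of them are
  counted, so \<open>H\<close> can be split while \<open>R\<close> stays fixed.\<close>

definition ncc :: "'a set \<Rightarrow> ('a \<times> 'a) set \<Rightarrow> nat" where
  "ncc H R = card ((\<lambda>x. eqc R `` {x}) ` H)"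

lemma eqc_refl [simp, intro]: "(x, x) \<in> eqc R"
  by (simp add: eqc_def)

lemma eqc_sym: "(x, y) \<in> eqc R \<Longrightarrow> (y, x) \<in> eqc R"
  unfolding eqc_def by (metis converse_Un converse_converse rtrancl_converseI sup_commute)

lemma eqc_trans: "(x, y) \<in> eqc R \<Longrightarrow> (y, z) \<in> eqc R \<Longrightarrow> (x, z) \<in> eqc R"
  unfolding eqc_def by (rule rtrancl_trans)

lemma eqc_base: "(x, y) \<in> R \<Longrightarrow> (x, y) \<in> eqc R"
  unfolding eqc_def by auto

lemma eqc_class_eq: "eqc R `` {x} = eqc R `` {y} \<longleftrightarrow> (x, y) \<in> eqc R"
  by (blast intro: eqc_sym eqc_trans)

lemma eqc_mono: "R \<subseteq> R' \<Longrightarrow> eqc R \<subseteq> eqc R'"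
  unfolding eqc_def by (intro rtrancl_mono) auto

lemma eqc_closed:
  assumes "(x, y) \<in> eqc R" "x \<in> S" "\<And>u v. (u, v) \<in> R \<Longrightarrow> u \<in> S \<longleftrightarrow> v \<in> S"
  shows "y \<in> S"
  using assms(1) unfolding eqc_def by (induction) (use assms(2,3) in auto)

lemma eqc_subsetI:
  assumes "\<And>x y. (x, y) \<in> R \<Longrightarrow> (x, y) \<in> eqc R'"
  shows "eqc R \<subseteq> eqc R'"
proof
  fix p assume "p \<in> eqc R"
  moreover obtain x y where p: "p = (x, y)" by force
  ultimately have "(x, y) \<in> (R \<union> R\<inverse>)\<^sup>*" by (simp add: eqc_def)
  then have "(x, y) \<in> eqc R'"
    by induction (use assms in \<open>blast intro: eqc_sym eqc_trans\<close>)+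
  then show "p \<in> eqc R'" using p by simp
qed

text \<open>Both images are copies of the quotient of \<open>A\<close> by the same kernel.\<close>

lemma card_image_cong_eq:
  assumes "\<And>x y. x \<in> A \<Longrightarrow> y \<in> A \<Longrightarrow> f x = f y \<longleftrightarrow> g x = g y"
  shows "card (f ` A) = card (g ` A)"
proof -
  have "bij_betw (\<lambda>z. g (inv_into A f z)) (f ` A) (g ` A)"
  proof (rule bij_betwI')
    have *: "inv_into A f (f a) \<in> A" "f (inv_into A f (f a)) = f a" if "a \<in> A" for a
      using that by (simp_all add: inv_into_into f_inv_into_f)
    show "g (inv_into A f x) = g (inv_into A f y) \<longleftrightarrow> x = y" if xy: "x \<in> f ` A" "y \<in> f ` A" for x y
    proof -
      obtain a b where ab: "a \<in> A" "x = f a" "b \<in> A" "y = f b" using xy by blast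
      show ?thesis using assms[of "inv_into A f x" "inv_into A f y"] *[OF ab(1)] *[OF ab(3)] ab by simp
    qed
    show "g (inv_into A f x) \<in> g ` A" if "x \<in> f ` A" for x
      using that * by blast
    show "\<exists>x\<in>f ` A. y = g (inv_into A f x)" if y: "y \<in> g ` A" for y
    proof -
      obtain a where a: "a \<in> A" "y = g a" using y by blast
      then have "g a = g (inv_into A f (f a))" using assms[of "inv_into A f (f a)" a] *[OF a(1)] by simp
      then show ?thesis using a by blast
    qed
  qed
  then show ?thesis by (rule bij_betw_same_card)
qed

lemma ncc_cong:
  assumes "\<And>x y. x \<in> H \<Longrightarrow> y \<in> H \<Longrightarrow> (x, y) \<in> eqc R \<longleftrightarrow> (x, y) \<in> eqc R'"
  shows "ncc H R = ncc H R'"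
  unfolding ncc_def by (rule card_image_cong_eq) (use assms in \<open>simp add: eqc_class_eq\<close>)

text \<open>A path through the new edge can be shortened so that it uses this edge at most
  once.\<close>

lemma eqc_insert:
  "(x, y) \<in> eqc (insert (u, v) R) \<longleftrightarrow>
     (x, y) \<in> eqc R \<or> (x, u) \<in> eqc R \<and> (v, y) \<in> eqc R \<or> (x, v) \<in> eqc R \<and> (u, y) \<in> eqc R"
  (is "_ \<longleftrightarrow> ?P x y")
proof
  assume "(x, y) \<in> eqc (insert (u, v) R)"
  then have "(x, y) \<in> (insert (u, v) R \<union> (insert (u, v) R)\<inverse>)\<^sup>*" by (simp add: eqc_def)
  then show "?P x y"
  proof induction
    case (step y z)
    have "(y, z) \<in> eqc R \<or> y = u \<and> z = v \<or> y = v \<and> z = u"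
      using step.hyps(2) by (auto intro: eqc_base eqc_sym)
    then show ?case
    proof (elim disjE conjE)
      assume "(y, z) \<in> eqc R"
      then show ?case using step.IH eqc_trans[of _ y R z] by metis
    next
      assume "y = u" "z = v"
      then show ?case using step.IH eqc_sym[of v u] eqc_refl[of v] eqc_refl[of u] by (metis eqc_trans)
    next
      assume "y = v" "z = u"
      then show ?case using step.IH eqc_sym[of v u] eqc_refl[of v] eqc_refl[of u] by (metis eqc_trans)
    qed
  qed simp
next
  have le: "p \<in> eqc (insert (u, v) R)" if "p \<in> eqc R" for p
    using that eqc_mono[of R "insert (u, v) R"] by auto
  have uv: "(u, v) \<in> eqc (insert (u, v) R)" by (rule eqc_base) simp
  assume "?P x y"
  then show "(x, y) \<in> eqc (insert (u, v) R)"
    using eqc_trans[OF eqc_trans[OF le uv] le] eqc_trans[OF eqc_trans[OF le eqc_sym[OF uv]] le] le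
    by auto
qed

lemma eqc_insert_absorb:
  assumes "(u, v) \<in> eqc R"
  shows "eqc (insert (u, v) R) = eqc R"
proof (rule antisym)
  show "eqc (insert (u, v) R) \<subseteq> eqc R" by (rule eqc_subsetI) (use assms eqc_base in auto)
qed (auto intro!: eqc_mono)

text \<open>A new edge merges the classes of its end points. When they differ, the class of
  \<open>u\<close> is set aside: on the remaining elements the old and the new relation agree, and
  \<open>v\<close> still represents the merged class.\<close>

lemma ncc_insert:
  assumes "finite H" "u \<in> H" "v \<in> H"
  shows "ncc H R = ncc H (insert (u, v) R) + of_bool ((u, v) \<notin> eqc R)"
proof (cases "(u, v) \<in> eqc R")
  case True
  then have "ncc H R = ncc H (insert (u, v) R)"
    unfolding ncc_def eqc_insert_absorb[OF True] by simp
  then show ?thesis using True by simp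
next
  case False
  let ?R' = "insert (u, v) R"
  define H' where "H' = {x \<in> H. (x, u) \<notin> eqc R}"
  have vH': "v \<in> H'" using assms False by (auto simp: H'_def dest: eqc_sym)
  have "(\<lambda>x. eqc R `` {x}) ` H = insert (eqc R `` {u}) ((\<lambda>x. eqc R `` {x}) ` H')"
    using assms(2) by (auto simp: H'_def eqc_class_eq image_iff) (metis eqc_class_eq)+
  moreover have "eqc R `` {u} \<notin> (\<lambda>x. eqc R `` {x}) ` H'"
    by (auto simp: H'_def eqc_class_eq dest: eqc_sym)
  moreover have "finite H'" using assms by (simp add: H'_def)
  ultimately have 1: "ncc H R = Suc (ncc H' R)" by (simp add: ncc_def)
  have 2: "ncc H' R = ncc H' ?R'"
    by (intro ncc_cong) (auto simp: eqc_insert H'_def dest: eqc_sym)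
  have "eqc ?R' `` {x} \<in> (\<lambda>x. eqc ?R' `` {x}) ` H'" if "x \<in> H" for x
  proof (cases "(x, u) \<in> eqc R")
    case True
    then have "eqc ?R' `` {x} = eqc ?R' `` {v}"
      by (subst eqc_class_eq) (auto simp: eqc_insert)
    then show ?thesis using vH' by auto
  qed (use that in \<open>auto simp: H'_def\<close>)
  then have "(\<lambda>x. eqc ?R' `` {x}) ` H = (\<lambda>x. eqc ?R' `` {x}) ` H'"
    by (auto simp: H'_def)
  then have "ncc H ?R' = ncc H' ?R'" by (simp add: ncc_def)
  then show ?thesis using 1 2 False by simp
qed

lemma ncc_Un:
  assumes "finite A" "finite B" "A \<inter> B = {}"
    and "\<And>u v. (u, v) \<in> R \<Longrightarrow> u \<in> A \<longleftrightarrow> v \<in> A"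
  shows "ncc (A \<union> B) R = ncc A R + ncc B R"
proof -
  have "eqc R `` {x} \<noteq> eqc R `` {y}" if "x \<in> A" "y \<in> B" for x y
    using that assms(3,4) eqc_closed[of x y R A] by (auto simp: eqc_class_eq)
  then have "(\<lambda>x. eqc R `` {x}) ` A \<inter> (\<lambda>x. eqc R `` {x}) ` B = {}" by blast
  then show ?thesis using assms by (simp add: ncc_def image_Un card_Un_disjoint)
qed

lemma ncc_one:
  assumes "x \<in> H" "\<And>y. y \<in> H \<Longrightarrow> (x, y) \<in> eqc R"
  shows "ncc H R = 1"
proof -
  have "(\<lambda>x. eqc R `` {x}) ` H = {eqc R `` {x}}"
    using assms by (auto simp: eqc_class_eq) (metis eqc_class_eq eqc_sym)+
  then show ?thesis by (simp add: ncc_def)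
qed

lemma ncc_oneD:
  assumes "ncc H R = 1" "x \<in> H" "y \<in> H"
  shows "(x, y) \<in> eqc R"
proof -
  obtain K where "(\<lambda>x. eqc R `` {x}) ` H = {K}"
    using assms(1) unfolding ncc_def by (rule card_1_singletonE)
  then have "eqc R `` {x} = K" "eqc R `` {y} = K"
    using imageI[OF assms(2), of "\<lambda>x. eqc R `` {x}"] imageI[OF assms(3), of "\<lambda>x. eqc R `` {x}"] by auto
  then show ?thesis by (simp add: eqc_class_eq[symmetric])
qed

lemma ncc_pos: "finite H \<Longrightarrow> H \<noteq> {} \<Longrightarrow> 0 < ncc H R"
  by (simp add: ncc_def card_gt_0_iff)

lemma ncc_empty [simp]: "ncc {} R = 0"
  by (simp add: ncc_def)

lemma sum_card_classes:
  assumes "finite H" "\<And>x. x \<in> H \<Longrightarrow> eqc R `` {x} \<subseteq> H"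
  shows "sum card ((\<lambda>x. eqc R `` {x}) ` H) = card H"
proof -
  let ?P = "(\<lambda>x. eqc R `` {x}) ` H"
  have "card (\<Union> ?P) = sum card ?P"
  proof (rule card_Union_disjoint)
    show "pairwise disjnt ?P"
      unfolding pairwise_def disjnt_def by (auto simp: eqc_class_eq) (metis eqc_trans eqc_sym)+
    show "\<And>X. X \<in> ?P \<Longrightarrow> finite X" using assms by (auto intro: finite_subset)
  qed
  moreover have "\<Union> ?P = H" using assms(2) by auto
  ultimately show ?thesis by simp
qed

lemma ncc_card_class:
  assumes "finite H" "\<And>x. x \<in> H \<Longrightarrow> eqc R `` {x} \<subseteq> H"
    and "\<And>x. x \<in> H \<Longrightarrow> k \<le> card (eqc R `` {x})"
  shows "k * ncc H R \<le> card H"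
proof -
  have "(\<Sum>X\<in>(\<lambda>x. eqc R `` {x}) ` H. k) \<le> sum card ((\<lambda>x. eqc R `` {x}) ` H)"
    by (rule sum_mono) (use assms(3) in auto)
  then show ?thesis using sum_card_classes[OF assms(1,2)] by (simp add: ncc_def mult.commute)
qed

lemma ncc_card_class_eq:
  assumes "finite H" "\<And>x. x \<in> H \<Longrightarrow> eqc R `` {x} \<subseteq> H"
    and "\<And>x. x \<in> H \<Longrightarrow> card (eqc R `` {x}) = k"
  shows "k * ncc H R = card H"
proof -
  have "sum card ((\<lambda>x. eqc R `` {x}) ` H) = (\<Sum>X\<in>(\<lambda>x. eqc R `` {x}) ` H. k)"
    by (rule sum.cong) (use assms(3) in auto)
  then show ?thesis using sum_card_classes[OF assms(1,2)] by (simp add: ncc_def mult.commute)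
qed

text \<open>The fourth assumption makes the edge \<open>(a, x)\<close> redundant once
  \<open>(b, y)\<close> is present, so that two edges merge at most two classes into one; the third
  one lets the merging be tested on either edge.\<close>

lemma ncc_pair_edges:
  assumes "finite H" "{a, x, b, y} \<subseteq> H"
    and "(a, x) \<in> eqc R \<longleftrightarrow> (b, y) \<in> eqc R"
    and "(a, x) \<in> eqc R \<or> (a, b) \<in> eqc R \<and> (x, y) \<in> eqc R \<or> (a, y) \<in> eqc R \<and> (b, x) \<in> eqc R"
  shows "ncc H R = ncc H (insert (a, x) (insert (b, y) R)) + of_bool ((a, x) \<notin> eqc R)"
proof -
  have "ncc H R = ncc H (insert (b, y) R) + of_bool ((b, y) \<notin> eqc R)"
    using assms by (intro ncc_insert) auto
  moreover have "ncc H (insert (b, y) R) =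
      ncc H (insert (a, x) (insert (b, y) R)) + of_bool ((a, x) \<notin> eqc (insert (b, y) R))"
    using assms by (intro ncc_insert) auto
  moreover have "(a, x) \<in> eqc (insert (b, y) R)"
    using assms(4) by (auto simp: eqc_insert intro: eqc_sym)
  ultimately show ?thesis using assms(3) by simp
qed

section \<open>Involutions and flips\<close>

definition gr :: "'a set \<Rightarrow> ('a \<Rightarrow> 'a) set \<Rightarrow> ('a \<times> 'a) set" where
  "gr H F = {(x, f x) | x f. x \<in> H \<and> f \<in> F}"

definition fpf_inv :: "'a set \<Rightarrow> ('a \<Rightarrow> 'a) \<Rightarrow> bool" where
  "fpf_inv H f \<longleftrightarrow> (\<forall>x\<in>H. f x \<in> H \<and> f (f x) = x \<and> f x \<noteq> x)"

lemma fpf_invD: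
  assumes "fpf_inv H f" "x \<in> H"
  shows "f x \<in> H" "f (f x) = x" "f x \<noteq> x"
  using assms by (auto simp: fpf_inv_def)

lemma gr_iff: "(x, y) \<in> gr H F \<longleftrightarrow> x \<in> H \<and> (\<exists>f\<in>F. y = f x)"
  by (auto simp: gr_def)

lemma gr_insert: "gr H (insert f F) = gr H {f} \<union> gr H F"
  by (auto simp: gr_def)

text \<open>A set closed under involutions is closed under their inverses, so the symmetric closure
  inside \<open>eqc\<close> costs nothing.\<close>

lemma gr_closed_class:
  assumes "\<And>f. f \<in> F \<Longrightarrow> fpf_inv H f" "S \<subseteq> H" "\<And>f x. f \<in> F \<Longrightarrow> x \<in> S \<Longrightarrow> f x \<in> S" "x \<in> S"
  shows "eqc (gr H F) `` {x} \<subseteq> S"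
proof
  fix y assume "y \<in> eqc (gr H F) `` {x}"
  then have "(x, y) \<in> eqc (gr H F)" by simp
  then show "y \<in> S"
    by (rule eqc_closed) (use assms in \<open>force simp: gr_iff fpf_inv_def\<close>)+
qed

lemma even_card_fpf:
  assumes "finite S" "fpf_inv S f"
  shows "even (card S)"
  using assms
proof (induction "card S" arbitrary: S rule: less_induct)
  case less
  show ?case
  proof (cases "S = {}")
    case False
    then obtain x where x: "x \<in> S" by auto
    let ?T = "S - {x, f x}"
    have fx: "f x \<in> S" "f x \<noteq> x" "f (f x) = x" using less.prems x by (auto simp: fpf_inv_def)
    have c: "card S = card ?T + 2"
      using x fx less.prems(1) card_Diff_subset[of "{x, f x}" S] card_mono[of S "{x, f x}"] by auto
    have "fpf_inv ?T f" using less.prems(2) fx unfolding fpf_inv_def by (metis DiffE DiffI insertE insertI1 insertI2 singletonD)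
    then have "even (card ?T)" using less.hyps[of ?T] c less.prems(1) by simp
    then show ?thesis using c by simp
  qed simp
qed

text \<open>The switch of the two edges at \<open>a\<close> and \<open>b\<close>. If they are one
  and the same edge of an involution, the order of the updates makes it the identity
  operation.\<close>

definition flip :: "'a \<Rightarrow> 'a \<Rightarrow> ('a \<Rightarrow> 'a) \<Rightarrow> 'a \<Rightarrow> 'a" where
  "flip a b m = m(m a := m b, m b := m a, a := b, b := a)"

lemma fpf_inv_flip:
  assumes "fpf_inv H m" "a \<in> H" "b \<in> H" "a \<noteq> b"
  shows "fpf_inv H (flip a b m)"
proof -
  have "m a = m b \<longleftrightarrow> a = b" using assms by (metis fpf_inv_def)
  then show ?thesis
    using assms unfolding fpf_inv_def flip_def by (auto; metis)
qed

text \<open>A switch joins the two near ends and the two far ends, so it does not matter which of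
  these pairs is named.\<close>

lemma flip_mates:
  assumes "fpf_inv H m" "a \<in> H" "b \<in> H" "a \<noteq> b"
  shows "flip (m a) (m b) m = flip a b m"
  using assms by (auto simp: flip_def fpf_inv_def fun_eq_iff)

text \<open>Here \<open>x\<close> and \<open>z\<close> stand for \<open>m a\<close> and
  \<open>m b\<close>. An equivalence on four points with classes of even size has one class or two
  pairs. Transitivity is spelled out propositionally so that everything is decided by boolean
  cases.\<close>

lemma even_classes:
  assumes "ab \<and> bx \<longrightarrow> ax" "ab \<and> ax \<longrightarrow> bx" "ax \<and> bx \<longrightarrow> ab"
    "ab \<and> bz \<longrightarrow> az" "ab \<and> az \<longrightarrow> bz" "az \<and> bz \<longrightarrow> ab"
    "ax \<and> xz \<longrightarrow> az" "ax \<and> az \<longrightarrow> xz" "az \<and> xz \<longrightarrow> ax"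
    "bx \<and> xz \<longrightarrow> bz" "bx \<and> bz \<longrightarrow> xz" "bz \<and> xz \<longrightarrow> bx"
    and "even (1 + of_bool ab + of_bool ax + of_bool az :: nat)"
    "even (of_bool ab + 1 + of_bool bx + of_bool bz :: nat)"
    "even (of_bool ax + of_bool bx + 1 + of_bool xz :: nat)"
    "even (of_bool az + of_bool bz + of_bool xz + 1 :: nat)"
  shows "(ab \<longleftrightarrow> xz) \<and> (ax \<longleftrightarrow> bz) \<and> (az \<longleftrightarrow> bx) \<and> (ab \<or> ax \<or> az)"
proof -
  have "ab \<noteq> (ax \<noteq> az)" using assms(13) by (cases ab; cases ax; cases az) simp_all
  moreover have "ab \<noteq> (bx \<noteq> bz)" using assms(14) by (cases ab; cases bx; cases bz) simp_all
  moreover have "ax \<noteq> (bx \<noteq> xz)" using assms(15) by (cases ax; cases bx; cases xz) simp_all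
  moreover have "az \<noteq> (bz \<noteq> xz)" using assms(16) by (cases az; cases bz; cases xz) simp_all
  ultimately show ?thesis using assms(1-12) by argo
qed

text \<open>The number of components drops by at most one when an edge is added; the parity of the number
  of end points in each component makes the effect of adding two edges determined by the pairing
  of their end points.\<close>

locale flip_setting =
  fixes H :: "'a set" and m :: "'a \<Rightarrow> 'a" and F :: "('a \<Rightarrow> 'a) set" and a b :: 'a
  assumes fin: "finite H" and m: "fpf_inv H m" and F: "\<And>f. f \<in> F \<Longrightarrow> fpf_inv H f" and ne: "F \<noteq> {}"
    and ab: "a \<in> H" "b \<in> H" "a \<noteq> b" "m a \<noteq> b"
begin

text \<open>Both edges to be switched are left out, so the graphs before and after the flip arise
  from \<open>R0\<close> by adding two edges each.\<close>

definition R0 where "R0 = gr H F \<union> gr (H - {a, b, m a, m b}) {m}"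

lemma dist: "m a \<in> H" "m b \<in> H" "m a \<noteq> a" "m b \<noteq> b" "m a \<noteq> m b" "m b \<noteq> a"
    "m (m a) = a" "m (m b) = b"
  using m ab by (auto simp: fpf_inv_def) metis+

lemma R0_closed: "(u, v) \<in> eqc R0 \<Longrightarrow> u \<in> S \<Longrightarrow> (\<And>f x. f \<in> F \<Longrightarrow> x \<in> S \<inter> H \<Longrightarrow> f x \<in> S) \<Longrightarrow>
   (\<And>x. x \<in> S \<inter> H - {a, b, m a, m b} \<Longrightarrow> m x \<in> S) \<Longrightarrow> v \<in> S"
proof (erule eqc_closed, assumption)
  fix u v assume A: "\<And>f x. f \<in> F \<Longrightarrow> x \<in> S \<inter> H \<Longrightarrow> f x \<in> S"
    "\<And>x. x \<in> S \<inter> H - {a, b, m a, m b} \<Longrightarrow> m x \<in> S" "(u, v) \<in> R0"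
  from A(3) consider f where "f \<in> F" "u \<in> H" "v = f u" | "u \<in> H - {a, b, m a, m b}" "v = m u"
    by (auto simp: R0_def gr_def)
  then show "u \<in> S \<longleftrightarrow> v \<in> S"
  proof cases
    case 1
    then have "v \<in> H" "f v = u" using F[of f] by (auto simp: fpf_inv_def)
    then show ?thesis using 1 A(1)[of f u] A(1)[of f v] by auto
  next
    case 2
    then have "v \<in> H - {a, b, m a, m b}" "m v = u"
      using m dist ab unfolding fpf_inv_def by (metis DiffD1 DiffD2 DiffI insertCI insertE singletonD)+
    then show ?thesis using 2 A(2)[of u] A(2)[of v] by auto
  qed
qed

text \<open>Any \<open>f\<close> in \<open>F\<close> pairs off the whole class, and \<open>m\<close>
  pairs off the class without the four end points; the difference is even.\<close>

lemma par:
  assumes "p \<in> H"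
  shows "even (card (eqc R0 `` {p} \<inter> {a, b, m a, m b}))"
proof -
  let ?K = "eqc R0 `` {p}"
  have KH: "?K \<subseteq> H"
    using R0_closed[of p _ H] F m assms by (auto simp: fpf_inv_def)
  obtain f where f: "f \<in> F" using ne by auto
  have "(x, f x) \<in> R0" if "x \<in> H" for x
    using that f by (auto simp: R0_def gr_def)
  then have "fpf_inv ?K f"
    using F[OF f] KH unfolding fpf_inv_def by (auto intro: eqc_trans[OF _ eqc_base])
  then have 1: "even (card ?K)" using KH fin by (meson even_card_fpf finite_subset)
  have mR: "(x, m x) \<in> R0" if "x \<in> H - {a, b, m a, m b}" for x
    using that by (auto simp: R0_def gr_def)
  have "fpf_inv (?K - {a, b, m a, m b}) m"
  proof (unfold fpf_inv_def, intro ballI conjI)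
    fix x assume x: "x \<in> ?K - {a, b, m a, m b}"
    then have xH: "x \<in> H - {a, b, m a, m b}" using KH by auto
    then show "m (m x) = x" "m x \<noteq> x" using m by (auto simp: fpf_inv_def)
    have "m x \<notin> {a, b, m a, m b}" using xH \<open>m (m x) = x\<close> dist by auto
    then show "m x \<in> ?K - {a, b, m a, m b}" using mR[OF xH] x by (auto intro: eqc_trans eqc_base)
  qed
  then have 2: "even (card (?K - {a, b, m a, m b}))" using KH fin by (meson even_card_fpf finite_subset finite_Diff)
  have "card ?K = card (?K - {a, b, m a, m b}) + card (?K \<inter> {a, b, m a, m b})"
    using KH fin by (metis card_Diff_subset_Int card_mono finite_Int finite_subset inf_le1 le_add_diff_inverse2)
  then show ?thesis using 1 2 by presburger
qed

lemma pairing: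
  shows "(a, b) \<in> eqc R0 \<longleftrightarrow> (m a, m b) \<in> eqc R0"
    and "(a, m a) \<in> eqc R0 \<longleftrightarrow> (b, m b) \<in> eqc R0"
    and "(a, m b) \<in> eqc R0 \<longleftrightarrow> (b, m a) \<in> eqc R0"
    and "(a, b) \<in> eqc R0 \<or> (a, m a) \<in> eqc R0 \<or> (a, m b) \<in> eqc R0"
proof -
  let ?e = "\<lambda>u v. (u, v) \<in> eqc R0"
  have split: "card (eqc R0 `` {p} \<inter> {a, b, m a, m b}) =
     of_bool (?e p a) + of_bool (?e p b) + of_bool (?e p (m a)) + of_bool (?e p (m b))" for p
    using ab dist by (auto simp: Int_insert_right)
  note parities = par[OF ab(1), unfolded split] par[OF ab(2), unfolded split]
      par[OF dist(1), unfolded split] par[OF dist(2), unfolded split]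
  have tr: "?e u v \<Longrightarrow> ?e v w \<Longrightarrow> ?e u w" and sy: "?e u v \<longleftrightarrow> ?e v u" for u v w
    by (blast intro: eqc_trans eqc_sym)+
  have T: "?e a b \<and> ?e b (m a) \<longrightarrow> ?e a (m a)" "?e a b \<and> ?e a (m a) \<longrightarrow> ?e b (m a)" "?e a (m a) \<and> ?e b (m a) \<longrightarrow> ?e a b"
    "?e a b \<and> ?e b (m b) \<longrightarrow> ?e a (m b)" "?e a b \<and> ?e a (m b) \<longrightarrow> ?e b (m b)" "?e a (m b) \<and> ?e b (m b) \<longrightarrow> ?e a b"
    "?e a (m a) \<and> ?e (m a) (m b) \<longrightarrow> ?e a (m b)" "?e a (m a) \<and> ?e a (m b) \<longrightarrow> ?e (m a) (m b)" "?e a (m b) \<and> ?e (m a) (m b) \<longrightarrow> ?e a (m a)"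
    "?e b (m a) \<and> ?e (m a) (m b) \<longrightarrow> ?e b (m b)" "?e b (m a) \<and> ?e b (m b) \<longrightarrow> ?e (m a) (m b)" "?e b (m b) \<and> ?e (m a) (m b) \<longrightarrow> ?e b (m a)"
    by (blast intro: tr sy[THEN iffD1])+
  have S: "?e b a = ?e a b" "?e (m a) a = ?e a (m a)" "?e (m b) a = ?e a (m b)" "?e (m a) b = ?e b (m a)"
     "?e (m b) b = ?e b (m b)" "?e (m b) (m a) = ?e (m a) (m b)"
    by (rule sy)+
  note * = even_classes[OF T parities[unfolded S eqc_refl[THEN eqTrueI] of_bool_eq(2)]]
  show "?e a b \<longleftrightarrow> ?e (m a) (m b)" "?e a (m a) \<longleftrightarrow> ?e b (m b)" "?e a (m b) \<longleftrightarrow> ?e b (m a)"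
    "?e a b \<or> ?e a (m a) \<or> ?e a (m b)"
    using * by blast+
qed

lemma before_eq: "eqc (gr H (insert m F)) = eqc (insert (a, m a) (insert (b, m b) R0))"
proof -
  have "gr H {m} = gr (H - {a, b, m a, m b}) {m} \<union> {(a, m a), (m a, a), (b, m b), (m b, b)}"
    using ab dist by (auto simp: gr_def)
  then have "gr H (insert m F) \<union> (gr H (insert m F))\<inverse> =
    insert (a, m a) (insert (b, m b) R0) \<union> (insert (a, m a) (insert (b, m b) R0))\<inverse>"
    unfolding R0_def gr_insert[of H m F] by auto
  then show ?thesis unfolding eqc_def by simp
qed

lemma after_eq: "eqc (gr H (insert (flip a b m) F)) = eqc (insert (a, b) (insert (m a, m b) R0))"
proof -
  have "gr H {flip a b m} = gr (H - {a, b, m a, m b}) {m} \<union> {(a, b), (b, a), (m a, m b), (m b, m a)}"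
  proof (intro set_eqI iffI)
    fix p assume "p \<in> gr H {flip a b m}"
    then obtain x where x: "x \<in> H" "p = (x, flip a b m x)" by (auto simp: gr_def)
    show "p \<in> gr (H - {a, b, m a, m b}) {m} \<union> {(a, b), (b, a), (m a, m b), (m b, m a)}"
    proof (cases "x \<in> {a, b, m a, m b}")
      case True
      then show ?thesis using x(2) ab dist unfolding flip_def by fastforce
    next
      case False
      then have "flip a b m x = m x" by (simp add: flip_def)
      then show ?thesis using x False by (simp add: gr_iff)
    qed
  next
    fix p assume p: "p \<in> gr (H - {a, b, m a, m b}) {m} \<union> {(a, b), (b, a), (m a, m b), (m b, m a)}"
    have *: "flip a b m a = b" "flip a b m b = a" "flip a b m (m a) = m b" "flip a b m (m b) = m a"
      "x \<notin> {a, b, m a, m b} \<Longrightarrow> flip a b m x = m x" for x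
      using ab dist by (auto simp: flip_def)
    show "p \<in> gr H {flip a b m}"
    proof (cases "p \<in> {(a, b), (b, a), (m a, m b), (m b, m a)}")
      case True
      then show ?thesis using *(1-4) ab dist by (elim insertE) (simp_all add: gr_iff)
    next
      case False
      then obtain x where x: "p = (x, m x)" "x \<in> H - {a, b, m a, m b}" using p by (auto simp: gr_def)
      then show ?thesis using *(5)[of x] by (simp add: gr_iff)
    qed
  qed
  then have "gr H (insert (flip a b m) F) \<union> (gr H (insert (flip a b m) F))\<inverse> =
    insert (a, b) (insert (m a, m b) R0) \<union> (insert (a, b) (insert (m a, m b) R0))\<inverse>"
    unfolding R0_def gr_insert[of H "flip a b m" F] by auto
  then show ?thesis unfolding eqc_def by simp
qed

lemma before: "ncc H R0 = ncc H (gr H (insert m F)) + of_bool ((a, m a) \<notin> eqc R0)"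
proof -
  have "ncc H (gr H (insert m F)) = ncc H (insert (a, m a) (insert (b, m b) R0))"
    by (simp add: ncc_def before_eq)
  then show ?thesis using ncc_pair_edges[of H a "m a" b "m b" R0] fin ab dist pairing by auto
qed

lemma after: "ncc H R0 = ncc H (gr H (insert (flip a b m) F)) + of_bool ((a, b) \<notin> eqc R0)"
proof -
  have "ncc H (gr H (insert (flip a b m) F)) = ncc H (insert (a, b) (insert (m a, m b) R0))"
    by (simp add: ncc_def after_eq)
  then show ?thesis
    using ncc_pair_edges[of H a b "m a" "m b" R0] fin ab dist pairing eqc_sym[of b "m a" R0]
      eqc_sym[of "m a" b R0] by auto
qed

lemma flip_bounds:
  "ncc H (gr H (insert m F)) \<le> Suc (ncc H (gr H (insert (flip a b m) F)))"
  "ncc H (gr H (insert (flip a b m) F)) \<le> Suc (ncc H (gr H (insert m F)))"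
  using before after by (simp_all add: of_bool_def split: if_splits)

text \<open>If a closed set separates \<open>a\<close> and \<open>b\<close> from their mates, parity
  leaves only the pairing of \<open>a\<close> with \<open>b\<close>. The old edges then merge two
  classes, while the new ones merge nothing.\<close>

lemma flip_split:
  assumes "a \<in> S" "b \<in> S" "m a \<notin> S" "m b \<notin> S"
    and "\<And>f x. f \<in> F \<Longrightarrow> x \<in> S \<inter> H \<Longrightarrow> f x \<in> S" "\<And>x. x \<in> S \<inter> H - {a, b} \<Longrightarrow> m x \<in> S"
  shows "ncc H (gr H (insert (flip a b m) F)) = Suc (ncc H (gr H (insert m F)))"
proof -
  have "(a, m a) \<notin> eqc R0" "(a, m b) \<notin> eqc R0"
    using R0_closed[of a _ S] assms by blast+
  then show ?thesis using before after pairing(4) by simp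
qed

lemma flip_split':
  assumes "m a \<in> S" "m b \<in> S" "a \<notin> S" "b \<notin> S"
    and "\<And>f x. f \<in> F \<Longrightarrow> x \<in> S \<inter> H \<Longrightarrow> f x \<in> S" "\<And>x. x \<in> S \<inter> H - {m a, m b} \<Longrightarrow> m x \<in> S"
  shows "ncc H (gr H (insert (flip a b m) F)) = Suc (ncc H (gr H (insert m F)))"
proof -
  have "(m a, a) \<notin> eqc R0" "(m a, b) \<notin> eqc R0"
    using R0_closed[of "m a" _ S] assms by blast+
  then have "(a, m a) \<notin> eqc R0" "(a, m b) \<notin> eqc R0" using pairing by (blast intro: eqc_sym)+
  then show ?thesis using before after pairing(4) by simp
qed

text \<open>The new edges merge nothing, as \<open>a\<close> and \<open>b\<close> are joined
  already. The count grows only if the old edges merged two classes, and then the class of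
  \<open>m a\<close> without these edges is the part that is cut off.\<close>

lemma flip_connected:
  assumes "(a, b) \<in> eqc R0"
  shows "ncc H (gr H (insert (flip a b m) F)) = ncc H (gr H (insert m F)) \<or>
    ncc H (gr H (insert (flip a b m) F)) = Suc (ncc H (gr H (insert m F))) \<and>
    (\<exists>S\<subseteq>H. m a \<in> S \<and> m b \<in> S \<and> a \<notin> S \<and> b \<notin> S \<and> (\<forall>f\<in>F. \<forall>x\<in>S. f x \<in> S) \<and>
       (\<forall>x\<in>S - {m a, m b}. m x \<in> S))"
proof (cases "(a, m a) \<in> eqc R0")
  case True
  then show ?thesis using before after assms by simp
next
  case False
  let ?S = "eqc R0 `` {m a}"
  have "?S \<subseteq> H" using R0_closed[of "m a" _ H] F m dist by (auto simp: fpf_inv_def)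
  moreover have "m b \<in> ?S" "a \<notin> ?S" "b \<notin> ?S"
    using pairing assms False by (auto intro: eqc_sym eqc_trans)
  moreover have "f x \<in> ?S" if "f \<in> F" "x \<in> ?S" for f x
  proof -
    have "(x, f x) \<in> R0" using that \<open>?S \<subseteq> H\<close> by (auto simp: R0_def gr_def)
    then show ?thesis using that by (auto intro: eqc_trans eqc_base)
  qed
  moreover have "m x \<in> ?S" if "x \<in> ?S - {m a, m b}" for x
  proof -
    have "x \<in> H - {a, b, m a, m b}" using that \<open>?S \<subseteq> H\<close> \<open>a \<notin> ?S\<close> \<open>b \<notin> ?S\<close> by auto
    then have "(x, m x) \<in> R0" by (auto simp: R0_def gr_def)
    then show ?thesis using that by (auto intro: eqc_trans eqc_base)
  qed
  ultimately show ?thesis using before after assms False by (intro disjI2 conjI exI[of _ ?S]) auto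
qed

end

text \<open>Euler's inequality for a map with two of the three classes of cycles: flips make \<open>m\<close> coincide
  with \<open>c\<close>, which creates one more cycle for \<open>c\<close> and at most destroys one for \<open>c'\<close>.\<close>

lemma euler_inequality:
  assumes "finite H" "fpf_inv H m" "\<And>f. f \<in> F \<Longrightarrow> fpf_inv H f" "c \<in> F" "c' \<in> F"
  shows "ncc H (gr H {m, c}) + ncc H (gr H {m, c'}) + 2 * ncc H (gr H F)
     \<le> card H div 2 + ncc H (gr H {c, c'}) + 2 * ncc H (gr H (insert m F))"
  using assms(2)
proof (induction "card {d \<in> H. m d \<noteq> c d}" arbitrary: m rule: less_induct)
  case less
  show ?case
  proof (cases "\<exists>a\<in>H. m a \<noteq> c a")
    \<comment> \<open>Once \<open>m\<close> equals \<open>c\<close> on \<open>H\<close>, the two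
      sides are equal: each cycle of \<open>m\<close> and \<open>c\<close> is a pair
      \<open>{x, c x}\<close>.\<close>
    case False
    have 1: "gr H {m, f} = gr H {c, f}" "gr H (insert m F) = gr H (insert c F)" for f
      using False unfolding gr_def by (auto; metis)+
    have "2 * ncc H (gr H {c}) = card H"
    proof (rule ncc_card_class_eq[OF assms(1)])
      fix x assume x: "x \<in> H"
      have c: "fpf_inv H c" using assms by auto
      have "eqc (gr H {c}) `` {x} \<subseteq> {x, c x}"
        by (rule gr_closed_class) (use c x in \<open>auto simp: fpf_inv_def\<close>)
      moreover have "c x \<in> eqc (gr H {c}) `` {x}" using x by (auto intro!: eqc_base simp: gr_iff)
      ultimately have "eqc (gr H {c}) `` {x} = {x, c x}" by auto
      then show "card (eqc (gr H {c}) `` {x}) = 2" "eqc (gr H {c}) `` {x} \<subseteq> H"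
        using c x by (auto simp: fpf_inv_def dest!: bspec)
    qed
    then show ?thesis using 1 assms(4) by (simp add: insert_absorb)
  next
    case True
    then obtain a where a: "a \<in> H" "m a \<noteq> c a" by auto
    let ?b = "c a" and ?m' = "flip a (c a) m"
    have cF: "fpf_inv H c" "fpf_inv H c'" using assms by auto
    have b: "?b \<in> H" "?b \<noteq> a" "c (c a) = a" using cF a by (auto simp: fpf_inv_def)
    have m': "fpf_inv H ?m'" using fpf_inv_flip[OF less.prems] a b by metis
    interpret f0: flip_setting H m "{c}" a ?b
      using assms less.prems a b cF by unfold_locales auto
    interpret f1: flip_setting H m "{c'}" a ?b
      using assms less.prems a b cF by unfold_locales auto
    interpret f2: flip_setting H m F a ?b
      using assms less.prems a b cF by unfold_locales auto
    note d = f0.dist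
    \<comment> \<open>The far ends \<open>m a\<close> and \<open>m (c a)\<close> disagreed with
      \<open>c\<close> already before the flip, so no new disagreement arises.\<close>
    have "{d \<in> H. ?m' d \<noteq> c d} \<subseteq> {d \<in> H. m d \<noteq> c d} - {a}"
    proof
      fix d assume dd: "d \<in> {d \<in> H. ?m' d \<noteq> c d}"
      have "flip a (c a) m a = c a" "flip a (c a) m (c a) = c (c a)" using d b by (auto simp: flip_def)
      then have ne: "d \<noteq> a" "d \<noteq> c a" using dd by auto
      have "m d \<noteq> c d"
      proof
        assume *: "m d = c d"
        then have "flip a (c a) m d \<noteq> m d" using dd by auto
        then have "d = m a \<or> d = m (c a)" using ne by (auto simp: flip_def split: if_splits)
        then have "c d = a \<or> c d = c a" using * d by auto
        moreover have "c (c d) = d" using dd cF by (auto simp: fpf_inv_def)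
        ultimately show False using ne b(3) by auto
      qed
      then show "d \<in> {d \<in> H. m d \<noteq> c d} - {a}" using dd ne by auto
    qed
    moreover have "a \<in> {d \<in> H. m d \<noteq> c d}" using a by auto
    ultimately have "card {d \<in> H. ?m' d \<noteq> c d} < card {d \<in> H. m d \<noteq> c d}"
      using assms(1) by (intro psubset_card_mono) auto
    note IH = less.hyps[OF this m']
    have 1: "ncc H (gr H {?m', c}) = Suc (ncc H (gr H {m, c}))"
      by (rule f0.flip_split[where S = "{a, ?b}"]) (use d a b in auto)
    have "(a, ?b) \<in> eqc f2.R0"
      unfolding f2.R0_def by (rule eqc_base) (use a assms in \<open>auto simp: gr_def\<close>)
    \<comment> \<open>If the flip splits a component, the right-hand side grows by two. The part
      split off then also yields a new cycle for \<open>c'\<close>, which together with the new one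
      for \<open>c\<close> makes up for it.\<close>
    from f2.flip_connected[OF this]
    have "ncc H (gr H (insert ?m' F)) = ncc H (gr H (insert m F)) \<or>
      ncc H (gr H (insert ?m' F)) = Suc (ncc H (gr H (insert m F))) \<and>
        ncc H (gr H {?m', c'}) = Suc (ncc H (gr H {m, c'}))" (is "_ \<or> ?B")
    proof (elim disj_forward asm_rl conj_forward)
      assume "\<exists>S\<subseteq>H. m a \<in> S \<and> m ?b \<in> S \<and> a \<notin> S \<and> ?b \<notin> S \<and> (\<forall>f\<in>F. \<forall>x\<in>S. f x \<in> S) \<and>
         (\<forall>x\<in>S - {m a, m ?b}. m x \<in> S)"
      then obtain S where "S \<subseteq> H" "m a \<in> S" "m ?b \<in> S" "a \<notin> S" "?b \<notin> S" "\<forall>f\<in>F. \<forall>x\<in>S. f x \<in> S"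
        "\<forall>x\<in>S - {m a, m ?b}. m x \<in> S" by blast
      then show "ncc H (gr H {?m', c'}) = Suc (ncc H (gr H {m, c'}))"
        using assms(5) by (intro f1.flip_split'[where S = S]) auto
    qed
    then show ?thesis using IH 1 f1.flip_bounds(1) by auto
  qed
qed

section \<open>Strands of a map\<close>

text \<open>At each vertex the corners between an outgoing half-edge and its counterclockwise successor
  belong to L-faces, the other corners to R-faces. The three pairings \<open>turn G c\<close> of the half-edges at
  a vertex form a Klein four-group, and L-faces, R-faces and O(D)-loops are the cycles of \<open>mate G\<close>
  and \<open>turn G c\<close>. In this form the three kinds of cycles, and the three kinds of dipoles, are
  exchangeable.\<close>

datatype strand = LS | RS | NS

fun turn :: "'h fmap \<Rightarrow> strand \<Rightarrow> 'h \<Rightarrow> 'h" where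
  "turn G NS d = rot G (rot G d)"
| "turn G LS d = (if d \<in> outs G then rot G d else rot G (rot G (rot G d)))"
| "turn G RS d = (if d \<in> outs G then rot G (rot G (rot G d)) else rot G d)"

text \<open>The product of two different involutions of the Klein four-group; only for different
  arguments does the value have this meaning.\<close>

fun third :: "strand \<Rightarrow> strand \<Rightarrow> strand" where
  "third LS RS = NS" | "third RS LS = NS" | "third LS NS = RS" | "third NS LS = RS"
| "third RS NS = LS" | "third NS RS = LS" | "third c _ = c"

text \<open>The part of \<open>is_fmap\<close> that concerns vertices, kept apart because it
  survives the deletion of edges, where \<open>mate\<close> acquires fixed points.\<close>

definition rotsys :: "'h fmap \<Rightarrow> bool" where
  "rotsys G \<longleftrightarrow> finite (halves G) \<and> outs G \<subseteq> halves G \<and> rot G permutes halves G \<and>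
     (\<forall>d\<in>halves G. card (vertex G d) = 4 \<and> (rot G d \<in> outs G \<longleftrightarrow> d \<notin> outs G))"

lemma UNIV_strand: "UNIV = {LS, RS, NS}"
  using strand.exhaust by auto

lemma third_neq [simp]: "c \<noteq> c' \<Longrightarrow> third c c' \<noteq> c" "c \<noteq> c' \<Longrightarrow> third c c' \<noteq> c'"
  by (cases c; cases c'; simp)+

lemma third_eq: "c \<noteq> c' \<Longrightarrow> c'' \<noteq> c \<Longrightarrow> c'' \<noteq> c' \<Longrightarrow> third c c' = c''"
  by (cases c; cases c'; cases c''; simp)

lemma is_fmap_iff: "is_fmap G \<longleftrightarrow> rotsys G \<and> mate G permutes halves G \<and> fpf_inv (halves G) (mate G) \<and>
    (\<forall>d\<in>halves G. mate G d \<in> outs G \<longleftrightarrow> d \<notin> outs G)"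
  unfolding is_fmap_def rotsys_def fpf_inv_def by (auto simp: permutes_in_image)

text \<open>An earlier return to \<open>d\<close> would make the orbit smaller. The fourth iterate
  lies in the orbit again, and injectivity leaves only \<open>d\<close> for it.\<close>

lemma orbit_card4:
  assumes "permutation f" "card (orbit f d) = 4"
  shows "f (f (f (f d))) = d" "f d \<noteq> d" "f (f d) \<noteq> d" "f (f (f d)) \<noteq> d"
    "orbit f d = {d, f d, f (f d), f (f (f d))}"
proof -
  have no: "(f ^^ n) d \<noteq> d" if "0 < n" "n < 4" for n
  proof
    assume "(f ^^ n) d = d"
    then have "orbit f d = (\<lambda>m. (f ^^ m) d) ` {..<n}"
      using orbit_altdef_bounded[of n f d] that by auto
    then have "card (orbit f d) \<le> n" by (metis card_image_le card_lessThan finite_lessThan)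
    then show False using assms that by simp
  qed
  show n: "f d \<noteq> d" "f (f d) \<noteq> d" "f (f (f d)) \<noteq> d"
    using no[of 1] no[of 2] no[of 3] by (simp_all add: eval_nat_numeral)
  have inj: "f x = f y \<longleftrightarrow> x = y" for x y
    using assms(1) by (meson bij_is_inj inj_eq permutation_bijective)
  have d0: "d \<in> orbit f d" by (rule permutation_self_in_orbit[OF assms(1)])
  have sub: "{d, f d, f (f d), f (f (f d))} \<subseteq> orbit f d"
    using d0 by (auto intro: orbit.step)
  have "card {d, f d, f (f d), f (f (f d))} = 4"
    using n n[symmetric] by (simp add: inj)
  then show eq: "orbit f d = {d, f d, f (f d), f (f (f d))}"
    using card_subset_eq[OF finite_orbit[OF d0] sub] assms(2) by simp
  have "f (f (f (f d))) \<in> orbit f d" using d0 by (auto intro: orbit.step)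
  then show "f (f (f (f d))) = d" using eq n by (auto simp: inj)
qed

lemma rotsysD:
  assumes "rotsys G" "d \<in> halves G"
  shows "rot G (rot G (rot G (rot G d))) = d" "rot G d \<noteq> d" "rot G (rot G d) \<noteq> d"
    "rot G (rot G (rot G d)) \<noteq> d" "rot G d \<in> halves G" "rot G d \<in> outs G \<longleftrightarrow> d \<notin> outs G"
    "vertex G d = {d, rot G d, rot G (rot G d), rot G (rot G (rot G d))}"
proof -
  have p: "rot G permutes halves G" "finite (halves G)" using assms by (auto simp: rotsys_def)
  then have "permutation (rot G)" by (auto simp: permutation_permutes)
  note * = orbit_card4[OF this, of d]
  have "card (orbit (rot G) d) = 4" using assms by (auto simp: rotsys_def vertex_def)
  note * = *[OF this]
  show "rot G (rot G (rot G (rot G d))) = d" "rot G d \<noteq> d" "rot G (rot G d) \<noteq> d"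
    "rot G (rot G (rot G d)) \<noteq> d" by (rule *)+
  show "vertex G d = {d, rot G d, rot G (rot G d), rot G (rot G (rot G d))}"
    unfolding vertex_def by (rule *)
  show "rot G d \<in> halves G" using p assms by (simp add: permutes_in_image)
  show "rot G d \<in> outs G \<longleftrightarrow> d \<notin> outs G" using assms by (simp add: rotsys_def)
qed

lemma rot_inj: "rotsys G \<Longrightarrow> rot G x = rot G y \<longleftrightarrow> x = y"
  unfolding rotsys_def using permutes_inj inj_eq by metis

lemma turn_in [simp]: "rotsys G \<Longrightarrow> d \<in> halves G \<Longrightarrow> turn G c d \<in> halves G"
  by (cases c) (simp_all add: rotsysD)

lemma turn_turn [simp]: "rotsys G \<Longrightarrow> d \<in> halves G \<Longrightarrow> turn G c (turn G c d) = d"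
  by (cases c) (simp_all add: rotsysD)

lemma turn_third: "rotsys G \<Longrightarrow> d \<in> halves G \<Longrightarrow> c \<noteq> c' \<Longrightarrow> turn G c (turn G c' d) = turn G (third c c') d"
  by (cases c; cases c') (simp_all add: rotsysD)

lemma turn_neq [simp]: "rotsys G \<Longrightarrow> d \<in> halves G \<Longrightarrow> turn G c d \<noteq> d"
  by (cases c) (simp_all add: rotsysD)

lemma turn_eq_iff [simp]:
  assumes "rotsys G" "d \<in> halves G"
  shows "turn G c d = turn G c' d \<longleftrightarrow> c = c'"
proof
  show "turn G c d = turn G c' d \<Longrightarrow> c = c'"
    using turn_third[OF assms, of c' c] turn_turn[OF assms, of c'] turn_neq[OF assms, of "third c' c"] by metis
qed simp

lemma turn_out: "rotsys G \<Longrightarrow> d \<in> halves G \<Longrightarrow> turn G c d \<in> outs G \<longleftrightarrow> (if c = NS then d \<in> outs G else d \<notin> outs G)"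
  by (cases c) (simp_all add: rotsysD)

lemma turn_fpf: "rotsys G \<Longrightarrow> fpf_inv (halves G) (turn G c)"
  by (simp add: fpf_inv_def)

lemma vertex_turn: "rotsys G \<Longrightarrow> d \<in> halves G \<Longrightarrow> vertex G d = insert d (range (\<lambda>c. turn G c d))"
  unfolding UNIV_strand by (auto simp: rotsysD)

lemma vertex_sub: "rotsys G \<Longrightarrow> d \<in> halves G \<Longrightarrow> vertex G d \<subseteq> halves G"
  by (auto simp: vertex_turn)

lemma vertex_self: "rotsys G \<Longrightarrow> d \<in> halves G \<Longrightarrow> d \<in> vertex G d"
  by (auto simp: vertex_turn)

lemma vertex_closed: "rotsys G \<Longrightarrow> d \<in> halves G \<Longrightarrow> x \<in> vertex G d \<Longrightarrow> turn G c x \<in> vertex G d"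
  using turn_third[of G d c] by (auto simp: vertex_turn) (metis rangeI turn_turn)

lemma vertex_least:
  assumes "rotsys G" "d \<in> halves G" "d \<in> S" "\<And>x c. x \<in> S \<Longrightarrow> turn G c x \<in> S"
  shows "vertex G d \<subseteq> S"
  using assms by (auto simp: vertex_turn)

text \<open>Any two of the three turns generate the third one, so two of them already sweep out a
  whole vertex.\<close>

lemma vertex_class:
  assumes "rotsys G" "d \<in> halves G" "c \<in> A" "c' \<in> A" "c \<noteq> c'"
  shows "eqc (gr (halves G) (turn G ` A)) `` {d} = vertex G d"
proof
  show "eqc (gr (halves G) (turn G ` A)) `` {d} \<subseteq> vertex G d"
  proof (rule gr_closed_class)
    show "f x \<in> vertex G d" if "f \<in> turn G ` A" "x \<in> vertex G d" for f x
      using that vertex_closed[OF assms(1,2)] by blast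
    show "fpf_inv (halves G) f" if "f \<in> turn G ` A" for f using that turn_fpf[OF assms(1)] by blast
  qed (rule vertex_sub[OF assms(1,2)] vertex_self[OF assms(1,2)])+
  have b: "(x, turn G c'' x) \<in> eqc (gr (halves G) (turn G ` A))" if "x \<in> halves G" "c'' \<in> A" for x c''
    using that by (intro eqc_base) (auto simp: gr_iff)
  have "(d, turn G c'' d) \<in> eqc (gr (halves G) (turn G ` A))" for c''
  proof (cases "c'' = c \<or> c'' = c'")
    case False
    then have "turn G c'' d = turn G c (turn G c' d)"
      using assms turn_third[of G d c c'] third_eq[of c c' c''] by auto
    then show ?thesis using b[of d c'] b[of "turn G c' d" c] assms by (auto intro: eqc_trans)
  qed (use b assms in auto)
  then show "vertex G d \<subseteq> eqc (gr (halves G) (turn G ` A)) `` {d}"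
    using assms by (auto simp: vertex_turn)
qed

section \<open>Vertices, components, faces and O(D)-loops as class counts\<close>

lemma num_vertices_ncc:
  assumes "rotsys G" "c \<in> A" "c' \<in> A" "c \<noteq> c'"
  shows "ncc (halves G) (gr (halves G) (turn G ` A)) = num_vertices G"
proof -
  have "(\<lambda>x. eqc (gr (halves G) (turn G ` A)) `` {x}) ` halves G = vertex G ` halves G"
    by (rule image_cong[OF refl]) (rule vertex_class[OF assms(1) _ assms(2-4)])
  then show ?thesis by (simp add: ncc_def num_vertices_def)
qed

lemma card_halves: "rotsys G \<Longrightarrow> card (halves G) = 4 * num_vertices G"
proof -
  assume G: "rotsys G"
  have "4 * ncc (halves G) (gr (halves G) (turn G ` UNIV)) = card (halves G)"
  proof (rule ncc_card_class_eq)
    show "finite (halves G)" using G by (simp add: rotsys_def)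
    fix x assume x: "x \<in> halves G"
    then have *: "eqc (gr (halves G) (range (turn G))) `` {x} = vertex G x"
      by (intro vertex_class[OF G, of x LS _ RS]) auto
    show "eqc (gr (halves G) (range (turn G))) `` {x} \<subseteq> halves G"
      "card (eqc (gr (halves G) (range (turn G))) `` {x}) = 4"
      unfolding * using G x vertex_sub[OF G x] by (auto simp: rotsys_def)
  qed
  then show ?thesis using num_vertices_ncc[OF G, of LS UNIV RS] by simp
qed

text \<open>For \<open>A = {c}\<close> this is the number of L-faces, R-faces or O(D)-loops, for
  \<open>A = UNIV\<close> the number of components. A circle contributes one to each of
  them.\<close>

definition ccount :: "'h fmap \<Rightarrow> strand set \<Rightarrow> nat" where
  "ccount G A = ncc (halves G) (gr (halves G) (insert (mate G) (turn G ` A))) + circles G"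

lemma component_class:
  assumes G: "rotsys G" and m: "\<And>d. d \<in> halves G \<Longrightarrow> mate G d \<in> halves G \<and> mate G (mate G d) = d"
    and d: "d \<in> halves G"
  shows "{(x, y). x \<in> halves G \<and> (y = rot G x \<or> y = mate G x)}\<^sup>* `` {d} =
     eqc (gr (halves G) (insert (mate G) (range (turn G)))) `` {d}" (is "?S\<^sup>* `` _ = eqc ?R `` _")
proof -
  have "(d, y) \<in> ?S\<^sup>* \<Longrightarrow> (d, y) \<in> eqc ?R" for y
  proof (induction rule: rtrancl_induct)
    case (step y z)
    have "rot G y = turn G (if y \<in> outs G then LS else RS) y" by simp
    then have "(y, z) \<in> ?R" using step(2) unfolding gr_iff by blast
    then show ?case using step(3) by (blast intro: eqc_trans eqc_base)
  qed simp
  moreover have "(d, y) \<in> (?R \<union> ?R\<inverse>)\<^sup>* \<Longrightarrow> (d, y) \<in> ?S\<^sup>* \<and> y \<in> halves G" for y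
  proof (induction rule: rtrancl_induct)
    case base
    then show ?case using d by simp
  next
    case (step y z)
    have R: "(y, z) \<in> ?R"
    proof (cases "(y, z) \<in> ?R")
      case False
      then have "z \<in> halves G" "y = mate G z \<or> (\<exists>c. y = turn G c z)" using step(2) by (auto simp: gr_iff)
      then have "z = mate G y \<or> (\<exists>c. z = turn G c y)" using m turn_turn[OF G] by metis
      then show ?thesis using step(3) by (auto simp: gr_iff)
    qed
    have y: "y \<in> halves G" using step by blast
    have r: "(x, rot G x) \<in> ?S" if "x \<in> halves G" for x using that by simp
    have "z \<in> halves G" "(y, z) \<in> ?S\<^sup>*"
    proof -
      consider "z = mate G y" | c where "z = turn G c y" using R by (auto simp: gr_iff)
      then have "z \<in> halves G \<and> (y, z) \<in> ?S\<^sup>*"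
      proof cases
        case 1
        then show ?thesis using y m by auto
      next
        case 2
        have "(y, rot G y) \<in> ?S\<^sup>*" "(y, rot G (rot G y)) \<in> ?S\<^sup>*" "(y, rot G (rot G (rot G y))) \<in> ?S\<^sup>*"
          using r y rotsysD(5)[OF G] by (meson r_into_rtrancl rtrancl.rtrancl_into_rtrancl)+
        then show ?thesis using 2 y G by (cases c) (auto simp: rotsysD)
      qed
      then show "z \<in> halves G" "(y, z) \<in> ?S\<^sup>*" by auto
    qed
    then show ?case using step(3) by (meson rtrancl_trans)
  qed
  ultimately show ?thesis unfolding eqc_def by blast
qed

lemma num_components_ncc:
  assumes G: "rotsys G" and m: "\<And>d. d \<in> halves G \<Longrightarrow> mate G d \<in> halves G \<and> mate G (mate G d) = d"
  shows "num_components G = ccount G UNIV"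
proof -
  have "components G = (\<lambda>d. eqc (gr (halves G) (insert (mate G) (range (turn G)))) `` {d}) ` halves G"
    unfolding components_def by (rule image_cong) (use component_class[OF G] m in auto)
  then show ?thesis by (simp add: num_components_def ccount_def ncc_def)
qed

lemma fmapD:
  assumes "is_fmap G"
  shows "rotsys G" "finite (halves G)" "mate G permutes halves G" "permutation (mate G)"
    "permutation (rot G)" "fpf_inv (halves G) (mate G)"
proof -
  show "rotsys G" "mate G permutes halves G" "fpf_inv (halves G) (mate G)" using assms by (auto simp: is_fmap_iff)
  show "finite (halves G)" using assms by (simp add: is_fmap_def)
  then show "permutation (mate G)" "permutation (rot G)"
    using assms unfolding is_fmap_def permutation_permutes by blast+
qed

lemma mateD:
  assumes "is_fmap G" "d \<in> halves G"
  shows "mate G d \<in> halves G" "mate G (mate G d) = d" "mate G d \<noteq> d" "mate G d \<in> outs G \<longleftrightarrow> d \<notin> outs G"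
  using assms by (auto simp: is_fmap_iff fpf_inv_def)

lemma fpf_strands: "is_fmap G \<Longrightarrow> f \<in> insert (mate G) (turn G ` A) \<Longrightarrow> fpf_inv (halves G) f"
  by (auto simp: fmapD turn_fpf)

lemma class_props:
  fixes A :: "strand set"
  assumes "is_fmap G" "d \<in> halves G"
  defines "K \<equiv> eqc (gr (halves G) (insert (mate G) (turn G ` A))) `` {d}"
  shows "K \<subseteq> halves G" "d \<in> K" "x \<in> K \<Longrightarrow> mate G x \<in> K" "x \<in> K \<Longrightarrow> c \<in> A \<Longrightarrow> turn G c x \<in> K"
proof -
  show sub: "K \<subseteq> halves G" unfolding K_def
  proof (rule gr_closed_class)
    show f: "fpf_inv (halves G) f" if "f \<in> insert (mate G) (turn G ` A)" for f
      by (rule fpf_strands[OF assms(1) that])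
    show "f x \<in> halves G" if "f \<in> insert (mate G) (turn G ` A)" "x \<in> halves G" for f x
      using fpf_invD(1)[OF f] that by blast
  qed (use assms in auto)
  show "d \<in> K" by (simp add: K_def)
  have "(x, mate G x) \<in> eqc (gr (halves G) (insert (mate G) (turn G ` A)))" if "x \<in> K"
    by (rule eqc_base) (use that sub in \<open>auto simp: gr_iff\<close>)
  then show "x \<in> K \<Longrightarrow> mate G x \<in> K" by (auto simp: K_def intro: eqc_trans)
  have "(x, turn G c x) \<in> eqc (gr (halves G) (insert (mate G) (turn G ` A)))" if "x \<in> K" "c \<in> A"
    by (rule eqc_base) (use that sub in \<open>auto simp: gr_iff\<close>)
  then show "x \<in> K \<Longrightarrow> c \<in> A \<Longrightarrow> turn G c x \<in> K" by (auto simp: K_def intro: eqc_trans)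
qed

lemma class_least:
  assumes "is_fmap G" "S \<subseteq> halves G" "\<And>x. x \<in> S \<Longrightarrow> mate G x \<in> S"
    "\<And>x c. c \<in> A \<Longrightarrow> x \<in> S \<Longrightarrow> turn G c x \<in> S" "d \<in> S"
  shows "eqc (gr (halves G) (insert (mate G) (turn G ` A))) `` {d} \<subseteq> S"
  by (rule gr_closed_class[OF fpf_strands[OF assms(1)]]) (use assms in auto)

lemma inv_rot: "is_fmap G \<Longrightarrow> d \<in> halves G \<Longrightarrow> inv (rot G) d = rot G (rot G (rot G d))"
  using rotsysD(1)[of G d] by (metis fmapD(1,5) bij_is_inj inv_f_f permutation_bijective)

lemma face_step_turn:
  assumes "is_fmap G" "d \<in> halves G" "c = (if d \<in> outs G then LS else RS)"
  shows "face_step G d = turn G c (mate G d)"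
  using assms mateD[OF assms(1,2)] by (auto simp: face_step_def inv_rot)

lemma permutation_face_step: "is_fmap G \<Longrightarrow> permutation (face_step G)"
  using permutation_compose[of "inv (rot G)" "mate G"] permutation_inverse[of "rot G"] fmapD[of G]
  by (simp add: face_step_def[abs_def] comp_def)

lemma orbit_inv_step:
  assumes "permutation f" "x \<in> orbit f d"
  shows "inv f x \<in> orbit f d"
  using assms orbit.step[of x "inv f" d] by (simp add: orbit_inv_eq)

text \<open>The walk around a face visits half-edges of one direction only; the other half of the
  strand cycle consists of their mates.\<close>

lemma face_class:
  assumes G: "is_fmap G" and d: "d \<in> halves G" and c: "c = (if d \<in> outs G then LS else RS)"
  shows "face G d = {x \<in> eqc (gr (halves G) {mate G, turn G c}) `` {d}. x \<in> outs G \<longleftrightarrow> d \<in> outs G}"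
proof -
  let ?R = "gr (halves G) {mate G, turn G c}"
  let ?O = "face G d"
  note rs = fmapD(1)[OF G]
  note cl = class_props[OF G d, where A = "{c}", unfolded image_insert image_empty]
  have cN: "c \<noteq> NS" using c by auto
  have p: "permutation (face_step G)" by (rule permutation_face_step[OF G])
  have stp: "face_step G x \<in> eqc ?R `` {d} \<and> (face_step G x \<in> outs G \<longleftrightarrow> d \<in> outs G)"
    if "x \<in> eqc ?R `` {d} \<and> (x \<in> outs G \<longleftrightarrow> d \<in> outs G)" for x
  proof -
    have xH: "x \<in> halves G" using that cl(1) by blast
    have *: "face_step G x = turn G c (mate G x)" using face_step_turn[OF G xH] that c by simp
    have "mate G x \<in> eqc ?R `` {d}" using that cl(3) by blast
    then have "face_step G x \<in> eqc ?R `` {d}" unfolding * by (rule cl(4)) simp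
    then show ?thesis unfolding * using that turn_out[OF rs mateD(1)[OF G xH]] mateD(4)[OF G xH] cN by auto
  qed
  have in1: "x \<in> eqc ?R `` {d} \<and> (x \<in> outs G \<longleftrightarrow> d \<in> outs G)" if "x \<in> ?O" for x
    using that unfolding face_def
  proof induction
    case base
    show ?case by (rule stp) simp
  next
    case (step x)
    show ?case by (rule stp[OF step(2)])
  qed
  have OH: "?O \<subseteq> halves G" using in1 cl(1) by blast
  have dO: "d \<in> ?O" unfolding face_def by (rule permutation_self_in_orbit[OF p])
  \<comment> \<open>Turning at a half-edge of the walk undoes the last half of the step leading to
    it and ends at the mate of its predecessor.\<close>
  have bwd: "turn G c x \<in> mate G ` ?O" if x: "x \<in> ?O" for x
  proof -
    let ?y = "inv (face_step G) x"
    have y: "?y \<in> ?O" using orbit_inv_step[OF p] x by (simp add: face_def)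
    have yH: "?y \<in> halves G" using y OH by blast
    have yo: "?y \<in> outs G \<longleftrightarrow> d \<in> outs G" using in1[OF y] by simp
    have "x = face_step G ?y" using p by (simp add: permutation_bijective bij_is_surj surj_f_inv_f)
    also have "\<dots> = turn G c (mate G ?y)" using face_step_turn[OF G yH] yo c by simp
    finally have "turn G c x = turn G c (turn G c (mate G ?y))" by simp
    also have "\<dots> = mate G ?y" by (rule turn_turn[OF rs mateD(1)[OF G yH]])
    finally show ?thesis using y by auto
  qed
  have fwd: "turn G c (mate G x) \<in> ?O" if x: "x \<in> ?O" for x
  proof -
    have xH: "x \<in> halves G" using x OH by blast
    have "face_step G x = turn G c (mate G x)" using face_step_turn[OF G xH] in1[OF x] c by simp
    moreover have "face_step G x \<in> ?O" using x unfolding face_def by (rule orbit.step)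
    ultimately show ?thesis by simp
  qed
  have "eqc (gr (halves G) (insert (mate G) (turn G ` {c}))) `` {d} \<subseteq> ?O \<union> mate G ` ?O"
    by (rule class_least[OF G]) (use OH dO bwd fwd mateD[OF G] in auto)
  moreover have "x \<in> outs G \<longleftrightarrow> d \<notin> outs G" if "x \<in> mate G ` ?O" for x
    using that in1 OH mateD(4)[OF G] by blast
  ultimately show ?thesis using in1 by (simp, blast)
qed

text \<open>Every strand cycle contains half-edges of both directions, so the outgoing ones
  represent all L-cycles and the ingoing ones all R-cycles. Faces of the two kinds differ because
  their half-edges have different directions.\<close>

lemma num_faces_ccount:
  assumes G: "is_fmap G"
  shows "num_faces G = ccount G {LS} + ccount G {RS}"
proof -
  let ?K = "\<lambda>c d. eqc (gr (halves G) {mate G, turn G c}) `` {d}"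
  have aux: "card (face G ` P) = ncc (halves G) (gr (halves G) {mate G, turn G c})"
    if P: "P \<subseteq> halves G" "\<And>d. d \<in> P \<Longrightarrow> c = (if d \<in> outs G then LS else RS)"
      "\<And>d. d \<in> halves G \<Longrightarrow> mate G d \<in> P \<or> d \<in> P"
      "\<And>d d'. d \<in> P \<Longrightarrow> d' \<in> P \<Longrightarrow> d \<in> outs G \<longleftrightarrow> d' \<in> outs G" for P c
  proof -
    have "card (face G ` P) = card (?K c ` P)"
    proof (rule card_image_cong_eq)
      fix x y assume xy: "x \<in> P" "y \<in> P"
      have fx: "face G x = {z \<in> ?K c x. z \<in> outs G \<longleftrightarrow> x \<in> outs G}" using face_class[OF G _ P(2)] xy P(1) by blast
      have fy: "face G y = {z \<in> ?K c y. z \<in> outs G \<longleftrightarrow> y \<in> outs G}" using face_class[OF G _ P(2)] xy P(1) by blast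
      show "face G x = face G y \<longleftrightarrow> ?K c x = ?K c y"
      proof
        assume "face G x = face G y"
        moreover have "y \<in> face G y" using fy by simp
        ultimately have "y \<in> {z \<in> ?K c x. z \<in> outs G \<longleftrightarrow> x \<in> outs G}" using fx by (metis (no_types, lifting))
        then have "y \<in> ?K c x" by blast
        then show "?K c x = ?K c y" by (simp add: eqc_class_eq)
      next
        assume "?K c x = ?K c y"
        then show "face G x = face G y" using fx fy P(4)[OF xy] by simp
      qed
    qed
    moreover have "?K c ` P = ?K c ` halves G"
    proof
      show "?K c ` halves G \<subseteq> ?K c ` P"
      proof
        fix k assume "k \<in> ?K c ` halves G"
        then obtain d where d: "d \<in> halves G" "k = ?K c d" by blast
        have "(d, mate G d) \<in> eqc (gr (halves G) {mate G, turn G c})" using d by (intro eqc_base) (simp add: gr_iff)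
        then have "?K c d = ?K c (mate G d)" by (simp add: eqc_class_eq)
        then show "k \<in> ?K c ` P" using P(3)[OF d(1)] d(2) by auto
      qed
    qed (rule image_mono[OF P(1)])
    ultimately show ?thesis by (simp add: ncc_def)
  qed
  have o: "outs G \<subseteq> halves G" using G by (simp add: is_fmap_def)
  have "face G ` outs G \<inter> face G ` (halves G - outs G) = {}"
  proof -
    have "face G d \<noteq> face G e" if "d \<in> outs G" "e \<in> halves G - outs G" for d e
      using that o face_class[OF G, of d LS] face_class[OF G, of e RS] by (auto simp: set_eq_iff)
    then show ?thesis by blast
  qed
  moreover have "face G ` halves G = face G ` outs G \<union> face G ` (halves G - outs G)" using o by auto
  moreover have "finite (halves G)" using fmapD[OF G] by simp
  ultimately have "card (face G ` halves G) = card (face G ` outs G) + card (face G ` (halves G - outs G))"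
    using o by (metis card_Un_disjoint finite_Diff finite_imageI finite_subset)
  moreover have "card (face G ` outs G) = ncc (halves G) (gr (halves G) {mate G, turn G LS})"
    by (rule aux) (use o mateD[OF G] in auto)
  moreover have "card (face G ` (halves G - outs G)) = ncc (halves G) (gr (halves G) {mate G, turn G RS})"
    by (rule aux) (use o mateD[OF G] in auto)
  ultimately show ?thesis by (simp add: num_faces_def ccount_def)
qed

lemma od_loop_class:
  assumes G: "is_fmap G" and d: "d \<in> halves G"
  shows "od_loop G d = eqc (gr (halves G) {mate G, turn G NS}) `` {d}"
proof -
  let ?f = "\<lambda>x. (rot G ^^ 2) (mate G x)"
  let ?W = "orbit ?f d"
  let ?K = "eqc (gr (halves G) {mate G, turn G NS}) `` {d}"
  have f: "?f x = turn G NS (mate G x)" for x by (simp add: eval_nat_numeral)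
  note cl = class_props[OF G d, where A = "{NS}", unfolded image_insert image_empty]
  note rs = fmapD(1)[OF G]
  have p: "permutation ?f"
    using permutation_compose[OF permutation_compose[OF fmapD(5)[OF G] fmapD(5)[OF G]] fmapD(4)[OF G]]
    by (simp add: comp_def eval_nat_numeral)
  have WK: "x \<in> ?K" if "x \<in> ?W" for x
    using that
  proof induction
    case base
    then show ?case unfolding f using cl by blast
  next
    case (step x)
    then show ?case unfolding f using cl by blast
  qed
  have dW: "d \<in> ?W" by (rule permutation_self_in_orbit[OF p])
  have WH: "?W \<subseteq> halves G" using WK cl(1) by blast
  have "?K \<subseteq> ?W \<union> mate G ` ?W"
  proof -
    have "eqc (gr (halves G) (insert (mate G) (turn G ` {NS}))) `` {d} \<subseteq> ?W \<union> mate G ` ?W"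
    proof (rule class_least[OF G])
      show "?W \<union> mate G ` ?W \<subseteq> halves G" using WH mateD(1)[OF G] by blast
      show "mate G x \<in> ?W \<union> mate G ` ?W" if "x \<in> ?W \<union> mate G ` ?W" for x
        using that
      proof
        assume "x \<in> mate G ` ?W"
        then obtain y where "y \<in> ?W" "x = mate G y" by blast
        then show ?thesis using mateD(2)[OF G, of y] WH by auto
      qed simp
      show "d \<in> ?W \<union> mate G ` ?W" using dW by simp
      fix x c assume c: "c \<in> {NS}" and x: "x \<in> ?W \<union> mate G ` ?W"
      show "turn G c x \<in> ?W \<union> mate G ` ?W"
      proof (cases "x \<in> ?W")
        case True
        let ?y = "inv ?f x"
        have y: "?y \<in> ?W" by (rule orbit_inv_step[OF p True])
        have "x = ?f ?y" using p by (metis bij_is_surj permutation_bijective surj_f_inv_f)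
        then have "turn G NS x = turn G NS (turn G NS (mate G ?y))" unfolding f by simp
        also have "\<dots> = mate G ?y" by (rule turn_turn[OF rs mateD(1)[OF G]]) (use y WH in blast)
        finally show ?thesis using y c by auto
      next
        case False
        then obtain y where y: "y \<in> ?W" "x = mate G y" using x by blast
        have "?f y \<in> ?W" using y(1) by (rule orbit.step)
        then show ?thesis using c y(2) unfolding f by auto
      qed
    qed
    then show ?thesis by simp
  qed
  moreover have "?W \<union> mate G ` ?W \<subseteq> ?K" using WK cl(3) by blast
  ultimately show ?thesis unfolding od_loop_def Let_def by blast
qed

lemma num_od_loops_ccount:
  assumes G: "is_fmap G"
  shows "num_od_loops G = ccount G {NS}"
proof -
  have "od_loops G = (\<lambda>d. eqc (gr (halves G) {mate G, turn G NS}) `` {d}) ` halves G"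
    unfolding od_loops_def by (rule image_cong) (use od_loop_class[OF G] in auto)
  then show ?thesis by (simp add: num_od_loops_def ccount_def ncc_def)
qed

lemma num_components_ccount: "is_fmap G \<Longrightarrow> num_components G = ccount G UNIV"
  by (rule num_components_ncc) (auto simp: fmapD mateD)

text \<open>Euler's inequality with all three turns for \<open>F\<close>. Without
  \<open>mate\<close>, the components as well as the cycles of two turns are the vertices, and there
  are \<open>4 v\<close> half-edges: \<open>E + E' + 2 v\<close> is at most
  \<open>2 v + v + 2 C\<close>.\<close>

lemma euler_ccount:
  assumes G: "is_fmap G" and c: "c \<noteq> c'"
  shows "ccount G {c} + ccount G {c'} \<le> num_vertices G + 2 * ccount G UNIV"
proof -
  note rs = fmapD(1)[OF G]
  have "ncc (halves G) (gr (halves G) {mate G, turn G c}) + ncc (halves G) (gr (halves G) {mate G, turn G c'})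
      + 2 * ncc (halves G) (gr (halves G) (range (turn G)))
     \<le> card (halves G) div 2 + ncc (halves G) (gr (halves G) {turn G c, turn G c'})
      + 2 * ncc (halves G) (gr (halves G) (insert (mate G) (range (turn G))))"
    by (rule euler_inequality) (use fmapD[OF G] turn_fpf[OF rs] in auto)
  moreover have "ncc (halves G) (gr (halves G) (range (turn G))) = num_vertices G"
    by (rule num_vertices_ncc[OF rs, of LS _ RS]) auto
  moreover have "ncc (halves G) (gr (halves G) {turn G c, turn G c'}) = num_vertices G"
    using num_vertices_ncc[OF rs, of c "{c, c'}" c'] c by simp
  ultimately show ?thesis using card_halves[OF rs] by (simp add: ccount_def)
qed

section \<open>Restriction to a union of vertices\<close>

lemma ncc_restrict:
  assumes "\<And>f. f \<in> F \<Longrightarrow> fpf_inv H f" "S \<subseteq> H" "\<And>f x. f \<in> F \<Longrightarrow> x \<in> S \<Longrightarrow> f x \<in> S"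
  shows "ncc S (gr H F) = ncc S (gr S F)"
proof (rule ncc_cong)
  fix x y assume xy: "x \<in> S" "y \<in> S"
  have F: "fpf_inv S f" if "f \<in> F" for f
    using assms(1)[OF that] assms(3)[OF that] assms(2) by (auto simp: fpf_inv_def)
  let ?K = "eqc (gr S F) `` {x}"
  have KS: "?K \<subseteq> S" by (rule gr_closed_class) (use F assms(3) xy in auto)
  have "eqc (gr H F) `` {x} \<subseteq> ?K"
  proof (rule gr_closed_class[OF assms(1)])
    fix f z assume fz: "f \<in> F" "z \<in> ?K"
    then have "(z, f z) \<in> eqc (gr S F)" using KS by (intro eqc_base) (auto simp: gr_iff)
    then show "f z \<in> ?K" using fz by (auto intro: eqc_trans)
  qed (use KS assms(2) in auto)
  moreover have "eqc (gr S F) \<subseteq> eqc (gr H F)"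
    by (rule eqc_mono) (use assms(2) in \<open>auto simp: gr_def\<close>)
  ultimately show "(x, y) \<in> eqc (gr H F) \<longleftrightarrow> (x, y) \<in> eqc (gr S F)" by auto
qed

lemma ncc_split:
  assumes "finite H" "\<And>f. f \<in> F \<Longrightarrow> fpf_inv H f" "S \<subseteq> H" "\<And>f x. f \<in> F \<Longrightarrow> x \<in> S \<Longrightarrow> f x \<in> S"
  shows "ncc H (gr H F) = ncc S (gr S F) + ncc (H - S) (gr (H - S) F)"
proof -
  have C: "f x \<in> H - S" if "f \<in> F" "x \<in> H - S" for f x
    using that fpf_invD[OF assms(2)[OF that(1)], of x] assms(4)[OF that(1), of "f x"] by auto
  have "ncc (S \<union> (H - S)) (gr H F) = ncc S (gr H F) + ncc (H - S) (gr H F)"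
  proof (rule ncc_Un)
    show "u \<in> S \<longleftrightarrow> v \<in> S" if "(u, v) \<in> gr H F" for u v
      using that C assms(4) by (auto simp: gr_iff)
  qed (use assms(1,3) finite_subset in auto)
  moreover have "ncc S (gr H F) = ncc S (gr S F)"
    by (rule ncc_restrict) (use assms in auto)
  moreover have "ncc (H - S) (gr H F) = ncc (H - S) (gr (H - S) F)"
    by (rule ncc_restrict[OF assms(2)]) (use C in auto)
  moreover have "S \<union> (H - S) = H" using assms(3) by auto
  ultimately show ?thesis by simp
qed

lemma gr_image_cong: "(\<And>x c. x \<in> H \<Longrightarrow> c \<in> A \<Longrightarrow> t c x = t' c x) \<Longrightarrow> (\<And>x. x \<in> H \<Longrightarrow> m x = m' x) \<Longrightarrow>
    gr H (insert m (t ` A)) = gr H (insert m' (t' ` A))"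
  unfolding gr_def by (auto; metis image_eqI)

text \<open>The common form of all graphs cut out of \<open>G\<close>: contractions, and the two
  closed-up sides of a two-edge-cut. Off \<open>S\<close> the maps are the identity, as equality of
  records demands.\<close>

definition submap :: "'h fmap \<Rightarrow> 'h set \<Rightarrow> ('h \<Rightarrow> 'h) \<Rightarrow> nat \<Rightarrow> 'h fmap" where
  "submap G S m k = \<lparr>halves = S, rot = (\<lambda>d. if d \<in> S then rot G d else d),
     mate = (\<lambda>d. if d \<in> S then m d else d), outs = outs G \<inter> S, circles = k\<rparr>"

lemma submap_simps [simp]: "halves (submap G S m k) = S" "circles (submap G S m k) = k"
    "outs (submap G S m k) = outs G \<inter> S" "d \<in> S \<Longrightarrow> mate (submap G S m k) d = m d"
    "d \<in> S \<Longrightarrow> rot (submap G S m k) d = rot G d"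
  by (simp_all add: submap_def)

lemma involution_permutes:
  assumes "\<And>x. x \<notin> S \<Longrightarrow> f x = x" "\<And>x. x \<in> S \<Longrightarrow> f x \<in> S \<and> f (f x) = x"
  shows "f permutes S"
  unfolding permutes_def using assms by metis

definition turn_closed :: "'h fmap \<Rightarrow> 'h set \<Rightarrow> bool" where
  "turn_closed G S \<longleftrightarrow> S \<subseteq> halves G \<and> (\<forall>x\<in>S. \<forall>c. turn G c x \<in> S)"

lemma turn_closedD: "turn_closed G S \<Longrightarrow> S \<subseteq> halves G" "turn_closed G S \<Longrightarrow> x \<in> S \<Longrightarrow> turn G c x \<in> S"
  by (auto simp: turn_closed_def)

lemma turn_closed_Un: "turn_closed G S \<Longrightarrow> turn_closed G T \<Longrightarrow> turn_closed G (S \<union> T)"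
  by (auto simp: turn_closed_def)

lemma turn_closed_Diff: "rotsys G \<Longrightarrow> turn_closed G S \<Longrightarrow> turn_closed G T \<Longrightarrow> turn_closed G (S - T)"
  unfolding turn_closed_def by (metis DiffD1 DiffD2 DiffI subset_iff turn_turn)

lemma turn_closed_halves: "rotsys G \<Longrightarrow> turn_closed G (halves G)"
  by (auto simp: turn_closed_def)

lemma turn_closed_vertex: "rotsys G \<Longrightarrow> d \<in> halves G \<Longrightarrow> turn_closed G (vertex G d)"
  using vertex_sub vertex_closed unfolding turn_closed_def by metis

lemma rot_closed: "turn_closed G S \<Longrightarrow> x \<in> S \<Longrightarrow> rot G x \<in> S"
  using turn_closedD(2)[of G S x LS] turn_closedD(2)[of G S x RS] by (cases "x \<in> outs G") auto

lemma submap_vertex: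
  assumes "rotsys G" "turn_closed G S" "d \<in> S"
  shows "vertex (submap G S m k) d = vertex G d"
  unfolding vertex_def
  by (rule orbit_cong0[OF assms(3)]) (use rot_closed[OF assms(2)] in auto)

lemma submap_turn:
  assumes "turn_closed G S" "d \<in> S"
  shows "turn (submap G S m k) c d = turn G c d"
  using assms rot_closed[OF assms(1)] by (cases c) auto

lemma submap_fmap:
  assumes "rotsys G" "turn_closed G S" "fpf_inv S m" "\<And>d. d \<in> S \<Longrightarrow> m d \<in> outs G \<longleftrightarrow> d \<notin> outs G"
  shows "is_fmap (submap G S m k)"
proof -
  let ?G = "submap G S m k"
  have S: "S \<subseteq> halves G" using assms(2) by (rule turn_closedD)
  have fin: "finite S" using assms(1) S by (auto simp: rotsys_def intro: finite_subset)
  have inj: "inj_on (rot ?G) S" using rot_inj[OF assms(1)] by (auto intro!: inj_onI)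
  have "rot ?G ` S \<subseteq> S" using rot_closed[OF assms(2)] by auto
  then have "rot ?G ` S = S" by (rule endo_inj_surj[OF fin _ inj])
  then have "bij_betw (rot ?G) S S" using inj by (simp add: bij_betw_def)
  then have "rot ?G permutes S" by (rule bij_imp_permutes) (simp add: submap_def)
  moreover have "mate ?G permutes S"
    by (rule involution_permutes) (use assms(3) in \<open>auto simp: submap_def fpf_inv_def\<close>)
  moreover have "fpf_inv S (mate ?G)" using assms(3) by (auto simp: fpf_inv_def submap_def)
  moreover have "card (vertex ?G d) = 4" "rot ?G d \<in> outs ?G \<longleftrightarrow> d \<notin> outs ?G" if "d \<in> S" for d
    using that S assms(1) submap_vertex[OF assms(1,2) that] rot_closed[OF assms(2) that]
    by (auto simp: rotsys_def)
  moreover have "mate ?G d \<in> outs ?G \<longleftrightarrow> d \<notin> outs ?G" if "d \<in> S" for d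
    using that assms(3,4) by (auto simp: fpf_inv_def)
  ultimately show ?thesis using fin by (simp add: is_fmap_iff rotsys_def)
qed

lemma submap_ccount:
  assumes "turn_closed G S"
  shows "ccount (submap G S m k) A = ncc S (gr S (insert m (turn G ` A))) + k"
proof -
  have "gr S (insert (mate (submap G S m k)) (turn (submap G S m k) ` A)) = gr S (insert m (turn G ` A))"
    by (rule gr_image_cong) (use submap_turn[OF assms] in auto)
  then show ?thesis by (simp add: ccount_def)
qed

section \<open>Dipoles and ladders\<close>

text \<open>\<open>h\<close> is one half of a dipole edge, and the other dipole edge is reached from
  it by turning along the third strand. On each side the leg at the vertex of \<open>h\<close> comes
  first.\<close>

definition dpiece :: "'h fmap \<Rightarrow> strand \<Rightarrow> strand \<Rightarrow> 'h \<Rightarrow> 'h piece" where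
  "dpiece G c1 c2 h = \<lparr>body = vertex G h \<union> vertex G (mate G h),
     side1 = (turn G c1 h, turn G c1 (mate G h)), side2 = (turn G c2 h, turn G c2 (mate G h))\<rparr>"

text \<open>The last two conditions reflect that \<open>face_dipole_at\<close> fixes the order of the two sides.\<close>

definition rung_at :: "'h fmap \<Rightarrow> strand \<Rightarrow> 'h piece \<Rightarrow> strand \<Rightarrow> strand \<Rightarrow> 'h \<Rightarrow> 'h \<Rightarrow> bool" where
  "rung_at G c X c1 c2 h h' \<longleftrightarrow> c \<noteq> c1 \<and> c \<noteq> c2 \<and> c1 \<noteq> c2 \<and> h \<in> halves G \<and> mate G h = h' \<and>
     mate G (turn G c h) = turn G c h' \<and> h' \<notin> vertex G h \<and> X = dpiece G c1 c2 h \<and>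
     (c = LS \<longrightarrow> (c1 = NS \<longleftrightarrow> h \<in> outs G)) \<and> (c = RS \<longrightarrow> (c1 = NS \<longleftrightarrow> h \<notin> outs G))"

definition rung :: "'h fmap \<Rightarrow> strand \<Rightarrow> 'h piece \<Rightarrow> bool" where
  "rung G c X \<longleftrightarrow> (\<exists>c1 c2 h h'. rung_at G c X c1 c2 h h')"

text \<open>Reading a piece from its other end also swaps the legs within each side. For face
  dipoles this is forced: the orientation conditions of \<open>rung_at\<close> tie the first side to
  the direction of \<open>h\<close>, so \<open>h\<close> and its mate change roles.\<close>

definition turn_around :: "'h piece \<Rightarrow> 'h piece" where
  "turn_around X = \<lparr>body = body X, side1 = prod.swap (side2 X), side2 = prod.swap (side1 X)\<rparr>"

text \<open>All that contraction needs to know about a piece. It leaves open where the legs lead: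
  they may be attached to each other or back to the piece.\<close>

definition ported :: "'h fmap \<Rightarrow> 'h piece \<Rightarrow> bool" where
  "ported G X \<longleftrightarrow> turn_closed G (body X) \<and> legs_of (side1 X) \<subseteq> body X \<and> legs_of (side2 X) \<subseteq> body X \<and>
     distinct [fst (side1 X), snd (side1 X), fst (side2 X), snd (side2 X)] \<and>
     (fst (side1 X) \<in> outs G \<longleftrightarrow> snd (side1 X) \<notin> outs G) \<and>
     (fst (side2 X) \<in> outs G \<longleftrightarrow> snd (side2 X) \<notin> outs G) \<and>
     (\<forall>d\<in>body X - legs_of (side1 X) - legs_of (side2 X).
        mate G d \<in> body X - legs_of (side1 X) - legs_of (side2 X))"

lemma vertex_eq_iff:
  assumes "rotsys G" "x \<in> halves G" "y \<in> halves G"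
  shows "vertex G x = vertex G y \<longleftrightarrow> y \<in> vertex G x"
proof
  show "vertex G x = vertex G y \<Longrightarrow> y \<in> vertex G x" using vertex_self[OF assms(1,3)] by simp
  assume y: "y \<in> vertex G x"
  then have "vertex G y \<subseteq> vertex G x" using vertex_least[OF assms(1,3) y] vertex_closed assms by metis
  moreover have "card (vertex G x) = 4" "card (vertex G y) = 4" using assms by (auto simp: rotsys_def)
  moreover from this have "finite (vertex G x)" by (metis card.infinite zero_neq_numeral)
  ultimately show "vertex G x = vertex G y" using card_subset_eq by metis
qed

lemma vertex_disjoint:
  assumes "rotsys G" "x \<in> halves G" "y \<in> halves G" "y \<notin> vertex G x"
  shows "vertex G x \<inter> vertex G y = {}"
proof (rule ccontr)
  assume "vertex G x \<inter> vertex G y \<noteq> {}"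
  then obtain z where z: "z \<in> vertex G x" "z \<in> vertex G y" by blast
  then have "z \<in> halves G" using vertex_sub[OF assms(1,2)] by blast
  then have "vertex G x = vertex G y" using z vertex_eq_iff[OF assms(1)] assms(2,3) by metis
  then show False using vertex_self[OF assms(1,3)] assms(4) by simp
qed

lemma rung_atD:
  assumes G: "is_fmap G" and X: "rung_at G c X c1 c2 h h'"
  shows "c \<noteq> c1" "c \<noteq> c2" "c1 \<noteq> c2" "h \<in> halves G" "h' \<in> halves G" "mate G h = h'" "mate G h' = h"
    "mate G (turn G c h) = turn G c h'" "mate G (turn G c h') = turn G c h"
    "vertex G h \<inter> vertex G h' = {}" "body X = vertex G h \<union> vertex G h'"
    "vertex G h = {h, turn G c h, turn G c1 h, turn G c2 h}"
    "vertex G h' = {h', turn G c h', turn G c1 h', turn G c2 h'}"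
    "side1 X = (turn G c1 h, turn G c1 h')" "side2 X = (turn G c2 h, turn G c2 h')"
    "h' \<in> outs G \<longleftrightarrow> h \<notin> outs G" "X = dpiece G c1 c2 h"
    "c = LS \<Longrightarrow> (c1 = NS \<longleftrightarrow> h \<in> outs G)" "c = RS \<Longrightarrow> (c1 = NS \<longleftrightarrow> h \<notin> outs G)"
    "\<And>x y. turn G x h \<noteq> turn G y h'" "\<And>y. h \<noteq> turn G y h'" "\<And>x. h' \<noteq> turn G x h" "h \<noteq> h'"
proof -
  note * = X[unfolded rung_at_def]
  note rs = fmapD(1)[OF G]
  have U: "UNIV = {c, c1, c2}" using * UNIV_strand by (cases c; cases c1; cases c2) auto
  have v: "vertex G x = {x, turn G c x, turn G c1 x, turn G c2 x}" if "x \<in> halves G" for x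
    unfolding vertex_turn[OF rs that] U by auto
  have h: "h \<in> halves G" using * by simp
  note m = mateD[OF G h]
  show "c \<noteq> c1" "c \<noteq> c2" "c1 \<noteq> c2" "h \<in> halves G" "mate G (turn G c h) = turn G c h'" "X = dpiece G c1 c2 h"
    "mate G h = h'" "c = LS \<Longrightarrow> (c1 = NS \<longleftrightarrow> h \<in> outs G)" "c = RS \<Longrightarrow> (c1 = NS \<longleftrightarrow> h \<notin> outs G)" using * by auto
  show H: "h' \<in> halves G" "mate G h' = h" "h' \<in> outs G \<longleftrightarrow> h \<notin> outs G" using m * by auto
  show "mate G (turn G c h') = turn G c h" using * mateD(2)[OF G turn_in[OF rs h], of c] by simp
  show "vertex G h = {h, turn G c h, turn G c1 h, turn G c2 h}"
    "vertex G h' = {h', turn G c h', turn G c1 h', turn G c2 h'}" using v h H by auto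
  show "body X = vertex G h \<union> vertex G h'" "side1 X = (turn G c1 h, turn G c1 h')"
    "side2 X = (turn G c2 h, turn G c2 h')" using * by (auto simp: dpiece_def)
  show d: "vertex G h \<inter> vertex G h' = {}" by (rule vertex_disjoint[OF rs h H(1)]) (use * in simp)
  show "turn G x h \<noteq> turn G y h'" "h \<noteq> turn G y h'" "h' \<noteq> turn G x h" "h \<noteq> h'" for x y
  proof -
    have "turn G x h \<in> vertex G h" "h \<in> vertex G h" "turn G y h' \<in> vertex G h'" "h' \<in> vertex G h'"
      using h H vertex_turn[OF rs] by auto
    then show "turn G x h \<noteq> turn G y h'" "h \<noteq> turn G y h'" "h' \<noteq> turn G x h" "h \<noteq> h'"
      using d by auto
  qed
qed

lemma rung_ported:
  assumes G: "is_fmap G" and X: "rung G c X"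
  shows "ported G X"
proof -
  obtain c1 c2 h h' where at: "rung_at G c X c1 c2 h h'" using X by (auto simp: rung_def)
  note * = rung_atD(1-16,20-23)[OF G at]
  note rs = fmapD(1)[OF G]
  have "turn_closed G (body X)"
    unfolding *(11) by (intro turn_closed_Un turn_closed_vertex rs *(4,5))
  moreover have "legs_of (side1 X) \<subseteq> body X" "legs_of (side2 X) \<subseteq> body X"
    using * by (auto simp: legs_of_def)
  moreover have "distinct [fst (side1 X), snd (side1 X), fst (side2 X), snd (side2 X)]"
    using *(3,4,5,10) unfolding *(12-15) by (auto simp: rs)
  moreover have "\<forall>d\<in>body X - legs_of (side1 X) - legs_of (side2 X).
      mate G d \<in> body X - legs_of (side1 X) - legs_of (side2 X)"
  proof -
    have "body X - legs_of (side1 X) - legs_of (side2 X) = {h, h', turn G c h, turn G c h'}"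
    proof -
      show ?thesis using *(1-5,17-20) unfolding *(11-15) legs_of_def
        by (auto simp: rs dest: sym)
    qed
    then show ?thesis using *(6-9) by auto
  qed
  ultimately show ?thesis
    using *(4,5,14-16) unfolding ported_def by (simp add: turn_out[OF rs])
qed

lemma body_turn_around [simp]: "body (turn_around X) = body X"
  by (simp add: turn_around_def)

lemma sides_turn_around [simp]: "side1 (turn_around X) = prod.swap (side2 X)" "side2 (turn_around X) = prod.swap (side1 X)"
  by (simp_all add: turn_around_def)

lemma legs_of_swap [simp]: "legs_of (prod.swap s) = legs_of s"
  by (cases s) (auto simp: legs_of_def)

lemma turn_around_rung:
  assumes G: "is_fmap G" and X: "rung G c X"
  shows "rung G c (turn_around X)"
proof -
  obtain c1 c2 h h' where at: "rung_at G c X c1 c2 h h'" using X by (auto simp: rung_def)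
  note * = rung_atD(1-10,16-19)[OF G at]
  have "turn_around X = dpiece G c2 c1 h'"
    using *(6,7,12) by (auto simp: turn_around_def dpiece_def)
  moreover have "c = LS \<Longrightarrow> (c2 = NS \<longleftrightarrow> h' \<in> outs G)" "c = RS \<Longrightarrow> (c2 = NS \<longleftrightarrow> h' \<notin> outs G)"
    using * by (cases c1; cases c2; simp)+
  moreover have "h \<notin> vertex G h'" using *(4,10) vertex_self[OF fmapD(1)[OF G], of h] by auto
  ultimately have "rung_at G c (turn_around X) c2 c1 h' h" unfolding rung_at_def using * by simp
  then show ?thesis by (auto simp: rung_def)
qed

definition chain :: "strand set \<Rightarrow> 'h fmap \<Rightarrow> 'h piece list \<Rightarrow> bool" where
  "chain T G ds \<longleftrightarrow> ds \<noteq> [] \<and> (\<forall>D\<in>set ds. \<exists>c\<in>T. rung G c D) \<and>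
     sorted_wrt (\<lambda>D E. body D \<inter> body E = {}) ds \<and>
     successively (\<lambda>D E. mate G ` legs_of (side2 D) = legs_of (side1 E)) ds"

definition ladder_piece :: "'h piece list \<Rightarrow> 'h piece" where
  "ladder_piece ds = \<lparr>body = (\<Union>D\<in>set ds. body D), side1 = side1 (hd ds), side2 = side2 (last ds)\<rparr>"

lemma chain_single: "rung G c D \<Longrightarrow> c \<in> T \<Longrightarrow> chain T G [D]"
  by (auto simp: chain_def)

lemma ladder_piece_single [simp]: "ladder_piece [D] = D"
  by (simp add: ladder_piece_def)

lemma ladder_piece_snoc: "ds \<noteq> [] \<Longrightarrow> ladder_piece (ds @ [D]) =
   \<lparr>body = body (ladder_piece ds) \<union> body D, side1 = side1 (ladder_piece ds), side2 = side2 D\<rparr>"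
  by (auto simp: ladder_piece_def)

lemma chain_snoc: "ds \<noteq> [] \<Longrightarrow> chain T G (ds @ [D]) \<longleftrightarrow> chain T G ds \<and> (\<exists>c\<in>T. rung G c D) \<and>
    body (ladder_piece ds) \<inter> body D = {} \<and>
    mate G ` legs_of (side2 (ladder_piece ds)) = legs_of (side1 D)"
  by (auto simp: chain_def ladder_piece_def sorted_wrt_append successively_append_iff)

lemma chain_induct [consumes 1, case_names single snoc]:
  assumes "chain T G ds"
    and "\<And>D c. c \<in> T \<Longrightarrow> rung G c D \<Longrightarrow> P [D]"
    and "\<And>ds D c. chain T G ds \<Longrightarrow> c \<in> T \<Longrightarrow> rung G c D \<Longrightarrow> body (ladder_piece ds) \<inter> body D = {} \<Longrightarrow>
      mate G ` legs_of (side2 (ladder_piece ds)) = legs_of (side1 D) \<Longrightarrow> P ds \<Longrightarrow> P (ds @ [D])"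
  shows "P ds"
  using assms(1)
proof (induction ds rule: rev_induct)
  case Nil
  then show ?case by (simp add: chain_def)
next
  case (snoc D ds)
  show ?case
  proof (cases "ds = []")
    case True
    then show ?thesis using snoc(2) assms(2) by (auto simp: chain_def)
  next
    case False
    then show ?thesis using snoc(1) snoc(2)[unfolded chain_snoc[OF False]] assms(3) by blast
  qed
qed

text \<open>The facing legs become inner half-edges; since \<open>mate\<close> is an involution, the
  link may be read in both directions.\<close>

lemma ported_snoc:
  assumes G: "is_fmap G" and X: "ported G X" and D: "ported G D" and d: "body X \<inter> body D = {}"
    and l: "mate G ` legs_of (side2 X) = legs_of (side1 D)"
  shows "ported G \<lparr>body = body X \<union> body D, side1 = side1 X, side2 = side2 D\<rparr>"
proof -
  have L: "legs_of (side1 X) \<subseteq> body X" "legs_of (side2 X) \<subseteq> body X" "legs_of (side1 D) \<subseteq> body D"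
    "legs_of (side2 D) \<subseteq> body D" "legs_of (side1 X) \<inter> legs_of (side2 X) = {}"
    "legs_of (side1 D) \<inter> legs_of (side2 D) = {}"
    using X D unfolding ported_def legs_of_def by auto
  have "mate G d \<in> (body X \<union> body D) - legs_of (side1 X) - legs_of (side2 D)"
    if d': "d \<in> (body X \<union> body D) - legs_of (side1 X) - legs_of (side2 D)" for d
  proof -
    consider "d \<in> body X - legs_of (side1 X) - legs_of (side2 X)" | "d \<in> legs_of (side2 X)"
      | "d \<in> body D - legs_of (side1 D) - legs_of (side2 D)" | "d \<in> legs_of (side1 D)" using d' by blast
    then show ?thesis
    proof cases
      case 1
      then have "mate G d \<in> body X - legs_of (side1 X)" using X unfolding ported_def by blast
      then show ?thesis using L d by blast
    next
      case 2
      then have "mate G d \<in> legs_of (side1 D)" using l by blast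
      then show ?thesis using L d by blast
    next
      case 3
      then have "mate G d \<in> body D - legs_of (side2 D)" using D unfolding ported_def by blast
      then show ?thesis using L d by blast
    next
      case 4
      then obtain e where e: "e \<in> legs_of (side2 X)" "d = mate G e" using l by blast
      then have "e \<in> body X" "e \<in> halves G" using X by (auto simp: ported_def turn_closed_def)
      then have "mate G d \<in> legs_of (side2 X)" using e mateD(2)[OF G] by simp
      then show ?thesis using L d by blast
    qed
  qed
  then have 1: "\<forall>d\<in>(body X \<union> body D) - legs_of (side1 X) - legs_of (side2 D).
      mate G d \<in> (body X \<union> body D) - legs_of (side1 X) - legs_of (side2 D)" by blast
  have 2: "turn_closed G (body X \<union> body D)" using X D by (auto simp: ported_def intro: turn_closed_Un)
  have 3: "distinct [fst (side1 X), snd (side1 X), fst (side2 D), snd (side2 D)]"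
  proof -
    have "{fst (side1 X), snd (side1 X)} \<subseteq> body X" "{fst (side2 D), snd (side2 D)} \<subseteq> body D"
      using L(1,4) by (simp_all add: legs_of_def)
    then have "{fst (side1 X), snd (side1 X)} \<inter> {fst (side2 D), snd (side2 D)} = {}" using d by blast
    moreover have "fst (side1 X) \<noteq> snd (side1 X)" "fst (side2 D) \<noteq> snd (side2 D)"
      using X D by (simp_all add: ported_def)
    ultimately show ?thesis by auto
  qed
  show ?thesis using 1 2 3 L X D unfolding ported_def by (simp add: le_supI1 le_supI2)
qed

lemma chain_ported:
  assumes G: "is_fmap G" and ch: "chain T G ds"
  shows "ported G (ladder_piece ds)"
  using ch
proof (induction rule: chain_induct)
  case (single D c)
  then show ?case by (simp add: rung_ported[OF G])
next
  case (snoc ds D c)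
  then have "ds \<noteq> []" by (simp add: chain_def)
  then show ?case using ported_snoc[OF G snoc(6) rung_ported[OF G snoc(3)] snoc(4,5)] by (simp add: ladder_piece_snoc)
qed

text \<open>Chains grow at their last rung only; reversal transfers every statement about one end to
  the other end.\<close>

lemma turn_around_chain:
  assumes G: "is_fmap G" and c: "chain T G ds"
  shows "chain T G (rev (map turn_around ds))"
    "ladder_piece (rev (map turn_around ds)) = turn_around (ladder_piece ds)"
proof -
  have ne: "ds \<noteq> []" using c by (simp add: chain_def)
  have link: "mate G ` legs_of (side2 (turn_around E)) = legs_of (side1 (turn_around D))"
    if "D \<in> set ds" "mate G ` legs_of (side2 D) = legs_of (side1 E)" for D E
  proof -
    have "ported G D" using that(1) c rung_ported[OF G] by (auto simp: chain_def)
    then have "legs_of (side2 D) \<subseteq> halves G" by (auto simp: ported_def turn_closed_def)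
    then have "mate G ` mate G ` legs_of (side2 D) = legs_of (side2 D)"
      using mateD(2)[OF G] by (force simp: image_image)
    then show ?thesis using that(2) by simp
  qed
  have "successively (\<lambda>x y. mate G ` legs_of (side2 (turn_around y)) = legs_of (side1 (turn_around x))) ds"
    by (rule successively_mono[of "\<lambda>D E. mate G ` legs_of (side2 D) = legs_of (side1 E)"])
      (use c link in \<open>auto simp: chain_def\<close>)
  moreover have "sorted_wrt (\<lambda>D E. body E \<inter> body D = {}) ds" using c by (auto simp: chain_def Int_commute)
  ultimately show "chain T G (rev (map turn_around ds))"
    using ne c turn_around_rung[OF G]
    by (simp add: chain_def sorted_wrt_rev sorted_wrt_map successively_map) blast
  show "ladder_piece (rev (map turn_around ds)) = turn_around (ladder_piece ds)"
    using ne by (auto simp: ladder_piece_def turn_around_def hd_rev last_rev hd_map last_map)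
qed

text \<open>A ladder closed at both ends. Opening the last rung by a flip splits off one component.\<close>

definition closing :: "'h fmap \<Rightarrow> 'h piece \<Rightarrow> ('h \<Rightarrow> 'h) \<Rightarrow> bool" where
  "closing G X m \<longleftrightarrow> (\<forall>d\<in>body X - legs_of (side1 X) - legs_of (side2 X). m d = mate G d) \<and>
     m (fst (side1 X)) = snd (side1 X) \<and> m (snd (side1 X)) = fst (side1 X) \<and>
     m (fst (side2 X)) = snd (side2 X) \<and> m (snd (side2 X)) = fst (side2 X)"

lemma closing_fpf:
  assumes G: "is_fmap G" and X: "ported G X" and m: "closing G X m"
  shows "fpf_inv (body X) m"
proof -
  let ?L = "legs_of (side1 X) \<union> legs_of (side2 X)"
  have LB: "?L \<subseteq> body X" and BH: "body X \<subseteq> halves G" using X by (auto simp: ported_def turn_closed_def)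
  have ml: "m d \<in> ?L \<and> m (m d) = d \<and> m d \<noteq> d" if "d \<in> ?L" for d
  proof -
    obtain p q p' q' where s: "side1 X = (p, q)" "side2 X = (p', q')" by force
    have "p \<noteq> q" "p' \<noteq> q'" "m p = q" "m q = p" "m p' = q'" "m q' = p'"
      using X m s by (auto simp: closing_def ported_def)
    moreover have "?L = {p, q, p', q'}" by (auto simp: s legs_of_def)
    ultimately show ?thesis using that by auto
  qed
  show ?thesis
  proof (unfold fpf_inv_def, intro ballI)
    fix d assume d: "d \<in> body X"
    show "m d \<in> body X \<and> m (m d) = d \<and> m d \<noteq> d"
    proof (cases "d \<in> ?L")
      case True
      then show ?thesis using ml LB by blast
    next
      case False
      have md: "m d = mate G d" using False d m by (auto simp: closing_def)
      have B: "mate G d \<in> body X - legs_of (side1 X) - legs_of (side2 X)"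
        using False d X unfolding ported_def by blast
      then have "m (mate G d) = mate G (mate G d)" using m unfolding closing_def by blast
      then show ?thesis using md B mateD[OF G, of d] d BH by auto
    qed
  qed
qed

text \<open>A rung closed on both sides consists of two vertices joined by four edges, and
  \<open>m\<close> exchanges the vertices and commutes with every turn. Hence each strand cycle has
  two half-edges at either vertex, and there are \<open>8 / 4 = 2\<close> of each kind.\<close>

lemma rung_closing_count:
  assumes G: "is_fmap G" and X: "rung G c X" and m: "closing G X m"
  shows "ncc (body X) (gr (body X) {m, turn G c'}) = 2"
    "ncc (body X) (gr (body X) (insert m (range (turn G)))) = 1" "card (body X) = 8"
proof -
  have P: "ported G X" by (rule rung_ported[OF G X])
  have mB: "fpf_inv (body X) m" by (rule closing_fpf[OF G P m])
  note rs = fmapD(1)[OF G]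
  have BH: "turn_closed G (body X)" using P by (simp add: ported_def)
  have tB: "fpf_inv (body X) (turn G k)" for k
    using BH rs unfolding fpf_inv_def turn_closed_def by (meson subsetD turn_neq turn_turn)
  obtain c1 c2 h h' where at: "rung_at G c X c1 c2 h h'" using X by (auto simp: rung_def)
  note * = rung_atD(1-15,20-23)[OF G at]
  show cardB: "card (body X) = 8"
  proof -
    have "card (vertex G x) = 4" if "x \<in> halves G" for x using rs that by (auto simp: rotsys_def)
    moreover from this have "finite (vertex G x)" if "x \<in> halves G" for x
      using that by (metis card.infinite zero_neq_numeral)
    ultimately show ?thesis using *(4,5,10) unfolding *(11) by (simp add: card_Un_disjoint)
  qed
  have h: "h \<in> halves G" "h' \<in> halves G" "vertex G h \<inter> vertex G h' = {}" "body X = vertex G h \<union> vertex G h'"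
    by (rule *(4,5,10,11))+
  have hm: "m h = h'" "m h' = h" "\<And>k. m (turn G k h) = turn G k h'" "\<And>k. m (turn G k h') = turn G k h"
  proof -
    have in1: "h \<in> body X - legs_of (side1 X) - legs_of (side2 X)" "h' \<in> body X - legs_of (side1 X) - legs_of (side2 X)"
      "turn G c h \<in> body X - legs_of (side1 X) - legs_of (side2 X)" "turn G c h' \<in> body X - legs_of (side1 X) - legs_of (side2 X)"
      using *(1-5,16-19) unfolding *(11,12,13,14,15) legs_of_def by (auto simp: rs dest: sym)
    have k: "k = c \<or> k = c1 \<or> k = c2" for k using *(1-3) by (cases c; cases c1; cases c2; cases k; simp)
    show "m h = h'" "m h' = h" using * in1 m by (auto simp: closing_def)
    show "m (turn G k h) = turn G k h'" "m (turn G k h') = turn G k h" for k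
      using k[of k] m in1 *(8,9,14,15) by (auto simp: closing_def)
  qed
  note h = h hm
  have cm: "m (turn G k x) = turn G k (m x)" if xX: "x \<in> body X" for k x
  proof -
    consider "x = h" | "x = h'" | j where "x = turn G j h" | j where "x = turn G j h'"
      using xX unfolding h(4) vertex_turn[OF rs h(1)] vertex_turn[OF rs h(2)] Un_iff insert_iff image_iff bex_UNIV
      by metis
    then show ?thesis
    proof cases
      case 3
      then show ?thesis using h(1,2,5-8) turn_third[OF rs, of _ k j] rs by (cases "k = j") auto
    next
      case 4
      then show ?thesis using h(1,2,5-8) turn_third[OF rs, of _ k j] rs by (cases "k = j") auto
    qed (use h in auto)
  qed
  have mv: "m x \<in> vertex G h \<longleftrightarrow> x \<notin> vertex G h" if x: "x \<in> body X" for x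
  proof -
    have in0: "h \<in> vertex G h" "h' \<in> vertex G h'" "turn G k h \<in> vertex G h" "turn G k h' \<in> vertex G h'" for k
      using vertex_turn[OF rs] h(1,2) by auto
    have "m x \<in> vertex G h'" if "x \<in> vertex G h" using that in0 h(5,7) unfolding vertex_turn[OF rs h(1)] by auto
    moreover have "m x \<in> vertex G h" if "x \<in> vertex G h'" using that in0 h(6,8) unfolding vertex_turn[OF rs h(2)] by auto
    ultimately show ?thesis using x h(3,4) by auto
  qed
  have fB: "finite (body X)" using cardB by (metis card.infinite zero_neq_numeral)
  have "4 * ncc (body X) (gr (body X) {m, turn G c'}) = card (body X)"
  proof (rule ncc_card_class_eq[OF fB])
    fix x assume x: "x \<in> body X"
    let ?S = "{x, turn G c' x, m x, turn G c' (m x)}"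
    note t = fpf_invD[OF tB x, of c'] and mm = fpf_invD[OF mB x]
    note mt = fpf_invD[OF tB mm(1), of c']
    have "eqc (gr (body X) {m, turn G c'}) `` {x} \<subseteq> ?S"
    proof (rule gr_closed_class)
      show "f y \<in> ?S" if "f \<in> {m, turn G c'}" "y \<in> ?S" for f y
        using that cm[OF x, of c'] cm[OF mm(1), of c'] t mm mt by auto
    qed (use mB tB x t mm mt in auto)
    moreover have "(x, m x) \<in> eqc (gr (body X) {m, turn G c'})" "(x, turn G c' x) \<in> eqc (gr (body X) {m, turn G c'})"
      "(m x, turn G c' (m x)) \<in> eqc (gr (body X) {m, turn G c'})"
      using x mm(1) by (auto intro!: eqc_base simp: gr_iff)
    ultimately have eq: "eqc (gr (body X) {m, turn G c'}) `` {x} = ?S" by (auto intro: eqc_trans)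
    have "y \<in> vertex G h \<longleftrightarrow> turn G c' y \<in> vertex G h" if "y \<in> body X" for y
      using vertex_closed[OF rs h(1), of _ c'] that fpf_invD(2)[OF tB that, of c'] by metis
    then have "turn G c' x \<noteq> m x" "x \<noteq> turn G c' (m x)" "turn G c' x \<noteq> turn G c' (m x)"
      using mv[OF x] x mm(1) by metis+
    then show "card (eqc (gr (body X) {m, turn G c'}) `` {x}) = 4" "eqc (gr (body X) {m, turn G c'}) `` {x} \<subseteq> body X"
      unfolding eq using t mm mt x by auto
  qed
  then show "ncc (body X) (gr (body X) {m, turn G c'}) = 2" using cardB by simp
  show "ncc (body X) (gr (body X) (insert m (range (turn G)))) = 1"
  proof (rule ncc_one[of h])
    let ?R = "gr (body X) (insert m (range (turn G)))"
    show hB: "h \<in> body X" using h(1,4) vertex_self[OF rs h(1)] by auto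
    have st: "(x, m x) \<in> eqc ?R" "(x, turn G k x) \<in> eqc ?R" if "x \<in> body X" for x k
      using that by (auto intro!: eqc_base simp: gr_iff)
    have h': "h' \<in> body X" using h(2,4) vertex_self[OF rs h(2)] by auto
    have hh: "(h, h') \<in> eqc ?R" using st(1)[OF hB] h by simp
    show "(h, y) \<in> eqc ?R" if xX: "y \<in> body X" for y
    proof -
      consider "y = h" | "y = h'" | j where "y = turn G j h" | j where "y = turn G j h'"
        using xX unfolding h(4) vertex_turn[OF rs h(1)] vertex_turn[OF rs h(2)] Un_iff insert_iff image_iff bex_UNIV
      by metis
      then show ?thesis
      proof cases
        case 4
        then show ?thesis using eqc_trans[OF hh st(2)[OF h']] by blast
      qed (use hh st(2)[OF hB] in auto)
    qed
  qed
qed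

lemma chain_closing_count:
  assumes G: "is_fmap G" and ch: "chain T G ds" and m: "closing G (ladder_piece ds) m"
  shows "ncc (body (ladder_piece ds)) (gr (body (ladder_piece ds)) {m, turn G c'}) = Suc (length ds) \<and>
    ncc (body (ladder_piece ds)) (gr (body (ladder_piece ds)) (insert m (range (turn G)))) = 1 \<and>
    card (body (ladder_piece ds)) = 8 * length ds"
  using ch m
proof (induction arbitrary: m rule: chain_induct)
  case (single D c)
  then show ?case using rung_closing_count[OF G single(2)] by simp
next
  case (snoc ds D c)
  note rs = fmapD(1)[OF G]
  have ne: "ds \<noteq> []" using snoc(1) by (simp add: chain_def)
  let ?X = "ladder_piece ds" and ?Y = "ladder_piece (ds @ [D])"
  let ?B = "body ?X" and ?C = "body D"
  have Y: "body ?Y = ?B \<union> ?C" "side1 ?Y = side1 ?X" "side2 ?Y = side2 D" using ladder_piece_snoc[OF ne, of D] by auto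
  have PX: "ported G ?X" and PD: "ported G D" and PY: "ported G ?Y"
    using chain_ported[OF G snoc(1)] rung_ported[OF G snoc(3)]
      ported_snoc[OF G chain_ported[OF G snoc(1)] rung_ported[OF G snoc(3)] snoc(4,5)]
    by (auto simp: ladder_piece_snoc[OF ne])
  obtain a b p q where s1: "side1 ?X = (a, b)" "side2 ?X = (p, q)" by force
  obtain z w u v where s2: "side1 D = (z, w)" "side2 D = (u, v)" by force
  have in1: "a \<in> ?B" "b \<in> ?B" "p \<in> ?B" "q \<in> ?B" "distinct [a, b, p, q]"
    using PX by (auto simp: ported_def s1 legs_of_def)
  have in2: "z \<in> ?C" "w \<in> ?C" "u \<in> ?C" "v \<in> ?C" "distinct [z, w, u, v]"
    using PD by (auto simp: ported_def s2 legs_of_def)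
  have disj: "?B \<inter> ?C = {}" by (rule snoc(4))
  have cB: "turn_closed G ?B" and cC: "turn_closed G ?C" using PX PD by (auto simp: ported_def)
  have BH: "?B \<subseteq> halves G" "?C \<subseteq> halves G" using turn_closedD(1)[OF cB] turn_closedD(1)[OF cC] .
  have mm: "m d = mate G d" if "d \<in> ?B \<union> ?C - {a, b, u, v}" for d
    using snoc.prems that by (auto simp: closing_def Y s1 s2 legs_of_def)
  have mside: "m a = b" "m b = a" "m u = v" "m v = u" using snoc.prems by (auto simp: closing_def Y s1 s2)
  have "{mate G p, mate G q} = {z, w}" using snoc(5) by (simp add: s1 s2 legs_of_def)
  moreover have "m p = mate G p" "m q = mate G q" using mm in1 in2 disj by auto
  ultimately have pq: "{m p, m q} = {z, w}" by simp
  have mY: "fpf_inv (body ?Y) m" by (rule closing_fpf[OF G PY snoc.prems])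
  let ?m = "flip p q m"
  have tY: "fpf_inv (body ?Y) (turn G k)" for k
    using turn_closed_Un[OF cB cC] rs unfolding Y fpf_inv_def turn_closed_def by (meson subsetD turn_neq turn_turn)
  have fin: "finite (body ?Y)" using BH fmapD(2)[OF G] unfolding Y by (auto intro: finite_subset)
  have mpC: "m p \<in> ?C" "m q \<in> ?C" using pq in2 by auto
  have mC: "m x \<in> ?C" if xC: "x \<in> ?C - {m p, m q}" for x
  proof -
    consider "x = u" | "x = v" | "x \<in> ?C - legs_of (side1 D) - legs_of (side2 D)"
      using xC unfolding pq by (auto simp: s2 legs_of_def)
    then show ?thesis
    proof cases
      case 3
      then have "mate G x \<in> ?C" using PD by (auto simp: ported_def)
      moreover have "m x = mate G x" using mm[of x] 3 disj in1 by (auto simp: s2 legs_of_def)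
      ultimately show ?thesis by simp
    qed (use mside in2 in auto)
  qed
  \<comment> \<open>Switching the two edges that link the last rung cuts this rung off. A ladder
    with one more rung thus has the cycles of the closed shorter ladder, plus two for the closed
    rung, minus one for the flip.\<close>
  have split: "ncc (body ?Y) (gr (body ?Y) (insert ?m (turn G ` A))) = Suc (ncc (body ?Y) (gr (body ?Y) (insert m (turn G ` A))))"
    if "A \<noteq> {}" for A
  proof -
    interpret flip_setting "body ?Y" m "turn G ` A" p q
      using fin mY tY that in1 mpC disj by unfold_locales (auto simp: Y)
    show ?thesis
      by (rule flip_split'[where S = ?C]) (use mpC in1 disj turn_closedD(2)[OF cC] mC in auto)
  qed
  have mY': "fpf_inv (body ?Y) ?m" by (rule fpf_inv_flip[OF mY]) (use in1 Y in auto)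
  have m1: "?m d = m d" if "d \<in> ?B - {p, q}" for d
    using that mpC disj by (auto simp: flip_def)
  have mpq: "?m p = q" "?m q = p" using in1(5) by (auto simp: flip_def)
  have clX: "closing G ?X ?m"
    unfolding closing_def s1 s2 legs_of_def
  proof (intro conjI ballI)
    fix d assume d: "d \<in> ?B - {fst (a, b), snd (a, b)} - {fst (p, q), snd (p, q)}"
    then have "d \<noteq> u" "d \<noteq> v" using in2 disj by auto
    then show "?m d = mate G d" using d m1[of d] mm[of d] by auto
  qed (use m1[of a] m1[of b] in1 mside mpq in auto)
  have clD: "closing G D ?m"
  proof -
    have e: "?m d = m d" if "d \<in> ?C - {z, w}" for d using that pq in1 disj by (auto simp: flip_def)
    have zw: "?m z = w" "?m w = z"
      using pq in1 in2 disj by (auto simp: flip_def doubleton_eq_iff)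
    have md: "m d = mate G d" if "d \<in> ?C - {u, v}" for d using mm[of d] that in1 disj by auto
    show ?thesis unfolding closing_def s1 s2 legs_of_def
    proof (intro conjI ballI)
      fix d assume "d \<in> ?C - {fst (z, w), snd (z, w)} - {fst (u, v), snd (u, v)}"
      then show "?m d = mate G d" using e[of d] md[of d] by auto
    qed (use e[of u] e[of v] zw mside in2 in auto)
  qed
  have two: "ncc (body ?Y) (gr (body ?Y) (insert ?m (turn G ` A))) =
     ncc ?B (gr ?B (insert ?m (turn G ` A))) + ncc ?C (gr ?C (insert ?m (turn G ` A)))" for A
  proof -
    have d: "body ?Y - ?B = ?C" using disj Y by auto
    have "?m x \<in> ?B" if "x \<in> ?B" for x
      using closing_fpf[OF G PX clX] that by (auto simp: fpf_inv_def)
    then have "ncc (body ?Y) (gr (body ?Y) (insert ?m (turn G ` A))) =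
       ncc ?B (gr ?B (insert ?m (turn G ` A))) + ncc (body ?Y - ?B) (gr (body ?Y - ?B) (insert ?m (turn G ` A)))"
      by (intro ncc_split[OF fin]) (use mY' tY turn_closedD(2)[OF cB] Y in auto)
    then show ?thesis unfolding d .
  qed
  have "card (body ?Y) = 8 * length (ds @ [D])"
    using snoc(6)[OF clX] rung_closing_count(3)[OF G snoc(3) clD] fin disj unfolding Y
    by (subst card_Un_disjoint) auto
  then show ?case
    using split[of "{c'}"] split[of UNIV] two[of "{c'}"] two[of UNIV] snoc(6)[OF clX] rung_closing_count[OF G snoc(3) clD]
    by simp
qed

section \<open>Contraction\<close>

declare turn.simps [simp del]

lemma flip_out:
  assumes "fpf_inv H m" "\<And>d. d \<in> H \<Longrightarrow> m d \<in> P \<longleftrightarrow> d \<notin> P" "a \<in> H" "b \<in> H" "a \<in> P \<longleftrightarrow> b \<notin> P" "d \<in> H"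
  shows "flip a b m d \<in> P \<longleftrightarrow> d \<notin> P"
proof -
  have "m a \<in> P \<longleftrightarrow> a \<notin> P" "m b \<in> P \<longleftrightarrow> b \<notin> P" "m d \<in> P \<longleftrightarrow> d \<notin> P" using assms by auto
  then show ?thesis using assms(5) by (auto simp: flip_def)
qed

text \<open>\<open>m1\<close> closes the first side of the piece and \<open>m2\<close> the second
  one as well; the contraction is the part of \<open>m2\<close> outside the body. By
  \<open>ab\<close> closing the first side is a genuine flip, whereas the legs of the second side
  may already be attached to each other.\<close>

locale contraction =
  fixes G :: "'h fmap" and X :: "'h piece" and a b u v :: 'h
  assumes G: "is_fmap G" and X: "ported G X" and s1: "side1 X = (a, b)" and s2: "side2 X = (u, v)"
    and ab: "mate G a \<noteq> b"
begin

abbreviation "H \<equiv> halves G"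
abbreviation "B \<equiv> body X"
definition "m1 = flip a b (mate G)"
definition "m2 = flip u v m1"

lemmas rs = fmapD(1)[OF G]
lemmas fin = fmapD(2)[OF G]
lemmas mH = fmapD(6)[OF G]

lemma BC: "turn_closed G B" "B \<subseteq> H"
  using X by (auto simp: ported_def turn_closed_def)

lemma legs: "a \<in> B" "b \<in> B" "u \<in> B" "v \<in> B" "a \<noteq> b" "u \<noteq> v" "a \<noteq> u" "a \<noteq> v" "b \<noteq> u" "b \<noteq> v"
    "a \<in> outs G \<longleftrightarrow> b \<notin> outs G" "u \<in> outs G \<longleftrightarrow> v \<notin> outs G"
  using X by (auto simp: ported_def s1 s2 legs_of_def)

lemma legsH: "a \<in> H" "b \<in> H" "u \<in> H" "v \<in> H"
  using legs BC by auto

lemma inner: "d \<in> B - {a, b, u, v} \<Longrightarrow> mate G d \<in> B - {a, b, u, v}"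
proof -
  have "B - legs_of (side1 X) - legs_of (side2 X) = B - {a, b, u, v}" by (auto simp: s1 s2 legs_of_def)
  then show "d \<in> B - {a, b, u, v} \<Longrightarrow> mate G d \<in> B - {a, b, u, v}" using X unfolding ported_def by blast
qed

lemma m1H: "fpf_inv H m1"
  unfolding m1_def by (rule fpf_inv_flip[OF mH legsH(1,2) legs(5)])

lemma m2H: "fpf_inv H m2"
  unfolding m2_def by (rule fpf_inv_flip[OF m1H legsH(3,4) legs(6)])

lemma m1_out: "d \<in> H \<Longrightarrow> m1 d \<in> outs G \<longleftrightarrow> d \<notin> outs G"
  unfolding m1_def by (rule flip_out[OF mH]) (use mateD(4)[OF G] legsH legs in auto)

lemma m2_out: "d \<in> H \<Longrightarrow> m2 d \<in> outs G \<longleftrightarrow> d \<notin> outs G"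
  unfolding m2_def by (rule flip_out[OF m1H]) (use m1_out legsH legs in auto)

lemma m1_ab: "m1 a = b" "m1 b = a"
  using legs by (auto simp: m1_def flip_def)

lemma m1_inner: assumes "d \<in> B - {a, b, u, v}" shows "m1 d = mate G d"
proof -
  have "mate G d \<noteq> a" "mate G d \<noteq> b" using inner[OF assms] by auto
  then have "d \<noteq> mate G a" "d \<noteq> mate G b" using mateD(2)[OF G] legsH by auto
  then show ?thesis using assms by (simp add: m1_def flip_def)
qed

lemma m1_outer: assumes "d \<in> H - B" "mate G d \<notin> B" shows "m1 d = mate G d"
proof -
  have "mate G d \<noteq> a" "mate G d \<noteq> b" using assms legs by auto
  then have "d \<noteq> mate G a" "d \<noteq> mate G b" using mateD(2)[OF G] legsH by auto
  then show ?thesis using assms legs by (auto simp: m1_def flip_def)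
qed

lemma m2_eq_m1: "d \<notin> {u, v} \<Longrightarrow> m1 d \<notin> {u, v} \<Longrightarrow> d \<in> H \<Longrightarrow> m2 d = m1 d"
  using fpf_invD[OF m1H] legsH by (auto simp: m2_def flip_def)

lemma closing_m2: "closing G X m2"
proof -
  have "m2 d = mate G d" if "d \<in> B - {a, b, u, v}" for d
    using m2_eq_m1[of d] that m1_inner[OF that] inner[OF that] BC by auto
  moreover have "m2 a = b" "m2 b = a" using m2_eq_m1[of a] m2_eq_m1[of b] m1_ab legs legsH by auto
  moreover have "m2 u = v" "m2 v = u" using legs by (auto simp: m2_def flip_def)
  ultimately show ?thesis by (auto simp: closing_def s1 s2 legs_of_def)
qed

lemma m2B: "fpf_inv B m2"
  by (rule closing_fpf[OF G X closing_m2])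

lemma m2_outside: "d \<in> H - B \<Longrightarrow> m2 d \<in> H - B"
  using fpf_invD[OF m2B] fpf_invD[OF m2H] by (metis DiffD1 DiffD2 DiffI)

lemma m2_outer: assumes "d \<in> H - B" "mate G d \<notin> B" shows "m2 d = mate G d"
  using m2_eq_m1[of d] m1_outer[OF assms] assms legs by auto

text \<open>\<open>reconnect\<close> fixes the dropped legs while a flip joins them with each other,
  and off the body the two agree. A circle appears exactly if closing the first side attaches
  \<open>u\<close> to \<open>v\<close>.\<close>

lemma contract_submap: "contract G X = submap G (H - B) m2 (circles G + of_bool (m1 u = v))"
proof -
  let ?m = "mate G"
  let ?r = "?m(?m a := ?m b, ?m b := ?m a, a := a, b := b)"
  have r1: "reconnect (side1 X) (mate G, circles G) = (?r, circles G)" using ab by (simp add: s1)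
  have ru: "?r u = m1 u" "?r v = m1 v" using legs by (auto simp: m1_def flip_def)
  obtain m c where r2: "reconnect (side2 X) (?r, circles G) = (m, c)" by force
  have rd: "?r d = m1 d" if "d \<notin> B" for d using that legs by (auto simp: m1_def flip_def)
  have vu: "m1 u = v \<Longrightarrow> m1 v = u" using fpf_invD(2)[OF m1H legsH(3)] by simp
  have m: "m d = m2 d" if d: "d \<notin> B" for d
  proof -
    have du: "d \<noteq> u" "d \<noteq> v" using d legs by auto
    show ?thesis
    proof (cases "m1 u = v")
      case True
      then have "m = ?r(u := u, v := v)" using r2 ru unfolding s2 by simp
      then have "m d = m1 d" using du rd[OF d] by (metis fun_upd_apply)
      moreover have "m2 = m1" using True vu by (auto simp: m2_def flip_def)
      ultimately show ?thesis by simp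
    next
      case False
      then have "?r u \<noteq> v" using ru by metis
      then have "m = ?r(?r u := ?r v, ?r v := ?r u, u := u, v := v)"
        using r2 unfolding s2 reconnect.simps by (metis Pair_inject)
      then have "m d = (?r(m1 u := m1 v, m1 v := m1 u)) d" using du unfolding ru by (metis fun_upd_apply)
      also have "\<dots> = (m1(m1 u := m1 v, m1 v := m1 u)) d" using rd[OF d] by (metis fun_upd_apply)
      finally show ?thesis using du by (simp add: m2_def flip_def)
    qed
  qed
  have c: "c = circles G + of_bool (m1 u = v)"
    using r2 ru unfolding s2 by (auto split: if_splits)
  have outs: "outs G \<subseteq> H" and pr: "rot G permutes H" and pm: "mate G permutes H"
    using G by (auto simp: is_fmap_def)
  have off: "m2 d = d" if "d \<notin> H" for d
  proof -
    have "d \<noteq> x" if "x \<in> H" for x using that \<open>d \<notin> H\<close> by auto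
    then show ?thesis using legsH fpf_invD(1)[OF m1H] mateD(1)[OF G] permutes_not_in[OF pm \<open>d \<notin> H\<close>]
      by (simp add: m2_def m1_def flip_def)
  qed
  have "(\<lambda>d. if d \<in> B then d else rot G d) = (\<lambda>d. if d \<in> H - B then rot G d else d)"
    using permutes_not_in[OF pr] by auto
  moreover have "(\<lambda>d. if d \<in> B then d else m d) = (\<lambda>d. if d \<in> H - B then m2 d else d)"
    using m off by auto
  moreover have "outs G - B = outs G \<inter> (H - B)" using outs by auto
  ultimately show ?thesis by (simp add: contract_def r1 r2 submap_def c)
qed

lemma outside_closed: "turn_closed G (H - B)"
  by (rule turn_closed_Diff[OF rs turn_closed_halves[OF rs] BC(1)])

lemma contract_fmap: "is_fmap (contract G X)"
  unfolding contract_submap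
  by (rule submap_fmap[OF rs outside_closed]) (use m2_outside m2H m2_out in \<open>auto simp: fpf_inv_def\<close>)

text \<open>After the first flip the body is attached to the rest by \<open>u\<close> and
  \<open>v\<close> only, so the second flip splits it off. If \<open>u\<close> and \<open>v\<close>
  are attached to each other, nothing is flipped, and the circle counted in
  \<open>contract_submap\<close> supplies the missing one.\<close>

lemma second_flip:
  assumes "A \<noteq> {}"
  shows "ncc H (gr H (insert m2 (turn G ` A))) = ncc H (gr H (insert m1 (turn G ` A))) + of_bool (m1 u \<noteq> v)"
proof (cases "m1 u = v")
  case True
  then have "m1 v = u" using fpf_invD(2)[OF m1H legsH(3)] by simp
  then have "m2 = m1" using True by (auto simp: m2_def flip_def)
  then show ?thesis using True by simp
next
  case False
  interpret flip_setting H m1 "turn G ` A" u v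
    using fin m1H turn_fpf[OF rs] assms legsH legs False by unfold_locales auto
  have in1: "m1 x \<in> B - {u, v}" if "x \<in> B - {u, v}" for x
    proof (cases "x = a \<or> x = b")
      case True
      then show ?thesis using m1_ab legs by auto
    next
      case False
      then have "x \<in> B - {a, b, u, v}" using that by auto
      then show ?thesis using m1_inner[of x] inner[of x] by auto
    qed
  have nin: "m1 x \<notin> B" if "x \<in> {u, v}" for x
  proof
    assume B: "m1 x \<in> B"
    have "m1 x \<notin> {u, v}" using that False fpf_invD[OF m1H legsH(3)] fpf_invD[OF m1H legsH(4)] by auto
    then have "m1 (m1 x) \<in> B - {u, v}" using in1 B by blast
    then show False using that fpf_invD(2)[OF m1H] legsH by auto
  qed
  have "ncc H (gr H (insert (flip u v m1) (turn G ` A))) = Suc (ncc H (gr H (insert m1 (turn G ` A))))"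
    by (rule flip_split[where S = B]) (use legs nin turn_closedD(2)[OF BC(1)] in1 in auto)
  then show ?thesis using False by (simp add: m2_def)
qed

lemma contract_total:
  assumes "A \<noteq> {}"
  shows "ccount (contract G X) A + ncc B (gr B (insert m2 (turn G ` A))) =
    Suc (ncc H (gr H (insert m1 (turn G ` A))) + circles G)"
proof -
  have "ncc H (gr H (insert m2 (turn G ` A))) = ncc B (gr B (insert m2 (turn G ` A))) +
     ncc (H - B) (gr (H - B) (insert m2 (turn G ` A)))"
    by (rule ncc_split[OF fin])
      (use m2H turn_fpf[OF rs] BC fpf_invD[OF m2B] turn_closedD(2)[OF BC(1)] in auto)
  then show ?thesis
    using second_flip[OF assms] unfolding contract_submap submap_ccount[OF outside_closed] by (cases "m1 u = v") auto
qed

text \<open>The closed ladder has one component and \<open>n + 1\<close> cycles of each kind, and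
  the second flip or the circle accounts for one of each. After the first flip, contraction
  therefore costs \<open>n\<close> cycles of each kind, \<open>2 n\<close> vertices and no
  component.\<close>

lemma chain_contract:
  assumes "chain T G ds" "X = ladder_piece ds"
  shows "ccount (contract G X) {c} + length ds = ncc H (gr H {m1, turn G c}) + circles G"
    "ccount (contract G X) UNIV = ncc H (gr H (insert m1 (range (turn G)))) + circles G"
    "num_vertices (contract G X) + 2 * length ds = num_vertices G"
proof -
  note cc = chain_closing_count[OF G assms(1) closing_m2[unfolded assms(2)]]
  show "ccount (contract G X) {c} + length ds = ncc H (gr H {m1, turn G c}) + circles G"
    using contract_total[of "{c}"] cc[of c] assms(2) by simp
  show "ccount (contract G X) UNIV = ncc H (gr H (insert m1 (range (turn G)))) + circles G"
    using contract_total[of UNIV] cc assms(2) by simp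
  have "card (H - B) = card H - card B" using BC(2) fin by (simp add: card_Diff_subset finite_subset)
  moreover have "card B \<le> card H" using BC(2) fin by (simp add: card_mono)
  moreover have "4 * num_vertices (contract G X) = card (H - B)"
    using card_halves[OF fmapD(1)[OF contract_fmap]] by (simp add: contract_submap)
  ultimately show "num_vertices (contract G X) + 2 * length ds = num_vertices G"
    using card_halves[OF rs] cc assms(2) by simp
qed

end

section \<open>Two-edge-cuts\<close>

text \<open>A two-edge-cut seen from one of its sides: \<open>p\<close> and \<open>q\<close> are the
  ends within \<open>S\<close> of the two cut edges.\<close>

definition two_cut :: "'h fmap \<Rightarrow> 'h set \<Rightarrow> 'h \<Rightarrow> 'h \<Rightarrow> bool" where
  "two_cut G S p q \<longleftrightarrow> turn_closed G S \<and> p \<in> S \<and> q \<in> S \<and> p \<noteq> q \<and> mate G p \<notin> S \<and> mate G q \<notin> S \<and>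
     (\<forall>d\<in>S - {p, q}. mate G d \<in> S)"

lemma two_cut_flip_setting:
  assumes "is_fmap G" "two_cut G S p q" "A \<noteq> {}"
  shows "flip_setting (halves G) (mate G) (turn G ` A) p q"
  using assms fmapD[OF assms(1)] turn_fpf[of G] turn_closedD(1)[of G S]
  by unfold_locales (auto simp: two_cut_def)

lemma two_cut_flip:
  assumes "is_fmap G" "two_cut G S p q" "A \<noteq> {}"
  shows "ncc (halves G) (gr (halves G) (insert (flip p q (mate G)) (turn G ` A))) =
     Suc (ncc (halves G) (gr (halves G) (insert (mate G) (turn G ` A))))"
  by (rule flip_setting.flip_split[OF two_cut_flip_setting[OF assms], where S = S])
    (use assms(2) in \<open>auto simp: two_cut_def turn_closed_def\<close>)

lemma two_cut_complement:
  assumes G: "is_fmap G" and c: "two_cut G S p q"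
  shows "two_cut G (halves G - S) (mate G p) (mate G q)"
proof -
  have S: "S \<subseteq> halves G" and p: "p \<in> halves G" "q \<in> halves G" and tc: "turn_closed G S"
    using c by (auto simp: two_cut_def turn_closed_def)
  note rs = fmapD(1)[OF G]
  have "mate G p \<noteq> mate G q" using c mateD(2)[OF G p(1)] mateD(2)[OF G p(2)] by (auto simp: two_cut_def)
  moreover have "mate G d \<in> halves G - S" if "d \<in> halves G - S - {mate G p, mate G q}" for d
  proof -
    have "mate G d \<notin> S"
    proof
      assume *: "mate G d \<in> S"
      have "mate G (mate G d) \<notin> S" using mateD(2)[OF G, of d] that by simp
      then have "mate G d = p \<or> mate G d = q" using c * by (auto simp: two_cut_def)
      then have "d = mate G p \<or> d = mate G q" using mateD(2)[OF G, of d] that by auto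
      then show False using that by auto
    qed
    then show ?thesis using mateD(1)[OF G, of d] that by auto
  qed
  moreover have "turn_closed G (halves G - S)"
    by (rule turn_closed_Diff[OF rs turn_closed_halves[OF rs] tc])
  ultimately show ?thesis
    using c mateD[OF G p(1)] mateD[OF G p(2)] by (auto simp: two_cut_def)
qed

text \<open>Within \<open>S\<close>, the turn along \<open>LS\<close> exchanges outgoing and ingoing
  half-edges, and \<open>mate\<close> does so within \<open>S - {p, q}\<close>. Comparing the two
  balances gives \<open>p\<close> and \<open>q\<close> opposite directions.\<close>

lemma two_cut_out:
  assumes G: "is_fmap G" and c: "two_cut G S p q"
  shows "p \<in> outs G \<longleftrightarrow> q \<notin> outs G"
proof -
  note rs = fmapD(1)[OF G]
  have S: "turn_closed G S" "S \<subseteq> halves G" and fS: "finite S"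
    using c fmapD(2)[OF G] by (auto simp: two_cut_def turn_closed_def intro: finite_subset)
  have t: "turn G LS x \<in> S" "turn G LS x \<in> outs G \<longleftrightarrow> x \<notin> outs G" "turn G LS (turn G LS x) = x" if "x \<in> S" for x
    using turn_closedD(2)[OF S(1) that] turn_out[OF rs, of x LS] turn_turn[OF rs, of x LS] that S(2) by auto
  have "bij_betw (turn G LS) (S \<inter> outs G) (S - outs G)"
    by (rule bij_betw_byWitness[where f' = "turn G LS"]) (use t in auto)
  then have 1: "card (S \<inter> outs G) = card (S - outs G)" by (rule bij_betw_same_card)
  have m: "mate G x \<in> S - {p, q}" "mate G x \<in> outs G \<longleftrightarrow> x \<notin> outs G" "mate G (mate G x) = x" if "x \<in> S - {p, q}" for x
  proof -
    have "x \<in> halves G" using that S by auto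
    note mx = mateD[OF G this]
    show "mate G x \<in> outs G \<longleftrightarrow> x \<notin> outs G" "mate G (mate G x) = x" using mx by auto
    have "mate G x \<noteq> p" "mate G x \<noteq> q" using c that mx by (auto simp: two_cut_def)
    then show "mate G x \<in> S - {p, q}" using c that by (auto simp: two_cut_def)
  qed
  have "bij_betw (mate G) (S \<inter> outs G - {p, q}) (S - outs G - {p, q})"
    by (rule bij_betw_byWitness[where f' = "mate G"]) (use m in auto)
  then have 2: "card (S \<inter> outs G - {p, q}) = card (S - outs G - {p, q})" by (rule bij_betw_same_card)
  have pq: "p \<in> S" "q \<in> S" "p \<noteq> q" using c by (auto simp: two_cut_def)
  show ?thesis
  proof (rule ccontr)
    assume "\<not> ?thesis"
    then consider "p \<in> outs G" "q \<in> outs G" | "p \<notin> outs G" "q \<notin> outs G" by blast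
    then show False
    proof cases
      case 1
      then have "S - outs G - {p, q} = S - outs G" by auto
      moreover have "card (S \<inter> outs G - {p, q}) < card (S \<inter> outs G)"
        using fS pq 1 by (intro psubset_card_mono) auto
      ultimately show False using \<open>card (S \<inter> outs G) = _\<close> 2 by simp
    next
      case 2
      then have "S \<inter> outs G - {p, q} = S \<inter> outs G" by auto
      moreover have "card (S - outs G - {p, q}) < card (S - outs G)"
        using fS pq 2 by (intro psubset_card_mono) auto
      ultimately show False using 1 \<open>card (S \<inter> outs G - {p, q}) = _\<close> by simp
    qed
  qed
qed

text \<open>The half-edges of deleted edges are fixed by \<open>mate\<close> and contribute only
  trivial pairs, so apart from these the relation is \<open>R0\<close>.\<close>

lemma delete_count:
  assumes G: "is_fmap G" and fs: "flip_setting (halves G) (mate G) (range (turn G)) p q"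
  shows "num_components (delete_edges G ({p, mate G p} \<union> {q, mate G q})) =
     ncc (halves G) (flip_setting.R0 (halves G) (mate G) (range (turn G)) p q) + circles G"
proof -
  define D where "D = {p, mate G p} \<union> {q, mate G q}"
  define G' where "G' = delete_edges G D"
  interpret flip_setting "halves G" "mate G" "range (turn G)" p q by (rule fs)
  have H: "halves G' = halves G" "rot G' = rot G" "outs G' = outs G" "circles G' = circles G"
    unfolding G'_def delete_edges_def by simp_all
  have t: "turn G' c d = turn G c d" for c d by (cases c) (simp_all only: turn.simps H)
  then have t': "turn G' = turn G" by (intro ext)
  have mt: "mate G' d = (if d \<in> D then d else mate G d)" for d by (simp add: G'_def delete_edges_def)
  have "rotsys G'" using fmapD(1)[OF G] unfolding rotsys_def vertex_def H .
  moreover have "mate G' d \<in> halves G' \<and> mate G' (mate G' d) = d" if "d \<in> halves G'" for d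
  proof (cases "d \<in> D")
    case False
    have d: "d \<in> halves G" using that H by simp
    have "mate G d \<notin> D" using False mateD(2)[OF G d] dist unfolding D_def by auto
    then show ?thesis using False mateD[OF G d] H by (simp add: mt)
  qed (use that H mt in simp)
  ultimately have "num_components G' = ccount G' UNIV" by (rule num_components_ncc)
  also have "\<dots> = ncc (halves G) (gr (halves G) (insert (mate G') (range (turn G)))) + circles G"
    by (simp add: ccount_def H t')
  also have "ncc (halves G) (gr (halves G) (insert (mate G') (range (turn G)))) = ncc (halves G) R0"
  proof -
    have "gr (halves G) (insert (mate G') (range (turn G))) \<subseteq> R0 \<union> Id"
      unfolding R0_def gr_def by (auto simp: mt D_def)
    then have "eqc (gr (halves G) (insert (mate G') (range (turn G)))) \<subseteq> eqc R0"
      by (intro eqc_subsetI) (auto intro: eqc_base)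
    moreover have "R0 \<subseteq> gr (halves G) (insert (mate G') (range (turn G)))"
      unfolding R0_def by (auto simp: gr_iff mt D_def)
    then have "eqc R0 \<subseteq> eqc (gr (halves G) (insert (mate G') (range (turn G))))" by (rule eqc_mono)
    ultimately show ?thesis by (simp add: ncc_def)
  qed
  finally show ?thesis unfolding G'_def D_def .
qed

text \<open>If deleting two edges raises the number of components, the class of one end
  \<open>p\<close> without them is one side of a cut. By parity exactly one end of the other edge
  lies in it, which may be either end.\<close>

lemma two_PR_iff:
  assumes G: "is_fmap G"
  shows "two_PR G \<longleftrightarrow> (\<exists>S p q. two_cut G S p q)"
proof
  assume "two_PR G"
  then obtain p q where pq: "p \<in> halves G" "q \<in> halves G" "{p, mate G p} \<noteq> {q, mate G q}"
    "num_components (delete_edges G ({p, mate G p} \<union> {q, mate G q})) > num_components G"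
    unfolding two_PR_def edges_def by blast
  have "p \<noteq> q" "mate G p \<noteq> q" using pq(3) mateD(2)[OF G pq(1)] by auto
  then have fs: "flip_setting (halves G) (mate G) (range (turn G)) p q"
    using fmapD[OF G] turn_fpf[of G] pq by unfold_locales auto
  interpret flip_setting "halves G" "mate G" "range (turn G)" p q by (rule fs)
  have "ncc (halves G) R0 > ncc (halves G) (gr (halves G) (insert (mate G) (range (turn G))))"
    using pq(4) delete_count[OF G fs] num_components_ccount[OF G] by (simp add: ccount_def)
  then have n: "(p, mate G p) \<notin> eqc R0" using before by (auto split: if_splits)
  let ?S = "eqc R0 `` {p}"
  have SH: "?S \<subseteq> halves G"
  proof
    fix x assume "x \<in> ?S"
    then have "(p, x) \<in> eqc R0" by simp
    then show "x \<in> halves G"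
      by (rule R0_closed[OF _ ab(1)]) (use turn_in[OF fmapD(1)[OF G]] mateD(1)[OF G] in auto)
  qed
  have tS: "turn G c x \<in> ?S" if "x \<in> ?S" for x c
  proof -
    have "(x, turn G c x) \<in> R0" using that SH by (auto simp: R0_def gr_def)
    then show ?thesis using that by (auto intro: eqc_trans eqc_base)
  qed
  have mS: "mate G x \<in> ?S" if "x \<in> ?S - {p, q, mate G p, mate G q}" for x
  proof -
    have "(x, mate G x) \<in> R0" using that SH by (auto simp: R0_def gr_def)
    then show ?thesis using that by (auto intro: eqc_trans eqc_base)
  qed
  have tr: "(x, y) \<in> eqc R0 \<Longrightarrow> (z, y) \<in> eqc R0 \<Longrightarrow> (x, z) \<in> eqc R0" for x y z by (meson eqc_sym eqc_trans)
  consider "(p, q) \<in> eqc R0" "(p, mate G q) \<notin> eqc R0" | "(p, mate G q) \<in> eqc R0" "(p, q) \<notin> eqc R0"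
    using pairing n tr by blast
  then show "\<exists>S p q. two_cut G S p q"
  proof cases
    case 1
    then have "two_cut G ?S p q" using SH tS mS n ab(3) by (auto simp: two_cut_def turn_closed_def)
    then show ?thesis by blast
  next
    case 2
    then have "two_cut G ?S p (mate G q)" using SH tS mS n dist(6,8) by (auto simp: two_cut_def turn_closed_def)
    then show ?thesis by blast
  qed
next
  assume "\<exists>S p q. two_cut G S p q"
  then obtain S p q where c: "two_cut G S p q" by blast
  have fs: "flip_setting (halves G) (mate G) (range (turn G)) p q"
    by (rule two_cut_flip_setting[OF G c]) simp
  interpret flip_setting "halves G" "mate G" "range (turn G)" p q by (rule fs)
  have "(p, mate G p) \<notin> eqc R0"
    using R0_closed[of p "mate G p" S] c by (auto simp: two_cut_def turn_closed_def)
  then have "num_components (delete_edges G ({p, mate G p} \<union> {q, mate G q})) > num_components G"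
    using before delete_count[OF G fs] num_components_ccount[OF G] by (simp add: ccount_def)
  moreover have "{p, mate G p} \<in> edges G" "{q, mate G q} \<in> edges G" using ab by (auto simp: edges_def)
  moreover have "{p, mate G p} \<noteq> {q, mate G q}" using ab by (auto simp: doubleton_eq_iff)
  ultimately show "two_PR G" unfolding two_PR_def
    by (intro bexI[of _ "{p, mate G p}"] bexI[of _ "{q, mate G q}"]) simp_all
qed

section \<open>Melons and dipoles\<close>

text \<open>Reversing the cyclic order while the two legs have opposite directions amounts to
  joining equal turns of the two legs.\<close>

definition melon :: "'h fmap \<Rightarrow> 'h \<Rightarrow> 'h \<Rightarrow> bool" where
  "melon G x y \<longleftrightarrow> x \<in> halves G \<and> y \<in> halves G \<and> y \<notin> vertex G x \<and> (\<forall>c. mate G (turn G c x) = turn G c y)"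

text \<open>The middle edge shows that the legs have opposite directions; then \<open>rot\<close> at
  one vertex and its inverse at the other are the same turn.\<close>

lemma melon_free_iff:
  assumes G: "is_fmap G"
  shows "melon_free G \<longleftrightarrow> \<not> (\<exists>x y. melon G x y)"
proof -
  note rs = fmapD(1)[OF G]
  have "vertex G x \<noteq> vertex G y \<and> mate G (rot G x) = (rot G ^^ 3) y \<and>
      mate G ((rot G ^^ 2) x) = (rot G ^^ 2) y \<and> mate G ((rot G ^^ 3) x) = rot G y \<longleftrightarrow> melon G x y"
    if xy: "x \<in> halves G" "y \<in> halves G" for x y
  proof -
    have all: "(\<forall>c. P c) \<longleftrightarrow> P LS \<and> P RS \<and> P NS" for P by (metis strand.exhaust)
    have "mate G (rot G (rot G x)) = rot G (rot G y) \<Longrightarrow> x \<in> outs G \<longleftrightarrow> y \<notin> outs G"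
      using mateD(4)[OF G turn_in[OF rs xy(1)], of NS] turn_out[OF rs xy(1), of NS] turn_out[OF rs xy(2), of NS]
      by (simp add: turn.simps) blast
    then show ?thesis
      using xy vertex_eq_iff[OF rs xy] unfolding melon_def all
      by (auto simp: turn.simps eval_nat_numeral)
  qed
  then show ?thesis unfolding melon_free_def by (meson melon_def)
qed

lemma melonI:
  assumes G: "is_fmap G" and "x \<in> halves G" "y \<in> halves G" "y \<notin> vertex G x"
    and "c \<noteq> c1" "c \<noteq> c2" "c1 \<noteq> c2"
    and "mate G (turn G c x) = turn G c y" "mate G (turn G c1 x) = turn G c1 y" "mate G (turn G c2 x) = turn G c2 y"
  shows "melon G x y"
proof -
  have "k = c \<or> k = c1 \<or> k = c2" for k using assms(5-7) by (cases c; cases c1; cases c2; cases k; simp)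
  then have "mate G (turn G k x) = turn G k y" for k using assms(8-10) by metis
  then show ?thesis using assms unfolding melon_def by blast
qed

text \<open>An edge joining the two legs on one side would be a third edge between the two vertices,
  and with the two dipole edges it would form a melon whose legs are those on the other
  side.\<close>

lemma rung_side1_open:
  assumes G: "is_fmap G" and mf: "melon_free G" and X: "rung G c X" and s: "side1 X = (a, b)"
  shows "mate G a \<noteq> b"
proof
  assume ab: "mate G a = b"
  obtain c1 c2 h h' where at: "rung_at G c X c1 c2 h h'" using X by (auto simp: rung_def)
  note * = rung_atD(1-6,8,10,14)[OF G at]
  note rs = fmapD(1)[OF G]
  let ?x = "turn G c2 h" and ?y = "turn G c2 h'"
  have t: "turn G c ?x = turn G c1 h" "turn G c ?y = turn G c1 h'" "turn G c1 ?x = turn G c h" "turn G c1 ?y = turn G c h'"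
    "turn G c2 ?x = h" "turn G c2 ?y = h'"
    using *(1-5) turn_third[OF rs] rs third_eq[of c c2 c1] third_eq[of c1 c2 c] by auto
  have H: "?x \<in> halves G" "?y \<in> halves G" using *(4,5) rs by simp_all
  have "?x \<in> vertex G h" "?y \<in> vertex G h'" using *(4,5) vertex_turn[OF rs] by auto
  moreover have "vertex G ?x = vertex G h" using vertex_eq_iff[OF rs *(4) H(1)] \<open>?x \<in> vertex G h\<close> by simp
  ultimately have "?y \<notin> vertex G ?x" using *(8) by auto
  then have "melon G ?x ?y"
    by (rule melonI[OF G H _ *(1-3)]) (use t ab s *(6,7,9) in auto)
  then show False using mf melon_free_iff[OF G] by blast
qed

lemma chain_sides_open:
  assumes G: "is_fmap G" and mf: "melon_free G" and ch: "chain T G ds"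
  shows "side1 (ladder_piece ds) = (a, b) \<Longrightarrow> mate G a \<noteq> b"
    "side2 (ladder_piece ds) = (u, v) \<Longrightarrow> mate G u \<noteq> v"
proof -
  have *: "mate G a \<noteq> b" if ch: "chain T G ds" and s: "side1 (ladder_piece ds) = (a, b)" for ds a b
  proof -
    have "hd ds \<in> set ds" using ch by (simp add: chain_def)
    then obtain c where "rung G c (hd ds)" using ch unfolding chain_def by blast
    then show ?thesis using rung_side1_open[OF G mf] s by (simp add: ladder_piece_def)
  qed
  show "side1 (ladder_piece ds) = (a, b) \<Longrightarrow> mate G a \<noteq> b" using * ch by blast
  assume s: "side2 (ladder_piece ds) = (u, v)"
  have "mate G v \<noteq> u"
    by (rule *[OF turn_around_chain(1)[OF G ch]]) (simp add: turn_around_chain(2)[OF G ch] s)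
  moreover have "u \<in> halves G" "v \<in> halves G"
    using chain_ported[OF G ch] by (auto simp: ported_def s legs_of_def turn_closed_def)
  ultimately show "mate G u \<noteq> v" using mateD(2)[OF G] by metis
qed

text \<open>A melon that appears in a contracted graph uses a reconnected edge; its other two edges are a
  dipole that prolongs the ladder.\<close>

lemma rung_of_edges:
  assumes G: "is_fmap G" and xy: "x \<in> halves G" "y \<in> halves G" "y \<notin> vertex G x"
    and m: "\<And>k. k \<noteq> c \<Longrightarrow> mate G (turn G k x) = turn G k y"
  obtains D where "rung G c D" "body D = vertex G x \<union> vertex G y" "legs_of (side1 D) = {turn G c x, turn G c y}"
proof -
  note rs = fmapD(1)[OF G]
  have aux: "\<exists>D. rung G c D \<and> body D = vertex G x \<union> vertex G y \<and> legs_of (side1 D) = {turn G c x, turn G c y}"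
    if xy: "x \<in> halves G" "y \<in> halves G" "y \<notin> vertex G x" "\<And>k. k \<noteq> c \<Longrightarrow> mate G (turn G k x) = turn G k y"
      and c: "c \<noteq> c1" "c \<noteq> c2" "c1 \<noteq> c2"
      and o: "c = LS \<longrightarrow> (c2 = NS \<longleftrightarrow> turn G c1 x \<in> outs G)" "c = RS \<longrightarrow> (c2 = NS \<longleftrightarrow> turn G c1 x \<notin> outs G)"
    for x y c1 c2
  proof -
    let ?h = "turn G c1 x" and ?h' = "turn G c1 y"
    let ?D = "dpiece G c2 c1 ?h"
    have h: "?h \<in> halves G" "?h' \<in> halves G" "mate G ?h = ?h'" using xy c(1) rs by auto
    have t: "turn G c ?h = turn G c2 x" "turn G c ?h' = turn G c2 y" "turn G c2 ?h = turn G c x" "turn G c2 ?h' = turn G c y"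
      using c turn_third[OF rs] xy(1,2) third_eq[of c c1 c2] third_eq[of c2 c1 c] by auto
    have v: "vertex G ?h = vertex G x" "vertex G ?h' = vertex G y"
      using vertex_eq_iff[OF rs xy(1) h(1)] vertex_eq_iff[OF rs xy(2) h(2)] vertex_turn[OF rs] xy(1,2) by auto
    have "vertex G x \<inter> vertex G y = {}" by (rule vertex_disjoint[OF rs xy(1-3)])
    then have "?h' \<notin> vertex G ?h" using v vertex_self[OF rs h(2)] by auto
    then have "rung_at G c ?D c2 c1 ?h ?h'" unfolding rung_at_def using c o h t xy by auto
    then have "rung G c ?D" by (auto simp: rung_def)
    moreover have "body ?D = vertex G x \<union> vertex G y" "legs_of (side1 ?D) = {turn G c x, turn G c y}"
      using h t v by (auto simp: dpiece_def legs_of_def)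
    ultimately show ?thesis by blast
  qed
  \<comment> \<open>For a face dipole the orientation conditions of \<open>rung_at\<close> decide
    which vertex comes first; with \<open>c2 = NS\<close>, exactly one of the two orders of
    \<open>x\<close> and \<open>y\<close> satisfies them.\<close>
  obtain c1 c2 where cc: "c \<noteq> c1" "c \<noteq> c2" "c1 \<noteq> c2" "c \<noteq> NS \<Longrightarrow> c1 \<noteq> NS \<and> c2 = NS"
    by (rule that[of "if c = LS then RS else LS" "if c = NS then RS else NS"]; cases c) simp_all
  have m': "mate G (turn G k y) = turn G k x" if "k \<noteq> c" for k
    using m[OF that] mateD(2)[OF G turn_in[OF rs xy(1)], of k] by simp
  have x': "x \<notin> vertex G y" using vertex_disjoint[OF rs xy] vertex_self[OF rs] xy by blast
  have o: "turn G c1 y \<in> outs G \<longleftrightarrow> turn G c1 x \<notin> outs G"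
    using m[of c1] cc(1) mateD(4)[OF G turn_in[OF rs xy(1)], of c1] by auto
  show ?thesis
  proof (cases "(c = LS \<longrightarrow> (c2 = NS \<longleftrightarrow> turn G c1 x \<in> outs G)) \<and> (c = RS \<longrightarrow> (c2 = NS \<longleftrightarrow> turn G c1 x \<notin> outs G))")
    case True
    then show ?thesis using aux[OF xy m cc(1-3)] that by blast
  next
    case False
    have "\<exists>D. rung G c D \<and> body D = vertex G y \<union> vertex G x \<and> legs_of (side1 D) = {turn G c y, turn G c x}"
      by (rule aux[OF xy(2,1) x' m' cc(1-3)]) (use False o cc(4) in auto)
    then obtain D where "rung G c D" "body D = vertex G y \<union> vertex G x" "legs_of (side1 D) = {turn G c y, turn G c x}" by blast
    then show ?thesis by (intro that[of D]) auto
  qed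
qed

lemma chain_extend:
  assumes G: "is_fmap G" and ch: "chain T G ds" and xy: "x \<in> halves G" "y \<in> halves G" "y \<notin> vertex G x"
    and c: "c \<in> T" and m: "\<And>k. k \<noteq> c \<Longrightarrow> mate G (turn G k x) = turn G k y"
    and d: "body (ladder_piece ds) \<inter> (vertex G x \<union> vertex G y) = {}"
    and l: "mate G ` legs_of (side2 (ladder_piece ds)) = {turn G c x, turn G c y}"
  obtains D where "chain T G (ds @ [D])" "body D = vertex G x \<union> vertex G y"
proof -
  have ne: "ds \<noteq> []" using ch by (simp add: chain_def)
  obtain D where D: "rung G c D" "body D = vertex G x \<union> vertex G y" "legs_of (side1 D) = {turn G c x, turn G c y}"
    using rung_of_edges[OF G xy m] by blast
  have "chain T G (ds @ [D])" unfolding chain_snoc[OF ne] using ch c D d l by auto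
  then show ?thesis using D(2) by (rule that)
qed

text \<open>In \<open>N_dipole\<close> the order of the sides follows from the sense of traversal.
  Starting at \<open>h\<close> or at the opposite half-edge gives the two orders, and the direction
  of \<open>h\<close> tells which of them puts the side of \<open>c1\<close> first.\<close>

lemma rung_N_dipole:
  assumes G: "is_fmap G" and X: "rung G NS X"
  shows "N_dipole G X"
proof -
  obtain c1 c2 h h' where at: "rung_at G NS X c1 c2 h h'" using X by (auto simp: rung_def)
  note * = rung_atD(1-11,14-17)[OF G at]
  note rs = fmapD(1)[OF G]
  have cc: "c1 = LS \<and> c2 = RS \<or> c1 = RS \<and> c2 = LS" using *(1-3) by (cases c1; cases c2; simp)
  have hN: "turn G NS h \<in> halves G" "turn G NS h' \<in> halves G" using *(4,5) rs by auto
  let ?S = "{h, h', turn G NS h, turn G NS h'}"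
  have cl: "od_loop G d = ?S" if "d \<in> ?S" for d
  proof -
    have dH: "d \<in> halves G" using that *(4,5) hN by auto
    have "eqc (gr (halves G) (insert (mate G) (turn G ` {NS}))) `` {d} \<subseteq> ?S"
      by (rule class_least[OF G]) (use that *(4-9) hN rs in auto)
    moreover have "?S \<subseteq> eqc (gr (halves G) (insert (mate G) (turn G ` {NS}))) `` {d}"
    proof -
      note p = class_props[OF G dH, where A = "{NS}"]
      have m: "mate G x \<in> eqc (gr (halves G) (insert (mate G) (turn G ` {NS}))) `` {d}"
        "turn G NS x \<in> eqc (gr (halves G) (insert (mate G) (turn G ` {NS}))) `` {d}"
        if "x \<in> eqc (gr (halves G) (insert (mate G) (turn G ` {NS}))) `` {d}" for x
        using p(3)[OF that] p(4)[OF that] by auto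
      from that consider "d = h" | "d = h'" | "d = turn G NS h" | "d = turn G NS h'" by auto
      then have "h \<in> eqc (gr (halves G) (insert (mate G) (turn G ` {NS}))) `` {d}"
        using p(2) m(1)[OF p(2)] m(2)[OF p(2)] m(2)[OF m(1)[OF p(2)]] *(4-9) rs by cases auto
      note h0 = this
      show ?thesis using h0 m(1)[OF h0] m(2)[OF h0] m(2)[OF m(1)[OF h0]] *(6) by auto
    qed
    ultimately show ?thesis unfolding od_loop_class[OF G dH] by auto
  qed
  have "{e \<in> edges G. e \<subseteq> ?S} = {{h, h'}, {turn G NS h, turn G NS h'}}"
  proof
    show "{e \<in> edges G. e \<subseteq> ?S} \<subseteq> {{h, h'}, {turn G NS h, turn G NS h'}}"
    proof
      fix e assume "e \<in> {e \<in> edges G. e \<subseteq> ?S}"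
      then obtain d where d: "e = {d, mate G d}" "d \<in> ?S" by (auto simp: edges_def)
      then consider "d = h" | "d = h'" | "d = turn G NS h" | "d = turn G NS h'" by auto
      then show "e \<in> {{h, h'}, {turn G NS h, turn G NS h'}}"
        using d(1) *(6-9) by cases (simp_all add: insert_commute)
    qed
    have "{h, h'} \<in> edges G" "{turn G NS h, turn G NS h'} \<in> edges G"
      using imageI[OF *(4), of "\<lambda>d. {d, mate G d}"] imageI[OF hN(1), of "\<lambda>d. {d, mate G d}"] *(6,8)
      by (simp_all add: edges_def)
    then show "{{h, h'}, {turn G NS h, turn G NS h'}} \<subseteq> {e \<in> edges G. e \<subseteq> ?S}" by auto
  qed
  moreover have "{h, h'} \<noteq> {turn G NS h, turn G NS h'}"
  proof -
    have "turn G NS h \<in> vertex G h" "h' \<in> vertex G h'"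
      using *(4,5) vertex_turn[OF rs] by auto
    then have "turn G NS h \<noteq> h'" "turn G NS h \<noteq> h" using *(4,10) rs by auto
    then show ?thesis by auto
  qed
  ultimately have len: "od_length G ?S = 2" by (simp add: od_length_def)
  have main: "N_dipole G X" if p: "p \<in> {h, turn G NS h}" and
     r: "rot G p = turn G c1 h" "rot G (mate G (turn G NS p)) = turn G c1 h'" for p
  proof -
    let ?q = "mate G (turn G NS p)"
    have q: "?q \<in> {h', turn G NS h'}" using p *(6,8) *(4) rs by auto
    have pH: "p \<in> halves G" "?q \<in> halves G" using p q *(4,5) hN by auto
    have v: "vertex G p = vertex G h" "vertex G ?q = vertex G h'"
    proof -
      have "p \<in> vertex G h" "?q \<in> vertex G h'"
        using p q unfolding vertex_turn[OF rs *(4)] vertex_turn[OF rs *(5)] by blast+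
      then show "vertex G p = vertex G h" "vertex G ?q = vertex G h'"
        using vertex_eq_iff[OF rs *(4) pH(1)] vertex_eq_iff[OF rs *(5) pH(2)] by simp_all
    qed
    have r3: "rot G (rot G (rot G p)) = turn G c2 h" "rot G (rot G (rot G ?q)) = turn G c2 h'"
    proof -
      have e: "rot G (rot G (rot G x)) = turn G NS (rot G x)" for x by (simp add: turn.simps)
      have "third NS c1 = c2" using third_eq[of NS c1 c2] *(1-3) by auto
      then show "rot G (rot G (rot G p)) = turn G c2 h" "rot G (rot G (rot G ?q)) = turn G c2 h'"
        unfolding e unfolding r using turn_third[OF rs *(4) *(1)] turn_third[OF rs *(5) *(1)] by simp_all
    qed
    have "vertex G p \<noteq> vertex G ?q" using v *(10) vertex_self[OF rs *(4)] by auto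
    moreover have "od_length G (od_loop G p) = 2" using cl[of p] p len by auto
    moreover have "X = \<lparr>body = vertex G p \<union> vertex G ?q, side1 = (rot G p, rot G ?q),
        side2 = ((rot G ^^ 3) p, (rot G ^^ 3) ?q)\<rparr>"
      using *(6,15) r r3 v by (simp add: dpiece_def eval_nat_numeral)
    ultimately show ?thesis
      using pH(1) unfolding N_dipole_def Let_def by (intro bexI[of _ p]) (simp_all add: eval_nat_numeral turn.simps)
  qed
  have o: "turn G NS h \<in> outs G \<longleftrightarrow> h \<in> outs G" "turn G NS h' \<in> outs G \<longleftrightarrow> h' \<in> outs G"
    using turn_out[OF rs *(4)] turn_out[OF rs *(5)] by auto
  have rt: "rot G x = turn G (if x \<in> outs G then LS else RS) x" for x by (simp add: turn.simps)
  have t: "turn G LS (turn G NS x) = turn G RS x" "turn G RS (turn G NS x) = turn G LS x" if "x \<in> halves G" for x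
    using turn_third[OF rs that] by auto
  show ?thesis
  proof (cases "(c1 = LS) = (h \<in> outs G)")
    case True
    show ?thesis
    proof (rule main[of h])
      show "rot G h = turn G c1 h" using True cc rt[of h] by auto
      show "rot G (mate G (turn G NS h)) = turn G c1 h'"
        unfolding *(8) rt[of "turn G NS h'"] using True cc o *(14) t[OF *(5)] by auto
    qed simp
  next
    case False
    show ?thesis
    proof (rule main[of "turn G NS h"])
      show "rot G (turn G NS h) = turn G c1 h" unfolding rt[of "turn G NS h"] using False cc o t[OF *(4)] by auto
      show "rot G (mate G (turn G NS (turn G NS h))) = turn G c1 h'"
        using False cc *(4,6,14) rt[of h'] rs by auto
    qed simp
  qed
qed

text \<open>The face walk starts at \<open>h\<close> if the first side is reached from
  \<open>h\<close> by the straight turn, and at \<open>turn G c h\<close> otherwise. The orientation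
  conditions of \<open>rung_at\<close> make the direction of this start fit the kind of the
  face.\<close>

lemma rung_face_dipole:
  assumes G: "is_fmap G" and X: "rung G c X" and c: "c \<noteq> NS"
  shows "dipole G X"
proof -
  obtain c1 c2 h h' where at: "rung_at G c X c1 c2 h h'" using X by (auto simp: rung_def)
  note * = rung_atD(1-11,14-19)[OF G at]
  note rs = fmapD(1)[OF G]
  have tH: "turn G c h \<in> halves G" "turn G c h' \<in> halves G" using *(4,5) rs by auto
  define d where "d = (if c1 = NS then h else turn G c h)"
  have dH: "d \<in> halves G" using *(4) tH by (simp add: d_def)
  have dout: "c = (if d \<in> outs G then LS else RS)"
    using *(1-3,16,17) c turn_out[OF rs *(4), of c] by (cases c; cases c1; auto simp: d_def)
  define d' where "d' = (if c1 = NS then turn G c h' else h')"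
  have md: "mate G d = (if c1 = NS then h' else turn G c h')" using *(6,8) by (simp add: d_def)
  have d': "face_step G d = d'" unfolding face_step_turn[OF G dH dout] md d'_def using *(5) rs by simp
  have d'H: "d' \<in> halves G" using *(5) tH by (simp add: d'_def)
  have do: "d' \<in> outs G \<longleftrightarrow> d \<in> outs G"
    using *(14) turn_out[OF rs *(4), of c] turn_out[OF rs *(5), of c] c by (auto simp: d_def d'_def)
  have d2: "face_step G d' = d"
    using face_step_turn[OF G d'H, of c] dout do *(4,7,9) rs by (auto simp: d_def d'_def split: if_splits)
  have v: "vertex G d = vertex G h" "vertex G d' = vertex G h'"
  proof -
    have "d \<in> vertex G h" "d' \<in> vertex G h'" using vertex_turn[OF rs] *(4,5) by (auto simp: d_def d'_def)
    then show "vertex G d = vertex G h" "vertex G d' = vertex G h'"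
      using vertex_eq_iff[OF rs *(4) dH] vertex_eq_iff[OF rs *(5) d'H] by simp_all
  qed
  have ne: "vertex G d \<noteq> vertex G d'" using v *(10) vertex_self[OF rs *(4)] by auto
  have "face G d = {d, d'}"
  proof
    show "face G d \<subseteq> {d, d'}"
    proof
      fix x assume "x \<in> face G d"
      then show "x \<in> {d, d'}" unfolding face_def by induction (use d' d2 in auto)
    qed
    have "d' \<in> face G d" unfolding face_def d'[symmetric] by (rule orbit.base)
    moreover from this have "face_step G d' \<in> face G d" unfolding face_def by (rule orbit.step)
    ultimately show "{d, d'} \<subseteq> face G d" by (simp add: d2)
  qed
  moreover have "d \<noteq> d'" using ne by auto
  ultimately have "card (face G d) = 2" by simp
  moreover have "X = \<lparr>body = vertex G d \<union> vertex G d', side1 = ((rot G ^^ 2) d, (rot G ^^ 3) d'),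
             side2 = ((rot G ^^ 3) d, (rot G ^^ 2) d')\<rparr>"
  proof -
    have r2: "(rot G ^^ 2) x = turn G NS x" for x by (simp add: eval_nat_numeral turn.simps)
    have k: "third NS c \<noteq> NS" "third NS c \<noteq> c" using c third_neq[of NS c] by auto
    have r3: "(rot G ^^ 3) x = turn G (third NS c) x" if "x \<in> {d, d'}" for x
      using that do dout by (auto simp: eval_nat_numeral turn.simps)
    have cc: "c1 = NS \<and> c2 = third NS c \<or> c2 = NS \<and> c1 = third NS c"
      using *(1-3) c by (cases c; cases c1; cases c2; simp)
    have tt: "turn G NS (turn G c x) = turn G (third NS c) x" "turn G (third NS c) (turn G c x) = turn G NS x" if "x \<in> halves G" for x
      using turn_third[OF rs that, of NS c] turn_third[OF rs that, of "third NS c" c] c k third_eq[of "third NS c" c NS] by auto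
    have "turn G NS d = turn G c1 h" "turn G (third NS c) d' = turn G c1 h'"
      "turn G (third NS c) d = turn G c2 h" "turn G NS d' = turn G c2 h'"
      using cc tt[OF *(4)] tt[OF *(5)] k by (auto simp: d_def d'_def)
    then show ?thesis using *(6,15) v r2 r3 by (simp add: dpiece_def)
  qed
  ultimately have fd: "face_dipole_at G d X"
    using ne unfolding face_dipole_at_def Let_def d' by simp
  show ?thesis
  proof (cases "d \<in> outs G")
    case True
    then show ?thesis using fd by (auto simp: dipole_def L_dipole_def)
  next
    case False
    then show ?thesis using fd dH by (auto simp: dipole_def R_dipole_def)
  qed
qed

lemma rung_dipole: "is_fmap G \<Longrightarrow> rung G c X \<Longrightarrow> dipole G X"
  using rung_N_dipole[of G X] rung_face_dipole[of G c X] unfolding dipole_def by metis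

lemma chain_ladder_of:
  assumes "\<And>c D. c \<in> T \<Longrightarrow> rung G c D \<Longrightarrow> P D" "chain T G ds"
  shows "P (ladder_piece ds) \<or> ladder_of P G (ladder_piece ds)"
proof (cases "length ds \<ge> 2")
  case True
  have "\<forall>i j. i < j \<and> j < length ds \<longrightarrow> body (ds ! i) \<inter> body (ds ! j) = {}"
    using assms(2) by (auto simp: chain_def sorted_wrt_iff_nth_less)
  moreover have "\<forall>i. Suc i < length ds \<longrightarrow> mate G ` legs_of (side2 (ds ! i)) = legs_of (side1 (ds ! Suc i))"
    using assms(2) by (auto simp: chain_def successively_conv_nth)
  moreover have "\<forall>D\<in>set ds. P D" using assms by (auto simp: chain_def)
  ultimately show ?thesis using True unfolding ladder_of_def ladder_piece_def by blast
next
  case False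
  then obtain D where "ds = [D]" using assms(2) by (cases ds) (auto simp: chain_def Suc_le_eq)
  then show ?thesis using assms by (auto simp: chain_def)
qed

section \<open>Straight loops through a ladder\<close>

definition loop_closed :: "'h fmap \<Rightarrow> 'h set \<Rightarrow> bool" where
  "loop_closed G l \<longleftrightarrow> l \<subseteq> halves G \<and> (\<forall>x\<in>l. mate G x \<in> l \<and> turn G NS x \<in> l)"

lemma od_loop_closed: "is_fmap G \<Longrightarrow> d \<in> halves G \<Longrightarrow> loop_closed G (od_loop G d) \<and> d \<in> od_loop G d"
  unfolding loop_closed_def od_loop_class
  using class_props[of G d, where A = "{NS}"] by simp

lemma od_loop_least: "is_fmap G \<Longrightarrow> loop_closed G S \<Longrightarrow> d \<in> S \<Longrightarrow> od_loop G d \<subseteq> S"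
  using class_least[of G S "{NS}" d] od_loop_class[of G d] by (auto simp: loop_closed_def)

lemma od_loop_eq: "is_fmap G \<Longrightarrow> d \<in> halves G \<Longrightarrow> x \<in> od_loop G d \<Longrightarrow> od_loop G x = od_loop G d"
proof -
  assume G: "is_fmap G" and d: "d \<in> halves G" and x: "x \<in> od_loop G d"
  have "x \<in> halves G" using od_loop_closed[OF G d] x by (auto simp: loop_closed_def)
  then show ?thesis using x unfolding od_loop_class[OF G d] od_loop_class[OF G \<open>x \<in> halves G\<close>]
    by (metis Image_singleton_iff eqc_class_eq)
qed

text \<open>As minimal non-empty closed sets, the loops of \<open>G\<close> and of its contraction
  can be compared without following walks.\<close>

lemma od_loops_iff:
  assumes G: "is_fmap G"
  shows "l \<in> od_loops G \<longleftrightarrow> l \<noteq> {} \<and> loop_closed G l \<and> (\<forall>S\<subseteq>l. S \<noteq> {} \<longrightarrow> loop_closed G S \<longrightarrow> S = l)"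
proof
  assume "l \<in> od_loops G"
  then obtain d where d: "d \<in> halves G" "l = od_loop G d" by (auto simp: od_loops_def)
  have "S = l" if S: "S \<subseteq> l" "S \<noteq> {}" "loop_closed G S" for S
  proof -
    obtain x where x: "x \<in> S" using S(2) by blast
    then have "od_loop G x = l" using od_loop_eq[OF G d(1)] S(1) d(2) by blast
    then show ?thesis using od_loop_least[OF G S(3) x] S(1) by blast
  qed
  then show "l \<noteq> {} \<and> loop_closed G l \<and> (\<forall>S\<subseteq>l. S \<noteq> {} \<longrightarrow> loop_closed G S \<longrightarrow> S = l)"
    using od_loop_closed[OF G d(1)] d(2) by blast
next
  assume l: "l \<noteq> {} \<and> loop_closed G l \<and> (\<forall>S\<subseteq>l. S \<noteq> {} \<longrightarrow> loop_closed G S \<longrightarrow> S = l)"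
  then obtain d where d: "d \<in> l" by blast
  then have dH: "d \<in> halves G" using l by (auto simp: loop_closed_def)
  have "od_loop G d \<subseteq> l" using od_loop_least[OF G _ d] l by blast
  then have "od_loop G d = l" using l od_loop_closed[OF G dH] by blast
  then show "l \<in> od_loops G" using dH by (auto simp: od_loops_def)
qed

lemma od_loops_meet: "is_fmap G \<Longrightarrow> l \<in> od_loops G \<Longrightarrow> x \<in> l \<Longrightarrow> od_loop G x = l"
  using od_loop_eq by (fastforce simp: od_loops_def)

lemma od_loops_halves: "is_fmap G \<Longrightarrow> l \<in> od_loops G \<Longrightarrow> l \<subseteq> halves G"
  by (simp add: od_loops_iff loop_closed_def)

definition core :: "'h piece \<Rightarrow> 'h set" where
  "core D = body D - legs_of (side1 D) - legs_of (side2 D)"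

lemma core_loop:
  assumes G: "is_fmap G" and X: "rung G NS D"
  shows "core D \<in> od_loops G" "core D \<noteq> {}" "core D \<subseteq> body D"
    "turn G NS ` legs_of (side1 D) = legs_of (side2 D)"
proof -
  obtain c1 c2 h h' where at: "rung_at G NS D c1 c2 h h'" using X by (auto simp: rung_def)
  note * = rung_atD(1-15,20-23)[OF G at]
  note rs = fmapD(1)[OF G]
  have core: "core D = {h, h', turn G NS h, turn G NS h'}"
    using *(1-5,16-19) unfolding core_def *(11,12,13,14,15) legs_of_def by (auto simp: rs dest: sym)
  then show "core D \<noteq> {}" "core D \<subseteq> body D" by (auto simp: core_def)
  have cl: "loop_closed G (core D)" unfolding loop_closed_def core using *(4-9) rs by auto
  have "S = core D" if S: "S \<subseteq> core D" "S \<noteq> {}" "loop_closed G S" for S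
  proof -
    have m: "mate G x \<in> S" "turn G NS x \<in> S" if "x \<in> S" for x using that S(3) by (auto simp: loop_closed_def)
    obtain x where "x \<in> S" using S(2) by blast
    moreover have "x \<in> {h, h', turn G NS h, turn G NS h'}" using \<open>x \<in> S\<close> S(1) core by blast
    ultimately have h: "h \<in> S"
      using m[of x] m[of "mate G x"] m[of "turn G NS x"] *(4-9) rs by auto
    then show ?thesis using m[OF h] m(2)[OF m(1)[OF h]] S(1) *(6) unfolding core by auto
  qed
  then show "core D \<in> od_loops G" unfolding od_loops_iff[OF G] using cl \<open>core D \<noteq> {}\<close> by blast
  have "turn G NS (turn G c1 h) = turn G c2 h" "turn G NS (turn G c1 h') = turn G c2 h'"
    using turn_third[OF rs *(4) *(1)] turn_third[OF rs *(5) *(1)] third_eq[of NS c1 c2] *(1-3) by auto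
  then show "turn G NS ` legs_of (side1 D) = legs_of (side2 D)" by (simp add: *(14,15) legs_of_def)
qed

text \<open>A straight walk that enters an N-rung through a leg crosses it to the opposite side and
  goes on into the next rung, so each leg of each rung lies on a loop through the first side of the
  ladder. The only other loops inside are the cores.\<close>

lemma chain_loops:
  assumes G: "is_fmap G" and ch: "chain {NS} G ds"
  shows "card (core ` set ds) = length ds \<and>
    (\<forall>D\<in>set ds. legs_of (side1 D) \<union> legs_of (side2 D) \<subseteq>
        {d \<in> halves G. od_loop G d \<inter> legs_of (side1 (ladder_piece ds)) \<noteq> {}}) \<and>
    (\<forall>D\<in>set ds. core D \<inter> (legs_of (side1 (ladder_piece ds)) \<union> legs_of (side2 (ladder_piece ds))) = {})"
  using ch
proof (induction rule: chain_induct)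
  case (single D c)
  then have D: "rung G NS D" by simp
  have P: "legs_of (side1 D) \<subseteq> halves G"
    using rung_ported[OF G D] by (auto simp: ported_def turn_closed_def)
  have "d \<in> halves G \<and> od_loop G d \<inter> legs_of (side1 D) \<noteq> {}" if "d \<in> legs_of (side1 D)" for d
    using that P od_loop_closed[OF G, of d] by blast
  moreover have "d \<in> halves G \<and> od_loop G d \<inter> legs_of (side1 D) \<noteq> {}" if d2: "d \<in> legs_of (side2 D)" for d
  proof -
    obtain e where e: "e \<in> legs_of (side1 D)" "d = turn G NS e"
      using d2 unfolding core_loop(4)[OF G D, symmetric] by blast
    then have eH: "e \<in> halves G" using P by blast
    then have "d \<in> od_loop G e" using od_loop_closed[OF G eH] e by (auto simp: loop_closed_def)
    have "od_loop G d = od_loop G e" by (rule od_loop_eq[OF G eH \<open>d \<in> od_loop G e\<close>])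
    moreover have "d \<in> halves G" using od_loop_closed[OF G eH] \<open>d \<in> od_loop G e\<close> by (auto simp: loop_closed_def)
    ultimately show ?thesis using e od_loop_closed[OF G eH] by blast
  qed
  ultimately show ?case by (auto simp: core_def)
next
  case (snoc ds D c)
  then have D: "rung G NS D" by simp
  have ne: "ds \<noteq> []" using snoc(1) by (simp add: chain_def)
  let ?X = "ladder_piece ds" and ?Y = "ladder_piece (ds @ [D])"
  let ?T = "{d \<in> halves G. od_loop G d \<inter> legs_of (side1 ?X) \<noteq> {}}"
  have Y: "side1 ?Y = side1 ?X" "side2 ?Y = side2 D" using ladder_piece_snoc[OF ne, of D] by auto
  have PX: "ported G ?X" by (rule chain_ported[OF G snoc(1)])
  have sub: "body E \<subseteq> body ?X" if "E \<in> set ds" for E using that by (auto simp: ladder_piece_def)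
  have cne: "core E \<noteq> {}" "core E \<subseteq> body E" if "E \<in> set ds" for E
    using that snoc(1) core_loop[OF G, of E] by (auto simp: chain_def)
  have "core D \<notin> core ` set ds"
    using cne sub core_loop(2,3)[OF G D] snoc(4) by (metis (no_types, lifting) Int_absorb disjoint_iff imageE inf.orderE inf_le2 subset_eq)
  then have 1: "card (core ` set (ds @ [D])) = length (ds @ [D])" using snoc(6) by simp
  have Tcl: "mate G d \<in> ?T" "turn G NS d \<in> ?T" if "d \<in> ?T" for d
  proof -
    have dH: "d \<in> halves G" using that by simp
    have l: "mate G d \<in> od_loop G d" "turn G NS d \<in> od_loop G d" "od_loop G d \<subseteq> halves G"
      using od_loop_closed[OF G dH] by (auto simp: loop_closed_def)
    have "od_loop G (mate G d) = od_loop G d" "od_loop G (turn G NS d) = od_loop G d"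
      using od_loop_eq[OF G dH l(1)] od_loop_eq[OF G dH l(2)] .
    moreover have "mate G d \<in> halves G" "turn G NS d \<in> halves G" using l by blast+
    ultimately show "mate G d \<in> ?T" "turn G NS d \<in> ?T" using that by simp_all
  qed
  have "last ds \<in> set ds" "side2 ?X = side2 (last ds)" using ne by (auto simp: ladder_piece_def)
  then have "legs_of (side2 ?X) \<subseteq> ?T" using snoc(6) by auto
  then have s1: "legs_of (side1 D) \<subseteq> ?T"
    unfolding snoc(5)[symmetric] by (intro image_subsetI Tcl(1)) (rule subsetD)
  then have s2: "legs_of (side2 D) \<subseteq> ?T"
    unfolding core_loop(4)[OF G D, symmetric] by (intro image_subsetI Tcl(2)) (rule subsetD)
  have 2: "\<forall>E\<in>set (ds @ [D]). legs_of (side1 E) \<union> legs_of (side2 E) \<subseteq> ?T" using snoc(6) s1 s2 by auto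
  have L: "legs_of (side2 D) \<subseteq> body D" "legs_of (side1 ?X) \<subseteq> body ?X"
    using rung_ported[OF G D] PX by (auto simp: ported_def)
  have 3: "\<forall>E\<in>set (ds @ [D]). core E \<inter> (legs_of (side1 ?X) \<union> legs_of (side2 D)) = {}"
  proof
    fix E assume "E \<in> set (ds @ [D])"
    then consider "E \<in> set ds" | "E = D" by auto
    then show "core E \<inter> (legs_of (side1 ?X) \<union> legs_of (side2 D)) = {}"
    proof cases
      case 1
      then have "core E \<inter> legs_of (side2 D) = {}" using cne(2) sub L(1) snoc(4) by blast
      then show ?thesis using snoc(6) 1 by blast
    next
      case 2
      then show ?thesis using L(2) snoc(4) by (auto simp: core_def)
    qed
  qed
  show ?case using 1 2 3 unfolding Y by blast
qed

lemma finite_od_loops: "is_fmap G \<Longrightarrow> finite (od_loops G)"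
  by (simp add: od_loops_def fmapD)

context contraction
begin

lemma outer_loops:
  assumes "l \<subseteq> H - B" "\<And>d. d \<in> l \<Longrightarrow> mate G d \<notin> B"
  shows "l \<in> od_loops (contract G X) \<longleftrightarrow> l \<in> od_loops G"
proof -
  have "loop_closed (contract G X) S \<longleftrightarrow> loop_closed G S" if "S \<subseteq> l" for S
  proof -
    have "mate (contract G X) d = mate G d" "turn (contract G X) NS d = turn G NS d" if "d \<in> S" for d
    proof -
      have d: "d \<in> H - B" "mate G d \<notin> B" using assms \<open>S \<subseteq> l\<close> that by auto
      then show "mate (contract G X) d = mate G d" "turn (contract G X) NS d = turn G NS d"
        unfolding contract_submap using m2_outer[OF d] submap_turn[OF outside_closed d(1)] by simp_all
    qed
    moreover have "S \<subseteq> halves G" "S \<subseteq> halves (contract G X)" using assms that by (auto simp: contract_submap)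
    ultimately show ?thesis by (simp add: loop_closed_def)
  qed
  then show ?thesis unfolding od_loops_iff[OF G] od_loops_iff[OF contract_fmap] by blast
qed

text \<open>The loops of \<open>G\<close> are those through a leg, which \<open>sigma\<close>
  subtracts, the \<open>n\<close> cores, and those avoiding the ladder. The last are exactly the
  loops of the contraction away from the reconnected edges.\<close>

lemma sigma_chain:
  assumes ch: "chain {NS} G ds" and Xd: "X = ladder_piece ds"
  shows "sigma G X = int (num_od_loops (contract G X)) - int (num_od_loops G) + int (length ds)"
proof -
  let ?G' = "contract G X"
  let ?L = "legs_of (side1 X) \<union> legs_of (side2 X)"
  note cl = chain_loops[OF G ch, folded Xd]
  define P1 where "P1 = {l \<in> od_loops G. l \<inter> ?L \<noteq> {}}"
  define P2 where "P2 = {l \<in> od_loops G. l \<inter> ?L = {} \<and> l \<inter> B \<noteq> {}}"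
  define P3 where "P3 = {l \<in> od_loops G. l \<inter> B = {}}"
  define Q1 where "Q1 = {l \<in> od_loops ?G'. \<exists>d\<in>l. mate G d \<in> B}"
  define Q3 where "Q3 = {l \<in> od_loops ?G'. \<forall>d\<in>l. mate G d \<notin> B}"
  have LB: "?L \<subseteq> B" using X by (auto simp: ported_def)
  have H': "halves ?G' = H - B" by (simp add: contract_submap)
  have "od_loops G = P1 \<union> P2 \<union> P3" "P1 \<inter> P2 = {}" "(P1 \<union> P2) \<inter> P3 = {}"
    using LB by (auto simp: P1_def P2_def P3_def)
  moreover have "finite P1" "finite P2" "finite P3" using finite_od_loops[OF G] by (auto simp: P1_def P2_def P3_def)
  ultimately have c1: "card (od_loops G) = card P1 + card P2 + card P3" by (simp add: card_Un_disjoint)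
  have "od_loops ?G' = Q1 \<union> Q3" "Q1 \<inter> Q3 = {}" by (auto simp: Q1_def Q3_def)
  moreover have "finite Q1" "finite Q3" using finite_od_loops[OF contract_fmap] by (auto simp: Q1_def Q3_def)
  ultimately have c2: "card (od_loops ?G') = card Q1 + card Q3" by (simp add: card_Un_disjoint)
  have "P3 = Q3"
  proof (intro set_eqI iffI)
    fix l assume l: "l \<in> P3"
    then have lG: "l \<in> od_loops G" "l \<inter> B = {}" by (auto simp: P3_def)
    then have c: "loop_closed G l" by (simp add: od_loops_iff[OF G])
    have s: "l \<subseteq> H - B" using c lG by (auto simp: loop_closed_def)
    have "mate G d \<notin> B" if "d \<in> l" for d using that c lG by (auto simp: loop_closed_def)
    then show "l \<in> Q3" using outer_loops[OF s] lG by (auto simp: Q3_def)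
  next
    fix l assume l: "l \<in> Q3"
    then have lG: "l \<in> od_loops ?G'" "\<And>d. d \<in> l \<Longrightarrow> mate G d \<notin> B" by (auto simp: Q3_def)
    have s: "l \<subseteq> H - B" using od_loops_halves[OF contract_fmap lG(1)] H' by simp
    then show "l \<in> P3" using outer_loops[OF s lG(2)] lG(1) by (auto simp: P3_def)
  qed
  have rg: "rung G NS D" if "D \<in> set ds" for D using ch that by (auto simp: chain_def)
  have Bd: "B = (\<Union>D\<in>set ds. body D)" by (simp add: Xd ladder_piece_def)
  have "P2 = core ` set ds"
  proof (intro set_eqI iffI)
    fix l assume l: "l \<in> P2"
    then have lG: "l \<in> od_loops G" "l \<inter> ?L = {}" by (auto simp: P2_def)
    obtain D d where d: "D \<in> set ds" "d \<in> body D" "d \<in> l" using l unfolding P2_def Bd by blast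
    have lp: "od_loop G d = l" by (rule od_loops_meet[OF G lG(1) d(3)])
    have "d \<notin> legs_of (side1 D) \<union> legs_of (side2 D)"
    proof
      assume "d \<in> legs_of (side1 D) \<union> legs_of (side2 D)"
      then have "od_loop G d \<inter> legs_of (side1 X) \<noteq> {}" using cl d(1) by blast
      then show False using lp lG(2) by blast
    qed
    then have "d \<in> core D" using d(2) by (simp add: core_def)
    then have "l = core D" using od_loops_meet[OF G core_loop(1)[OF G rg[OF d(1)]]] lp by simp
    then show "l \<in> core ` set ds" using d(1) by blast
  next
    fix l assume "l \<in> core ` set ds"
    then obtain D where D: "D \<in> set ds" "l = core D" by blast
    note k = core_loop[OF G rg[OF D(1)]]
    have "core D \<inter> ?L = {}" using cl D(1) by blast
    moreover have "core D \<inter> B \<noteq> {}" using k(2,3) D(1) unfolding Bd by blast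
    ultimately show "l \<in> P2" using k(1) D(2) by (auto simp: P2_def)
  qed
  then have "card P2 = length ds" using cl by simp
  moreover have "sigma G X = int (card Q1) + (int (circles ?G') - int (circles G)) - int (card P1)"
    by (simp add: sigma_def Let_def Q1_def P1_def)
  ultimately show ?thesis using c1 c2 \<open>P3 = Q3\<close> by (simp add: num_od_loops_def)
qed

end

section \<open>The first flip\<close>

text \<open>For each strand other than \<open>c\<close>, the two legs on the first side are joined
  within the rung by a segment of that strand, which the flip closes into a cycle of its own. The
  legs are also connected through the rung, so if the flip disconnects the graph, the part cut off
  lies beyond the legs.\<close>

lemma rung_first_flip:
  assumes G: "is_fmap G" and X: "rung G c X" and s: "side1 X = (a, b)" and ab: "mate G a \<noteq> b"
  shows "\<And>k. k \<noteq> c \<Longrightarrow> ncc (halves G) (gr (halves G) {flip a b (mate G), turn G k}) =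
      Suc (ncc (halves G) (gr (halves G) {mate G, turn G k}))"
    and "A \<noteq> {} \<Longrightarrow> flip_setting (halves G) (mate G) (turn G ` A) a b"
    and "ncc (halves G) (gr (halves G) (insert (flip a b (mate G)) (range (turn G)))) =
        ncc (halves G) (gr (halves G) (insert (mate G) (range (turn G)))) \<or>
      ncc (halves G) (gr (halves G) (insert (flip a b (mate G)) (range (turn G)))) =
        Suc (ncc (halves G) (gr (halves G) (insert (mate G) (range (turn G))))) \<and>
      (\<exists>S. two_cut G S (mate G a) (mate G b) \<and> S \<inter> body X = {})"
proof -
  note rs = fmapD(1)[OF G]
  obtain c1 c2 h h' where at: "rung_at G c X c1 c2 h h'" using X by (auto simp: rung_def)
  note * = rung_atD(1-14)[OF G at]
  note apart = rung_atD(20-23)[OF G at]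
  have a: "a = turn G c1 h" "b = turn G c1 h'" using s *(14) by auto
  have aH: "a \<in> halves G" "b \<in> halves G" "a \<noteq> b" using a *(4,5) rs apart by auto
  have fs: "flip_setting (halves G) (mate G) (turn G ` A) a b" if "A \<noteq> {}" for A
    using that fmapD[OF G] turn_fpf[OF rs] aH ab by unfold_locales auto
  show "A \<noteq> {} \<Longrightarrow> flip_setting (halves G) (mate G) (turn G ` A) a b" by (rule fs)
  have mab: "mate G a \<noteq> x" "mate G b \<noteq> x" if "mate G x \<notin> {a, b}" for x
    using that mateD(2)[OF G aH(1)] mateD(2)[OF G aH(2)] by auto
  have mm: "mate G b \<noteq> a" using ab mateD(2)[OF G aH(2)] by metis
  show "ncc (halves G) (gr (halves G) {flip a b (mate G), turn G k}) =
      Suc (ncc (halves G) (gr (halves G) {mate G, turn G k}))" if k: "k \<noteq> c" for k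
  proof -
    interpret flip_setting "halves G" "mate G" "turn G ` {k}" a b by (rule fs) simp
    have "k = c1 \<or> k = c2" using k *(1-3) by (cases c; cases c1; cases c2; cases k; simp)
    then show ?thesis
    proof
      assume k1: "k = c1"
      have "ncc (halves G) (gr (halves G) (insert (flip a b (mate G)) (turn G ` {k}))) =
          Suc (ncc (halves G) (gr (halves G) (insert (mate G) (turn G ` {k}))))"
      proof (rule flip_split[where S = "{a, h, h', b}"])
        show "mate G a \<notin> {a, h, h', b}" "mate G b \<notin> {a, h, h', b}"
        proof -
          have "h \<noteq> a" "h \<noteq> b" "h' \<noteq> a" "h' \<noteq> b"
            unfolding a using apart(2,3) turn_neq[OF rs *(4), of c1] turn_neq[OF rs *(5), of c1] by metis+
          then have "mate G a \<noteq> h" "mate G a \<noteq> h'" "mate G b \<noteq> h" "mate G b \<noteq> h'"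
            using mab[of h] mab[of h'] *(6,7) by auto
          then show "mate G a \<notin> {a, h, h', b}" "mate G b \<notin> {a, h, h', b}" using dist ab mm by auto
        qed
        show "f x \<in> {a, h, h', b}" if "f \<in> turn G ` {k}" "x \<in> {a, h, h', b} \<inter> halves G" for f x
          using that k1 a *(4,5) rs by auto
      qed (use *(6,7) in auto)
      then show ?thesis by simp
    next
      assume k2: "k = c2"
      have t: "turn G c2 (turn G c1 x) = turn G c x" "turn G c2 (turn G c x) = turn G c1 x" if "x \<in> halves G" for x
        using turn_third[OF rs that] *(1-3) third_eq[of c2 c1 c] third_eq[of c2 c c1] by auto
      \<comment> \<open>Along \<open>c2\<close> the legs are joined through the second dipole edge,
        because turning a leg along \<open>c2\<close> after \<open>c1\<close> amounts to turning
        \<open>h\<close> along \<open>c\<close>.\<close>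
      let ?S = "{a, turn G c h, turn G c h', b}"
      have "ncc (halves G) (gr (halves G) (insert (flip a b (mate G)) (turn G ` {k}))) =
          Suc (ncc (halves G) (gr (halves G) (insert (mate G) (turn G ` {k}))))"
      proof (rule flip_split[where S = ?S])
        show "mate G a \<notin> ?S" "mate G b \<notin> ?S"
        proof -
          have "turn G c h \<noteq> a" "turn G c h \<noteq> b" "turn G c h' \<noteq> a" "turn G c h' \<noteq> b"
            using a apart turn_eq_iff[OF rs *(4), of c c1] turn_eq_iff[OF rs *(5), of c c1] *(1) by metis+
          then have "mate G a \<noteq> turn G c h" "mate G a \<noteq> turn G c h'" "mate G b \<noteq> turn G c h" "mate G b \<noteq> turn G c h'"
            using mab[of "turn G c h"] mab[of "turn G c h'"] *(8,9) by auto
          then show "mate G a \<notin> ?S" "mate G b \<notin> ?S" using dist ab mm by auto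
        qed
        show "f x \<in> ?S" if "f \<in> turn G ` {k}" "x \<in> ?S \<inter> halves G" for f x
          using that k2 a t *(4,5) by auto
      qed (use *(8,9) in auto)
      then show ?thesis by simp
    qed
  qed
  interpret U: flip_setting "halves G" "mate G" "range (turn G)" a b by (rule fs) simp
  have "(a, b) \<in> eqc U.R0"
  proof -
    have hab: "h \<noteq> a" "h \<noteq> b" "h' \<noteq> a" "h' \<noteq> b"
      unfolding a using apart(2,3) turn_neq[OF rs *(4), of c1] turn_neq[OF rs *(5), of c1] by metis+
    then have "h \<noteq> mate G a" "h \<noteq> mate G b" using mab[of h] *(6) by auto
    then have "(h, h') \<in> U.R0" unfolding U.R0_def using *(4,6) hab by (auto simp: gr_iff)
    moreover have "(h, a) \<in> U.R0" "(h', b) \<in> U.R0" unfolding U.R0_def using *(4,5) a by (auto simp: gr_iff)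
    ultimately show ?thesis by (meson eqc_base eqc_sym eqc_trans)
  qed
  from U.flip_connected[OF this]
  show "ncc (halves G) (gr (halves G) (insert (flip a b (mate G)) (range (turn G)))) =
        ncc (halves G) (gr (halves G) (insert (mate G) (range (turn G)))) \<or>
      ncc (halves G) (gr (halves G) (insert (flip a b (mate G)) (range (turn G)))) =
        Suc (ncc (halves G) (gr (halves G) (insert (mate G) (range (turn G))))) \<and>
      (\<exists>S. two_cut G S (mate G a) (mate G b) \<and> S \<inter> body X = {})"
  proof (elim disj_forward asm_rl conj_forward)
    assume "\<exists>S\<subseteq>halves G. mate G a \<in> S \<and> mate G b \<in> S \<and> a \<notin> S \<and> b \<notin> S \<and>
       (\<forall>f\<in>range (turn G). \<forall>x\<in>S. f x \<in> S) \<and> (\<forall>x\<in>S - {mate G a, mate G b}. mate G x \<in> S)"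
    then obtain S where S: "S \<subseteq> halves G" "mate G a \<in> S" "mate G b \<in> S" "a \<notin> S" "b \<notin> S"
      "\<forall>c. \<forall>x\<in>S. turn G c x \<in> S" "\<forall>x\<in>S - {mate G a, mate G b}. mate G x \<in> S" by blast
    have tS: "turn_closed G S" using S by (auto simp: turn_closed_def)
    have "two_cut G S (mate G a) (mate G b)"
      unfolding two_cut_def using S tS U.dist by simp
    \<comment> \<open>A half-edge of the body in \<open>S\<close> would bring in its whole vertex
      and thereby \<open>a\<close> or \<open>b\<close>.\<close>
    moreover have "S \<inter> body X = {}"
    proof -
      have va: "vertex G a = vertex G h" "vertex G b = vertex G h'"
        using vertex_eq_iff[OF rs *(4) aH(1)] vertex_eq_iff[OF rs *(5) aH(2)] a *(12,13) by auto
      have "d \<notin> S" if "d \<in> vertex G e" "e \<in> halves G" "e \<notin> S" for d e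
      proof
        assume "d \<in> S"
        have dH: "d \<in> halves G" using vertex_sub[OF rs that(2)] that(1) by blast
        have "e \<in> vertex G d" using vertex_eq_iff[OF rs that(2) dH] that(1) vertex_self[OF rs that(2)] by simp
        moreover have "vertex G d \<subseteq> S" by (rule vertex_least[OF rs dH \<open>d \<in> S\<close>]) (use S(6) in blast)
        ultimately show False using that(3) by blast
      qed
      then show ?thesis using S(4,5) aH(1,2) va *(11) by blast
    qed
    ultimately show "\<exists>S. two_cut G S (mate G a) (mate G b) \<and> S \<inter> body X = {}" by blast
  qed
qed

section \<open>Genus, grade and the existence of N-dipoles\<close>

lemma genus_ccount: "is_fmap G \<Longrightarrow> 2 * genus G = 2 + real (num_vertices G) - real (ccount G {LS}) - real (ccount G {RS})"
  by (simp add: genus_def num_faces_ccount)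

lemma grade_ccount: "is_fmap G \<Longrightarrow> grade G = 4 + 2 * real (num_vertices G) - real (ccount G {LS}) - real (ccount G {RS})
    - 2 * real (ccount G {NS})"
  by (simp add: grade_def num_faces_ccount num_od_loops_ccount field_simps)

lemma feynman_iff: "feynman_graph G \<longleftrightarrow> is_fmap G \<and> ccount G UNIV = 1"
  unfolding feynman_graph_def using num_components_ccount[of G] by auto

lemma feynman_bounds:
  assumes "feynman_graph G"
  shows "0 \<le> genus G" "0 \<le> grade G" "grade G \<in> \<int>"
proof -
  have G: "is_fmap G" and c: "ccount G UNIV = 1" using assms by (auto simp: feynman_iff)
  have e: "ccount G {LS} + ccount G {RS} \<le> num_vertices G + 2" "ccount G {LS} + ccount G {NS} \<le> num_vertices G + 2"
    "ccount G {RS} + ccount G {NS} \<le> num_vertices G + 2"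
    using euler_ccount[OF G, of LS RS] euler_ccount[OF G, of LS NS] euler_ccount[OF G, of RS NS] c by auto
  show "0 \<le> genus G" using genus_ccount[OF G] e(1) by linarith
  show "0 \<le> grade G" using grade_ccount[OF G] e(2,3) by linarith
  show "grade G \<in> \<int>" unfolding grade_ccount[OF G] by (intro Ints_diff Ints_add Ints_mult) auto
qed

lemma feynman_circles: "feynman_graph G \<Longrightarrow> halves G \<noteq> {} \<Longrightarrow> circles G = 0"
  using ncc_pos[of "halves G" "gr (halves G) (insert (mate G) (range (turn G)))"] fmapD(2)[of G]
  by (auto simp: feynman_iff ccount_def)

lemma feynman_connected:
  assumes G: "feynman_graph G" and S: "turn_closed G S" "\<And>d. d \<in> S \<Longrightarrow> mate G d \<in> S" "S \<noteq> {}"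
  shows "S = halves G"
proof -
  have F: "is_fmap G" using G by (simp add: feynman_iff)
  have SH: "S \<subseteq> halves G" by (rule turn_closedD(1)[OF S(1)])
  obtain d where d: "d \<in> S" using S(3) by blast
  have "ncc (halves G) (gr (halves G) (insert (mate G) (range (turn G)))) = 1"
  proof -
    have "circles G = 0" using feynman_circles[OF G] d SH by blast
    then show ?thesis using G by (simp add: feynman_iff ccount_def)
  qed
  then have "(d, x) \<in> eqc (gr (halves G) (insert (mate G) (range (turn G))))" if "x \<in> halves G" for x
    using ncc_oneD[OF _ subsetD[OF SH d] that] by blast
  moreover have "eqc (gr (halves G) (insert (mate G) (range (turn G)))) `` {d} \<subseteq> S"
    by (rule class_least[OF F SH]) (use S turn_closedD(2)[OF S(1)] d in auto)
  ultimately show ?thesis using SH by blast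
qed

text \<open>A loop that closes after two edges without forming an N-dipole consists of two
  self-loops at one vertex. Then \<open>v = \<phi> = 1\<close>, the grade is not 0 and the genus is
  below 1, which the last assumption excludes. Otherwise each loop has at least eight half-edges, so
  \<open>2 \<phi> \<le> v\<close>.\<close>

lemma exists_N_rung:
  assumes F: "feynman_graph G" and ne: "halves G \<noteq> {}" and g: "grade G < 2 + 2 * genus G" "grade G = 0 \<or> genus G \<ge> 1"
  shows "\<exists>D. rung G NS D"
proof (rule ccontr)
  assume no: "\<not> ?thesis"
  have G: "is_fmap G" using F by (simp add: feynman_iff)
  note rs = fmapD(1)[OF G]
  have circ: "circles G = 0" by (rule feynman_circles[OF F ne])
  show False
  proof (cases "\<exists>h\<in>halves G. mate G (turn G NS h) = turn G NS (mate G h)")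
    case True
    then obtain h where h: "h \<in> halves G" "mate G (turn G NS h) = turn G NS (mate G h)" by blast
    note m = mateD[OF G h(1)]
    have "mate G h \<in> vertex G h"
    proof (rule ccontr)
      assume "mate G h \<notin> vertex G h"
      then have "rung_at G NS (dpiece G LS RS h) LS RS h (mate G h)" using h by (simp add: rung_at_def)
      then show False using no by (auto simp: rung_def)
    qed
    then obtain k where k: "mate G h = turn G k h" using m(3) vertex_turn[OF rs h(1)] by auto
    \<comment> \<open>Opposite half-edges have the same direction and cannot be joined; this
      excludes loops of a single edge.\<close>
    have kN: "k \<noteq> NS" using k m(4) turn_out[OF rs h(1), of k] by auto
    let ?S = "{h, turn G k h, turn G NS h, turn G NS (turn G k h)}"
    have tN: "turn G NS (turn G k h) = turn G (third NS k) h" using turn_third[OF rs h(1)] kN by auto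
    have kk: "c = k \<or> c = NS \<or> c = third NS k" for c using kN by (cases c; cases k; simp)
    have vS: "vertex G h = ?S" unfolding tN vertex_turn[OF rs h(1)] using kk by auto metis
    have mS: "mate G x \<in> ?S" if "x \<in> ?S" for x
      using that h(2) k m(2) mateD(2)[OF G turn_in[OF rs h(1)], of NS] by auto
    have HS: "vertex G h = halves G"
      by (rule feynman_connected[OF F turn_closed_vertex[OF rs h(1)]]) (use mS vS in auto)
    have "card (halves G) = 4" using rs h(1) HS by (metis rotsys_def)
    then have V: "num_vertices G = 1" using card_halves[OF rs] by simp
    have "ncc (halves G) (gr (halves G) (insert (mate G) (turn G ` {NS}))) = 1"
    proof (rule ncc_one[OF h(1)])
      fix y assume "y \<in> halves G"
      then have y: "y \<in> ?S" using HS vS by simp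
      note p = class_props[OF G h(1), where A = "{NS}"]
      note p4 = p(4)[OF _ singletonI]
      show "(h, y) \<in> eqc (gr (halves G) (insert (mate G) (turn G ` {NS})))"
        using y p(2) p(3)[OF p(2)] p4[OF p(2)] p4[OF p(3)[OF p(2)]] unfolding k by auto
    qed
    then have N: "ccount G {NS} = 1" using circ by (simp add: ccount_def)
    have pos: "0 < ccount G {c}" for c
      using ncc_pos[OF fmapD(2)[OF G] ne] by (simp add: ccount_def)
    have "ccount G {LS} + ccount G {RS} \<le> 3" using euler_ccount[OF G, of LS RS] V F by (simp add: feynman_iff)
    then have "grade G \<noteq> 0" using grade_ccount[OF G] V N by auto
    moreover have "genus G < 1" using genus_ccount[OF G] V pos[of LS] pos[of RS] by linarith
    ultimately show False using g(2) by auto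
  next
    case False
    then have no': "mate G (turn G NS h) \<noteq> turn G NS (mate G h)" if "h \<in> halves G" for h using that by blast
    have "8 * ncc (halves G) (gr (halves G) (insert (mate G) (turn G ` {NS}))) \<le> card (halves G)"
    proof (rule ncc_card_class[OF fmapD(2)[OF G]])
      fix h assume h: "h \<in> halves G"
      let ?K = "eqc (gr (halves G) (insert (mate G) (turn G ` {NS}))) `` {h}"
      note p = class_props[OF G h, where A = "{NS}"]
      show "?K \<subseteq> halves G" by (rule p(1))
      note p4 = p(4)[OF _ singletonI]
      let ?N = "turn G NS" and ?m = "mate G"
      let ?E = "[h, ?N h, ?m h, ?N (?m h), ?m (?N h), ?N (?m (?N h)), ?m (?N (?m h)), ?N (?m (?N (?m h)))]"
      have H: "?m h \<in> halves G" "?N h \<in> halves G" "?N (?m h) \<in> halves G" "?m (?N h) \<in> halves G"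
        "?m (?N (?m h)) \<in> halves G" using h mateD(1)[OF G] rs by auto
      \<comment> \<open>The eight half-edges met when walking from \<open>h\<close> in both senses.
        Four of them have the direction of \<open>h\<close> and four the other one, so distinctness
        only has to be checked within each group.\<close>
      define n p' q r s t w where defs: "n = ?N h" "p' = ?m h" "q = ?N p'" "r = ?m n" "s = ?N r" "t = ?m q" "w = ?N t"
      have inH: "n \<in> halves G" "p' \<in> halves G" "q \<in> halves G" "r \<in> halves G" "t \<in> halves G" using H by (auto simp: defs)
      have inv: "?N n = h" "?N q = p'" "?N s = r" "?N w = t" "?m p' = h" "?m r = n" "?m t = q"
        using inH h mateD(2)[OF G] turn_turn[OF rs] by (simp_all add: defs)
      have fp: "n \<noteq> h" "q \<noteq> p'" "s \<noteq> r" "w \<noteq> t" using inH h turn_neq[OF rs] by (simp_all add: defs)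
      have rq: "r \<noteq> q" using no'[OF h] by (simp add: defs)
      have e1: "t \<noteq> h" using inv(7) defs(2) fp(2) by metis
      have e2: "t \<noteq> n" using inv(7) defs(4) rq by metis
      have e3: "w \<noteq> h" using inv(4) defs(1) e2 by metis
      have e4: "w \<noteq> n" using inv(1,4) e1 by metis
      have e5: "r \<noteq> p'" using inv(5,6) fp(1) by metis
      have e6: "s \<noteq> p'" using inv(3) defs(3) rq by metis
      have e7: "s \<noteq> q" using inv(2,3) e5 by metis
      have o1: "?m x \<in> outs G \<longleftrightarrow> x \<notin> outs G" "?N x \<in> outs G \<longleftrightarrow> x \<in> outs G" if "x \<in> halves G" for x
        using mateD(4)[OF G that] turn_out[OF rs that, of NS] by auto
      have o: "n \<in> outs G \<longleftrightarrow> h \<in> outs G" "p' \<in> outs G \<longleftrightarrow> h \<notin> outs G" "q \<in> outs G \<longleftrightarrow> h \<notin> outs G"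
         "r \<in> outs G \<longleftrightarrow> h \<notin> outs G" "s \<in> outs G \<longleftrightarrow> h \<notin> outs G" "t \<in> outs G \<longleftrightarrow> h \<in> outs G" "w \<in> outs G \<longleftrightarrow> h \<in> outs G"
        using o1 inH h unfolding defs by simp_all
      have opp: "x \<noteq> y" if "x \<in> outs G \<longleftrightarrow> y \<notin> outs G" for x y using that by auto
      have "distinct [h, n, t, w]" "distinct [p', q, r, s]"
        using fp rq e1 e2 e3 e4 e5 e6 e7 by auto
      moreover have "set [h, n, t, w] \<inter> set [p', q, r, s] = {}"
        using o by auto
      ultimately have "distinct ([h, n, t, w] @ [p', q, r, s])" unfolding distinct_append by blast
      then have "distinct ?E" unfolding defs by auto
      then have "8 \<le> card (set ?E)" by (simp add: distinct_card)
      also have "card (set ?E) \<le> card ?K"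
      proof (rule card_mono)
        show "finite ?K" using p(1) fmapD(2)[OF G] by (rule finite_subset)
        show "set ?E \<subseteq> ?K"
          using p(2) p(3)[OF p(2)] p4[OF p(2)] p4[OF p(3)[OF p(2)]] p(3)[OF p4[OF p(2)]] p4[OF p(3)[OF p4[OF p(2)]]]
            p(3)[OF p4[OF p(3)[OF p(2)]]] p4[OF p(3)[OF p4[OF p(3)[OF p(2)]]]]
          by simp
      qed
      finally show "8 \<le> card ?K" .
    qed
    then have "2 * ccount G {NS} \<le> num_vertices G" using card_halves[OF rs] circ by (simp add: ccount_def)
    then show False using genus_ccount[OF G] grade_ccount[OF G] g(1) by linarith
  qed
qed

section \<open>Separating ladders\<close>

text \<open>The side \<open>S\<close> of a separating ladder is a union of vertices attached to the rest of the graph by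
  the two legs on the first side of the ladder only.\<close>

definition sep_chain :: "'h fmap \<Rightarrow> 'h piece list \<Rightarrow> 'h set \<Rightarrow> bool" where
  "sep_chain G ds S \<longleftrightarrow> chain UNIV G ds \<and> S \<inter> body (ladder_piece ds) = {} \<and>
     two_cut G S (mate G (fst (side1 (ladder_piece ds)))) (mate G (snd (side1 (ladder_piece ds))))"

lemma two_cut_commute: "two_cut G S p q \<longleftrightarrow> two_cut G S q p"
  by (auto simp: two_cut_def)

lemma chain_contraction:
  assumes "is_fmap G" "melon_free G" "chain T G ds" "side1 (ladder_piece ds) = (a, b)" "side2 (ladder_piece ds) = (u, v)"
  shows "contraction G (ladder_piece ds) a b u v"
  using assms chain_ported[OF assms(1,3)] chain_sides_open(1)[OF assms(1-4)] by unfold_locales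

lemma chain_length_bound:
  assumes G: "is_fmap G" and mf: "melon_free G" and ch: "chain T G ds"
  shows "length ds \<le> card (halves G)"
proof -
  obtain a b u v where s12: "side1 (ladder_piece ds) = (a, b)" "side2 (ladder_piece ds) = (u, v)" by force
  interpret contraction G "ladder_piece ds" a b u v by (rule chain_contraction[OF G mf ch s12])
  show ?thesis using chain_contract(3)[OF ch refl] card_halves[OF rs] by simp
qed

text \<open>\<open>S\<close> uses up both legs of the first side, so only the legs of the second
  side can lead elsewhere. They are not attached to each other, hence they do lead out and bound the
  remaining part.\<close>

lemma sep_chain_other_side:
  assumes G: "is_fmap G" and mf: "melon_free G" and s: "sep_chain G ds S"
  shows "sep_chain G (rev (map turn_around ds)) (halves G - S - body (ladder_piece ds))"
proof -
  let ?X = "ladder_piece ds" and ?B = "body (ladder_piece ds)"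
  obtain a b u v where s1: "side1 ?X = (a, b)" and s2: "side2 ?X = (u, v)" by force
  have ch: "chain UNIV G ds" using s by (simp add: sep_chain_def)
  interpret contraction G ?X a b u v by (rule chain_contraction[OF G mf ch s1 s2])
  have cut: "two_cut G S (mate G a) (mate G b)" and SB: "S \<inter> ?B = {}" using s by (auto simp: sep_chain_def s1)
  have uv: "mate G u \<noteq> v" by (rule chain_sides_open(2)[OF G mf ch s2])
  let ?S = "H - S - ?B"
  have tS: "turn_closed G S" using cut by (simp add: two_cut_def)
  have t: "turn_closed G ?S"
    by (intro turn_closed_Diff[OF rs] turn_closed_halves[OF rs] tS BC(1))
  have mS: "mate G d \<in> S \<Longrightarrow> d \<in> S \<or> d \<in> {a, b}" if "d \<in> H" for d
    using cut that mateD(2)[OF G that] mateD(2)[OF G legsH(1)] mateD(2)[OF G legsH(2)] unfolding two_cut_def by (metis DiffI insertCI insertE singletonD)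
  have mB: "mate G d \<in> ?B \<Longrightarrow> d \<in> ?B \<or> d \<in> {mate G a, mate G b, mate G u, mate G v}" if "d \<in> H" for d
  proof -
    assume B: "mate G d \<in> ?B"
    show ?thesis
    proof (cases "mate G d \<in> {a, b, u, v}")
      case True
      then have "mate G (mate G d) \<in> {mate G a, mate G b, mate G u, mate G v}" by auto
      then show ?thesis using mateD(2)[OF G that] by simp
    next
      case False
      then show ?thesis using inner[of "mate G d"] B mateD(2)[OF G that] by simp
    qed
  qed
  have ab_in: "mate G a \<in> S" "mate G b \<in> S" using cut by (auto simp: two_cut_def)
  have out: "mate G x \<in> ?S" if x: "x \<in> {u, v}" for x
  proof -
    have xH: "x \<in> H" "x \<in> ?B" using x legsH legs by auto
    have "mate G x \<notin> S" using mS[OF xH(1)] x xH legs SB by auto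
    moreover have "mate G x \<notin> ?B"
    proof
      assume B: "mate G x \<in> ?B"
      have "mate G x \<noteq> v" if "x = u" using uv that by simp
      moreover have "mate G x \<noteq> u" if "x = v" using uv that mateD(2)[OF G legsH(3)] mateD(2)[OF G legsH(4)] by metis
      moreover have "mate G x \<noteq> x" using mateD(3)[OF G xH(1)] .
      ultimately have "mate G x \<notin> {u, v}" using x by auto
      moreover have "mate G x \<notin> {a, b}"
      proof
        assume "mate G x \<in> {a, b}"
        then have "x \<in> {mate G a, mate G b}" using mateD(2)[OF G xH(1)] by auto
        then show False using ab_in SB xH by auto
      qed
      ultimately have "mate G (mate G x) \<in> ?B - {a, b, u, v}" using inner[of "mate G x"] B by auto
      then show False using mateD(2)[OF G xH(1)] x by auto
    qed
    ultimately show ?thesis using mateD(1)[OF G xH(1)] by simp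
  qed
  have "mate G u \<noteq> mate G v" using mateD(2)[OF G legsH(3)] mateD(2)[OF G legsH(4)] legs by metis
  moreover have "mate G (mate G u) \<notin> ?S" "mate G (mate G v) \<notin> ?S"
    using mateD(2)[OF G legsH(3)] mateD(2)[OF G legsH(4)] legs by auto
  moreover have "mate G d \<in> ?S" if d: "d \<in> ?S - {mate G v, mate G u}" for d
  proof -
    have dH: "d \<in> H" using d by auto
    have "mate G d \<notin> S" using mS[OF dH] d legs by auto
    moreover have "mate G d \<notin> ?B" using mB[OF dH] d ab_in by auto
    ultimately show ?thesis using mateD(1)[OF G dH] by simp
  qed
  ultimately have "two_cut G ?S (mate G v) (mate G u)"
    using t out[of u] out[of v] unfolding two_cut_def by auto
  then show ?thesis
    unfolding sep_chain_def turn_around_chain(2)[OF G ch]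
    using turn_around_chain(1)[OF G ch] by (auto simp: s1 s2)
qed

text \<open>\<open>G\<close> has no melon, so one in the closed-up part uses the added edge. It does
  so along one strand \<open>c\<close> only, since a single edge serves a single strand; the other
  two edges belong to \<open>G\<close>.\<close>

lemma melon_new_edge:
  assumes G: "is_fmap G" and mf: "melon_free G" and tS: "turn_closed G S"
    and m: "m p = q" "m q = p" "\<And>d. d \<in> S - {p, q} \<Longrightarrow> m d = mate G d"
    and xy: "x \<in> S" "y \<in> S" "y \<notin> vertex G x" "\<And>c. m (turn G c x) = turn G c y"
  obtains c where "{turn G c x, turn G c y} = {p, q}" "\<And>k. k \<noteq> c \<Longrightarrow> mate G (turn G k x) = turn G k y"
proof -
  note rs = fmapD(1)[OF G]
  have xyH: "x \<in> halves G" "y \<in> halves G" using xy turn_closedD(1)[OF tS] by auto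
  have vv: "vertex G x \<inter> vertex G y = {}" by (rule vertex_disjoint[OF rs xyH xy(3)])
  have inS: "turn G c x \<in> S" "turn G c y \<in> S" for c using turn_closedD(2)[OF tS] xy by auto
  have ne: "turn G c x \<noteq> turn G k y" for c k
  proof -
    have "turn G c x \<in> vertex G x" "turn G k y \<in> vertex G y" using vertex_turn[OF rs] xyH by auto
    then show ?thesis using vv by auto
  qed
  have "\<not> melon G x y" using mf melon_free_iff[OF G] by blast
  then obtain c where c: "mate G (turn G c x) \<noteq> turn G c y" using xyH xy(3) by (auto simp: melon_def)
  then have cpq: "turn G c x \<in> {p, q}" using m(3)[of "turn G c x"] xy(4)[of c] inS by auto
  then have set: "{turn G c x, turn G c y} = {p, q}" using m(1,2) xy(4)[of c] by auto
  have "mate G (turn G k x) = turn G k y" if "k \<noteq> c" for k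
  proof -
    have "turn G k x \<noteq> turn G c x" using that turn_eq_iff[OF rs xyH(1)] by simp
    then have "turn G k x \<notin> {p, q}" using ne[of k c] set by auto
    then show ?thesis using m(3)[of "turn G k x"] xy(4)[of k] inS by simp
  qed
  with set show ?thesis by (rule that)
qed

text \<open>The dipole left by the melon continues the ladder at its first side. As chains grow at
  the last rung, the ladder is turned around, and the part recorded is then the opposite one, which
  the extension leaves unchanged.\<close>

lemma sep_chain_extend:
  assumes G: "is_fmap G" and mf: "melon_free G" and s: "sep_chain G ds S"
    and p: "p = mate G (fst (side1 (ladder_piece ds)))" and q: "q = mate G (snd (side1 (ladder_piece ds)))"
    and m: "m p = q" "m q = p" "\<And>d. d \<in> S - {p, q} \<Longrightarrow> m d = mate G d"
    and xy: "x \<in> S" "y \<in> S" "y \<notin> vertex G x" "\<And>c. m (turn G c x) = turn G c y"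
  shows "\<exists>ds' S'. sep_chain G ds' S' \<and> length ds' = Suc (length ds)"
proof -
  let ?X = "ladder_piece ds"
  note rs = fmapD(1)[OF G]
  have ch: "chain UNIV G ds" and SB: "S \<inter> body ?X = {}" and cut: "two_cut G S p q"
    using s by (auto simp: sep_chain_def p q)
  have tS: "turn_closed G S" and SH: "S \<subseteq> halves G" using cut by (auto simp: two_cut_def turn_closed_def)
  have xyH: "x \<in> halves G" "y \<in> halves G" using xy SH by auto
  obtain c where set: "{turn G c x, turn G c y} = {p, q}" and real: "\<And>k. k \<noteq> c \<Longrightarrow> mate G (turn G k x) = turn G k y"
    using melon_new_edge[OF G mf tS m xy] by blast
  let ?es = "rev (map turn_around ds)" and ?T = "halves G - S - body ?X"
  have ce: "chain UNIV G ?es" and pe: "ladder_piece ?es = turn_around ?X" by (rule turn_around_chain[OF G ch])+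
  have eo: "sep_chain G ?es ?T" by (rule sep_chain_other_side[OF G mf s])
  have vS: "vertex G x \<subseteq> S" "vertex G y \<subseteq> S"
    using vertex_least[OF rs xyH(1) xy(1)] vertex_least[OF rs xyH(2) xy(2)] turn_closedD(2)[OF tS] by blast+
  have l: "mate G ` legs_of (side2 (ladder_piece ?es)) = {turn G c x, turn G c y}"
    unfolding set pe by (simp add: p q legs_of_def insert_commute)
  obtain D where D: "chain UNIV G (?es @ [D])" "body D = vertex G x \<union> vertex G y"
    by (rule chain_extend[OF G ce xyH xy(3) UNIV_I real _ l]) (use vS SB pe in auto)
  have nee: "?es \<noteq> []" using ce by (simp add: chain_def)
  have "body (ladder_piece (?es @ [D])) = body ?X \<union> (vertex G x \<union> vertex G y)"
    "side1 (ladder_piece (?es @ [D])) = side1 (ladder_piece ?es)"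
    unfolding ladder_piece_snoc[OF nee] using D(2) pe by auto
  then have "sep_chain G (?es @ [D]) ?T"
    using eo D(1) vS unfolding sep_chain_def by auto
  then show ?thesis by (intro exI[of _ "?es @ [D]"] exI[of _ ?T]) simp
qed

lemma submap_melon:
  assumes G: "is_fmap G" and S: "turn_closed G S" and F: "is_fmap (submap G S m k)"
    and no: "\<And>x y. x \<in> S \<Longrightarrow> y \<in> S \<Longrightarrow> y \<notin> vertex G x \<Longrightarrow> (\<And>c. m (turn G c x) = turn G c y) \<Longrightarrow> False"
  shows "melon_free (submap G S m k)"
proof -
  have False if "melon (submap G S m k) x y" for x y
  proof -
    have xy: "x \<in> S" "y \<in> S" using that by (auto simp: melon_def)
    show False
    proof (rule no[OF xy])
      show "y \<notin> vertex G x" using that submap_vertex[OF fmapD(1)[OF G] S xy(1)] by (simp add: melon_def)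
      show "m (turn G c x) = turn G c y" for c
      proof -
        have "mate (submap G S m k) (turn (submap G S m k) c x) = turn (submap G S m k) c y"
          using that by (simp add: melon_def)
        then show ?thesis using submap_turn[OF S] xy turn_closedD(2)[OF S xy(1), of c] by simp
      qed
    qed
  qed
  then show ?thesis using melon_free_iff[OF F] by blast
qed

text \<open>The bounds on the number of half-edges serve the induction in
  \<open>grade_zero_genus\<close>.\<close>

definition melon_free_split :: "'h fmap \<Rightarrow> 'h fmap \<Rightarrow> 'h fmap \<Rightarrow> bool" where
  "melon_free_split G G1 G2 \<longleftrightarrow> obtained_between G G1 G2 \<and>
     feynman_graph G1 \<and> feynman_graph G2 \<and> melon_free G1 \<and> melon_free G2 \<and> halves G1 \<noteq> {} \<and> halves G2 \<noteq> {} \<and>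
     card (halves G1) < card (halves G) \<and> card (halves G2) < card (halves G) \<and>
     genus G1 + genus G2 = genus G \<and> grade G1 + grade G2 = grade G"

text \<open>The first flip is made at a two-edge-cut, so it adds one to every count, and the closed
  ladder can then be removed. A melon on either side would give a longer ladder, which maximality
  forbids.\<close>

lemma sep_chain_split:
  assumes F: "feynman_graph G" and mf: "melon_free G" and s: "sep_chain G ds S"
    and mx: "\<And>ds' S'. sep_chain G ds' S' \<Longrightarrow> length ds' \<le> length ds"
  shows "\<exists>G1 G2. melon_free_split G G1 G2"
proof -
  have G: "is_fmap G" using F by (simp add: feynman_iff)
  let ?X = "ladder_piece ds"
  obtain a b u v where s1: "side1 ?X = (a, b)" and s2: "side2 ?X = (u, v)" by force
  have ch: "chain UNIV G ds" using s by (simp add: sep_chain_def)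
  interpret contraction G ?X a b u v by (rule chain_contraction[OF G mf ch s1 s2])
  have cut: "two_cut G S (mate G a) (mate G b)" and SB: "S \<inter> B = {}" using s by (auto simp: sep_chain_def s1)
  let ?T = "H - S - B"
  have so: "sep_chain G (rev (map turn_around ds)) ?T" by (rule sep_chain_other_side[OF G mf s])
  have cutT: "two_cut G ?T (mate G v) (mate G u)"
    using so unfolding sep_chain_def turn_around_chain(2)[OF G ch] by (simp add: s2)
  have tS: "turn_closed G S" "turn_closed G ?T" using cut cutT by (auto simp: two_cut_def)
  have SH: "S \<subseteq> H" using tS by (auto simp: turn_closed_def)
  have HB: "H - B = S \<union> ?T" using SH SB by auto
  have inS: "mate G a \<in> S" "mate G b \<in> S" "mate G u \<in> ?T" "mate G v \<in> ?T" using cut cutT by (auto simp: two_cut_def)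
  have inv: "mate G (mate G a) = a" "mate G (mate G b) = b" "mate G (mate G u) = u" "mate G (mate G v) = v"
    using mateD(2)[OF G] legsH by auto
  have m1u: "m1 u = mate G u" "m1 v = mate G v"
  proof -
    have "u \<noteq> mate G a" "u \<noteq> mate G b" "v \<noteq> mate G a" "v \<noteq> mate G b" using inS legs SB by auto
    then show "m1 u = mate G u" "m1 v = mate G v" using legs by (simp_all add: m1_def flip_def)
  qed
  have nuv: "m1 u \<noteq> v" unfolding m1u using inS legs by auto
  have circ: "circles G = 0" using feynman_circles[OF F] legsH by blast
  have mS: "m2 (mate G a) = mate G b" "m2 (mate G b) = mate G a"
  proof -
    have "m1 (mate G a) = mate G b" "m1 (mate G b) = mate G a"
      using inS legs SB by (auto simp: m1_def flip_def)
    moreover have "mate G a \<notin> {u, v}" "mate G b \<notin> {u, v}" using inS legs SB by auto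
    moreover have "mate G a \<in> H" "mate G b \<in> H" using inS SH by auto
    ultimately show "m2 (mate G a) = mate G b" "m2 (mate G b) = mate G a"
      using m2_eq_m1[of "mate G a"] m2_eq_m1[of "mate G b"] by simp_all
  qed
  have mT: "m2 (mate G u) = mate G v" "m2 (mate G v) = mate G u"
    unfolding m2_def flip_def m1u using inS legs by (auto simp: inv)
  have mSr: "m2 d = mate G d" if d: "d \<in> S - {mate G a, mate G b}" for d
  proof (rule m2_outer)
    show "d \<in> H - B" using d SH SB by auto
    have "mate G d \<in> S" using d cut by (auto simp: two_cut_def)
    then show "mate G d \<notin> B" using SB by auto
  qed
  have mTr: "m2 d = mate G d" if d: "d \<in> ?T - {mate G v, mate G u}" for d
  proof (rule m2_outer)
    show "d \<in> H - B" using d by auto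
    have "mate G d \<in> ?T" using d cutT by (auto simp: two_cut_def)
    then show "mate G d \<notin> B" by auto
  qed
  have fS: "fpf_inv S m2"
  proof -
    have "m2 d \<in> S" if "d \<in> S" for d
    proof (cases "d \<in> {mate G a, mate G b}")
      case False
      then have "mate G d \<in> S" using that cut by (auto simp: two_cut_def)
      then show ?thesis using mSr[of d] False that by simp
    qed (use mS inS in auto)
    then show ?thesis using fpf_invD[OF m2H] SH by (auto simp: fpf_inv_def)
  qed
  have fT: "fpf_inv ?T m2"
  proof -
    have "m2 d \<in> ?T" if "d \<in> ?T" for d
      using that m2_outside[of d] fpf_invD[OF m2H, of d] fpf_invD(1)[OF fS, of "m2 d"] by auto
    then show ?thesis using fpf_invD[OF m2H] by (auto simp: fpf_inv_def)
  qed
  define G1 where "G1 = submap G S m2 0"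
  define G2 where "G2 = submap G ?T m2 0"
  have F1: "is_fmap G1" unfolding G1_def by (rule submap_fmap[OF rs tS(1) fS]) (use m2_out SH in auto)
  have F2: "is_fmap G2" unfolding G2_def by (rule submap_fmap[OF rs tS(2) fT]) (use m2_out in auto)
  have un: "contract G ?X = disjoint_union G1 G2"
    unfolding contract_submap G1_def G2_def submap_def disjoint_union_def
    using nuv circ HB by (auto simp: fun_eq_iff)
  have sum: "ccount G1 A + ccount G2 A = ccount (contract G ?X) A" for A
  proof -
    have "ncc (H - B) (gr (H - B) (insert m2 (turn G ` A))) =
       ncc S (gr S (insert m2 (turn G ` A))) + ncc (H - B - S) (gr (H - B - S) (insert m2 (turn G ` A)))"
    proof (rule ncc_split)
      show "finite (H - B)" using fin by simp
      show "fpf_inv (H - B) f" if "f \<in> insert m2 (turn G ` A)" for f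
        using that m2_outside fpf_invD[OF m2H] turn_closedD(2)[OF outside_closed] rs
        by (auto simp: fpf_inv_def)
    qed (use SH SB fpf_invD[OF fS] turn_closedD(2)[OF tS(1)] in auto)
    moreover have "H - B - S = ?T" by auto
    ultimately show ?thesis
      using nuv circ unfolding G1_def G2_def contract_submap submap_ccount[OF tS(1)] submap_ccount[OF tS(2)]
        submap_ccount[OF outside_closed] by simp
  qed
  have flip: "ncc H (gr H (insert m1 (turn G ` A))) = Suc (ncc H (gr H (insert (mate G) (turn G ` A))))" if "A \<noteq> {}" for A
  proof -
    have "flip (mate G a) (mate G b) (mate G) = m1" unfolding m1_def by (rule flip_mates[OF mH legsH(1,2) legs(5)])
    then show ?thesis using two_cut_flip[OF G cut that] by simp
  qed
  note cc = chain_contract[OF ch refl]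
  \<comment> \<open>The one extra cycle of each kind compensates for the additive constant occurring
    twice in the sum: 2 for \<open>2 g\<close>, and 4 for the grade, where O(D)-loops have weight
    two. The \<open>n\<close> rungs cancel against the \<open>2 n\<close> vertices.\<close>
  have e: "ccount G1 {c} + ccount G2 {c} + length ds = Suc (ccount G {c})" for c
    using sum[of "{c}"] cc(1)[of c] flip[of "{c}"] by (simp add: ccount_def)
  have C2: "ccount G1 UNIV + ccount G2 UNIV = 2"
    using sum[of UNIV] cc(2) flip[of UNIV] F circ by (simp add: ccount_def feynman_iff)
  have H12: "halves G1 = S" "halves G2 = ?T" by (simp_all add: G1_def G2_def)
  have pos: "0 < ccount G1 UNIV" "0 < ccount G2 UNIV"
    using ncc_pos[of S] ncc_pos[of ?T] fin SH inS finite_subset[OF SH] by (auto simp: ccount_def H12 card_gt_0_iff)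
  have Fe: "feynman_graph G1" "feynman_graph G2" using F1 F2 C2 pos by (auto simp: feynman_iff)
  have V: "num_vertices G1 + num_vertices G2 + 2 * length ds = num_vertices G"
  proof -
    have "card (H - B) = card S + card ?T"
      unfolding HB by (rule card_Un_disjoint) (use fin finite_subset[OF SH] in auto)
    then have "num_vertices G1 + num_vertices G2 = num_vertices (contract G ?X)"
      using card_halves[OF fmapD(1)[OF F1]] card_halves[OF fmapD(1)[OF F2]] card_halves[OF fmapD(1)[OF contract_fmap]] H12
      by (simp add: contract_submap)
    then show ?thesis using cc(3) by simp
  qed
  have gs: "genus G1 + genus G2 = genus G" "grade G1 + grade G2 = grade G"
    using genus_ccount[OF F1] genus_ccount[OF F2] genus_ccount[OF G] grade_ccount[OF F1] grade_ccount[OF F2] grade_ccount[OF G]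
      V e[of LS] e[of RS] e[of NS] by linarith+
  have mf1: "melon_free G1" unfolding G1_def
  proof (rule submap_melon[OF G tS(1) F1[unfolded G1_def]])
    fix x y assume "x \<in> S" "y \<in> S" "y \<notin> vertex G x" "\<And>c. m2 (turn G c x) = turn G c y"
    then have "\<exists>ds' S'. sep_chain G ds' S' \<and> length ds' = Suc (length ds)"
      by (intro sep_chain_extend[OF G mf s, of "mate G a" "mate G b" m2 x y]) (use mS mSr s1 in auto)
    then show False using mx by fastforce
  qed
  have mf2: "melon_free G2" unfolding G2_def
  proof (rule submap_melon[OF G tS(2) F2[unfolded G2_def]])
    fix x y assume "x \<in> ?T" "y \<in> ?T" "y \<notin> vertex G x" "\<And>c. m2 (turn G c x) = turn G c y"
    then have "\<exists>ds' S'. sep_chain G ds' S' \<and> length ds' = Suc (length (rev (map turn_around ds)))"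
      by (intro sep_chain_extend[OF G mf so, of "mate G v" "mate G u" m2 x y])
        (use mT mTr s2 turn_around_chain(2)[OF G ch] in auto)
    then show False using mx by fastforce
  qed
  have lad: "dipole G ?X \<or> ladder G ?X"
    unfolding ladder_def by (rule chain_ladder_of[of UNIV G "dipole G"]) (use ch rung_dipole[OF G] in auto)
  have "separating G ?X"
    unfolding separating_def num_components_ccount[OF contract_fmap] num_components_ccount[OF G]
    using C2 sum[of UNIV] F by (simp add: feynman_iff)
  then have "inserted_between G ?X G1 G2" unfolding inserted_between_def using un H12 by auto
  then have "obtained_between G G1 G2" using lad unfolding obtained_between_def by blast
  moreover have "card S < card H" "card ?T < card H"
  proof -
    have "S \<subset> H" "?T \<subset> H" using SH SB legs legsH by blast+
    then show "card S < card H" "card ?T < card H" using fin by (simp_all add: psubset_card_mono)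
  qed
  moreover have "S \<noteq> {}" "?T \<noteq> {}" using inS by blast+
  ultimately have "melon_free_split G G1 G2" unfolding melon_free_split_def H12 using Fe mf1 mf2 gs by blast
  then show ?thesis by blast
qed

lemma separating_decomposition:
  assumes F: "feynman_graph G" and mf: "melon_free G" and s: "sep_chain G ds S"
  shows "\<exists>G1 G2. melon_free_split G G1 G2"
proof -
  have G: "is_fmap G" using F by (simp add: feynman_iff)
  have bound: "length es \<le> card (halves G)" if "sep_chain G es T" for es T
    by (rule chain_length_bound[OF G mf, of UNIV]) (use that in \<open>simp add: sep_chain_def\<close>)
  let ?P = "\<lambda>n. \<exists>es T. sep_chain G es T \<and> length es = n"
  have "?P (length ds)" using s by blast
  moreover have "\<forall>n. ?P n \<longrightarrow> n \<le> card (halves G)" using bound by blast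
  ultimately have ex: "?P (GREATEST n. ?P n)" and le: "\<And>n. ?P n \<Longrightarrow> n \<le> (GREATEST n. ?P n)"
    using GreatestI_nat[of ?P] Greatest_le_nat[of ?P] by blast+
  from ex obtain es T where es: "sep_chain G es T" "length es = (GREATEST n. ?P n)" by blast
  show ?thesis by (rule sep_chain_split[OF F mf es(1)]) (use le es(2) in auto)
qed

section \<open>Melon-free graphs of grade zero\<close>

text \<open>\<open>\<delta>\<close> is the change of the number of O(D)-loops under the first flip.
  Contraction changes the L-faces and the R-faces by \<open>1 - n\<close> each, the O(D)-loops by
  \<open>\<delta> - n\<close> and the vertices by \<open>- 2 n\<close>; in genus and grade
  \<open>n\<close> cancels, and comparison with \<open>sigma_chain\<close> identifies
  \<open>\<delta>\<close> with \<open>sigma\<close>.\<close>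

lemma N_chain_contract:
  assumes F: "feynman_graph G" and mf: "melon_free G" and ch: "chain {NS} G ds"
    and s1: "side1 (ladder_piece ds) = (a, b)" and C: "ncc (halves G) (gr (halves G) (insert (flip a b (mate G)) (range (turn G)))) =
      ncc (halves G) (gr (halves G) (insert (mate G) (range (turn G))))"
  defines "\<delta> \<equiv> real (ncc (halves G) (gr (halves G) {flip a b (mate G), turn G NS})) - real (ncc (halves G) (gr (halves G) {mate G, turn G NS}))"
  shows "feynman_graph (contract G (ladder_piece ds))"
    "genus (contract G (ladder_piece ds)) = genus G - 1"
    "grade (contract G (ladder_piece ds)) = grade G - 2 - 2 * \<delta>"
    "real_of_int (sigma G (ladder_piece ds)) = \<delta>" "\<not> separating G (ladder_piece ds)" "-1 \<le> \<delta>"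
proof -
  have G: "is_fmap G" using F by (simp add: feynman_iff)
  let ?X = "ladder_piece ds" and ?G' = "contract G (ladder_piece ds)"
  obtain u v where s2: "side2 ?X = (u, v)" by force
  interpret contraction G ?X a b u v by (rule chain_contraction[OF G mf ch s1 s2])
  note cc = chain_contract[OF ch refl]
  have hd: "rung G NS (hd ds)" "side1 (hd ds) = (a, b)" using ch s1 by (auto simp: chain_def ladder_piece_def)
  note ff = rung_first_flip[OF G hd ab]
  have circ: "circles G = 0" using feynman_circles[OF F] legsH by blast
  have C': "ccount ?G' UNIV = 1" using cc(2) C F by (simp add: m1_def ccount_def feynman_iff)
  then show "feynman_graph ?G'" using contract_fmap by (simp add: feynman_iff)
  have e: "ccount ?G' {c} + length ds = Suc (ccount G {c})" if "c \<noteq> NS" for c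
    using cc(1)[of c] ff(1)[OF that] by (simp add: m1_def ccount_def)
  have eLR: "ccount ?G' {LS} + length ds = Suc (ccount G {LS})" "ccount ?G' {RS} + length ds = Suc (ccount G {RS})"
    by (rule e; simp)+
  have eN: "real (ccount ?G' {NS}) + real (length ds) = real (ccount G {NS}) + \<delta>"
    using arg_cong[OF cc(1)[of NS], of real] by (simp add: m1_def ccount_def \<delta>_def)
  show "genus ?G' = genus G - 1"
    using genus_ccount[OF G] genus_ccount[OF contract_fmap] eLR cc(3) by linarith
  show "grade ?G' = grade G - 2 - 2 * \<delta>"
    using grade_ccount[OF G] grade_ccount[OF contract_fmap] eLR eN cc(3) by linarith
  show "real_of_int (sigma G ?X) = \<delta>"
    using sigma_chain[OF ch refl] eN num_od_loops_ccount[OF G] num_od_loops_ccount[OF contract_fmap] by simp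
  show "\<not> separating G ?X"
    unfolding separating_def num_components_ccount[OF contract_fmap] num_components_ccount[OF G]
    using C' F by (simp add: feynman_iff)
  have "flip_setting H (mate G) (turn G ` {NS}) a b" using ff(2)[of "{NS}"] by simp
  from flip_setting.flip_bounds(1)[OF this] show "-1 \<le> \<delta>" by (simp add: \<delta>_def)
qed

text \<open>A connected contraction has genus one less, which is still non-negative. In the
  separating case the grades of the pieces are non-negative with sum 0, hence both 0, and a single
  piece already supplies the genus.\<close>

lemma grade_zero_genus:
  assumes "feynman_graph G" "melon_free G" "halves G \<noteq> {}" "grade G = 0"
  shows "1 \<le> genus G"
  using assms
proof (induction "card (halves G)" arbitrary: G rule: less_induct)
  case less
  have G: "is_fmap G" using less.prems by (simp add: feynman_iff)
  have "\<exists>D. rung G NS D"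
    by (rule exists_N_rung) (use less.prems feynman_bounds[OF less.prems(1)] in auto)
  then obtain D where D: "rung G NS D" by blast
  obtain a b where s1: "side1 D = (a, b)" by force
  have ab: "mate G a \<noteq> b" by (rule rung_side1_open[OF G less.prems(2) D s1])
  have ch: "chain {NS} G [D]" "chain UNIV G [D]" by (rule chain_single[OF D]; simp)+
  from rung_first_flip(3)[OF G D s1 ab] show ?case
  proof (elim disjE conjE exE)
    assume "ncc (halves G) (gr (halves G) (insert (flip a b (mate G)) (range (turn G)))) =
      ncc (halves G) (gr (halves G) (insert (mate G) (range (turn G))))"
    note c = N_chain_contract[OF less.prems(1,2) ch(1) _ this, unfolded ladder_piece_single, OF s1]
    show ?thesis using c(2) feynman_bounds(1)[OF c(1)] by simp
  next
    fix S assume S: "two_cut G S (mate G a) (mate G b)" "S \<inter> body D = {}"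
    then have "sep_chain G [D] S" using ch(2) by (simp add: sep_chain_def s1)
    from separating_decomposition[OF less.prems(1,2) this] obtain G1 G2 where sp: "melon_free_split G G1 G2" by blast
    have *: "feynman_graph G1" "feynman_graph G2" "melon_free G1" "melon_free G2" "halves G1 \<noteq> {}" "halves G2 \<noteq> {}"
       "card (halves G1) < card (halves G)" "card (halves G2) < card (halves G)"
       "genus G1 + genus G2 = genus G" "grade G1 + grade G2 = grade G"
      using sp by (auto simp: melon_free_split_def)
    have "grade G1 = 0" using feynman_bounds(2)[OF *(1)] feynman_bounds(2)[OF *(2)] *(10) less.prems(4) by linarith
    then have "1 \<le> genus G1" using less.hyps[OF *(7) *(1,3,5)] by simp
    then show ?thesis using *(9) feynman_bounds(1)[OF *(2)] by linarith
  qed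
qed

section \<open>Graphs with a two-edge-cut\<close>

text \<open>The union consults its first argument first; since both maps are the identity off their
  half-edges, the order leaves no trace.\<close>

lemma disjoint_union_commute:
  assumes "is_fmap G1" "is_fmap G2" "halves G1 \<inter> halves G2 = {}"
  shows "disjoint_union G1 G2 = disjoint_union G2 G1"
proof -
  have "rot G d = d" "mate G d = d" if "is_fmap G" "d \<notin> halves G" for G :: "'a fmap" and d
    using that permutes_not_in[of "rot G"] permutes_not_in[of "mate G"] by (auto simp: is_fmap_def)
  then show ?thesis using assms unfolding disjoint_union_def by (auto simp: fun_eq_iff)
qed

lemma obtained_between_commute:
  assumes "is_fmap G1" "is_fmap G2" "obtained_between G G1 G2"
  shows "obtained_between G G2 G1"
  using assms(3) unfolding obtained_between_def
proof (elim disj_forward)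
  assume "\<exists>X. (dipole G X \<or> ladder G X) \<and> inserted_between G X G1 G2"
  then show "\<exists>X. (dipole G X \<or> ladder G X) \<and> inserted_between G X G2 G1"
    using disjoint_union_commute[OF assms(1,2)] unfolding inserted_between_def by (metis Int_commute)
next
  assume "two_edge_connection G G1 G2"
  then obtain d1 d2 where d: "halves G1 \<inter> halves G2 = {}" "d1 \<in> outs G1" "d2 \<in> outs G2" and
    e: "G = (disjoint_union G1 G2)\<lparr>mate := (mate (disjoint_union G1 G2))(d1 := mate G2 d2, mate G2 d2 := d1,
                                d2 := mate G1 d1, mate G1 d1 := d2)\<rparr>"
    unfolding two_edge_connection_def Let_def by blast
  have h: "d1 \<in> halves G1" "d2 \<in> halves G2" using d assms by (auto simp: is_fmap_def)
  have "distinct [d1, mate G1 d1, d2, mate G2 d2]"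
    using d(1) mateD[OF assms(1) h(1)] mateD[OF assms(2) h(2)] h by auto
  then have "f(d1 := mate G2 d2, mate G2 d2 := d1, d2 := mate G1 d1, mate G1 d1 := d2) =
     f(d2 := mate G1 d1, mate G1 d1 := d2, d1 := mate G2 d2, mate G2 d2 := d1)" for f
    by (auto simp: fun_eq_iff)
  then show "two_edge_connection G G2 G1"
    unfolding two_edge_connection_def Let_def using d e disjoint_union_commute[OF assms(1,2) d(1)]
    by (intro conjI bexI[of _ d2] bexI[of _ d1]) (auto simp: Int_commute)
qed

lemma melon_free_split_commute: "melon_free_split G G1 G2 \<Longrightarrow> melon_free_split G G2 G1"
  unfolding melon_free_split_def using obtained_between_commute[of G1 G2 G] by (auto simp: feynman_iff)

text \<open>The two edges of the melon that belong to \<open>G\<close> form a dipole, and the legs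
  on its first side are the ends of the cut edges. Beyond them lies the complement of
  \<open>S\<close>, so this dipole separates.\<close>

lemma two_cut_melon:
  assumes G: "is_fmap G" and mf: "melon_free G" and cut: "two_cut G S p q"
    and m: "m p = q" "m q = p" "\<And>d. d \<in> S - {p, q} \<Longrightarrow> m d = mate G d"
    and xy: "x \<in> S" "y \<in> S" "y \<notin> vertex G x" "\<And>c. m (turn G c x) = turn G c y"
  shows "\<exists>ds S'. sep_chain G ds S'"
proof -
  note rs = fmapD(1)[OF G]
  have tS: "turn_closed G S" using cut by (simp add: two_cut_def)
  have xyH: "x \<in> halves G" "y \<in> halves G" using xy turn_closedD(1)[OF tS] by auto
  obtain c where set: "{turn G c x, turn G c y} = {p, q}" and real: "\<And>k. k \<noteq> c \<Longrightarrow> mate G (turn G k x) = turn G k y"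
    using melon_new_edge[OF G mf tS m xy] by blast
  obtain D where D: "rung G c D" "body D = vertex G x \<union> vertex G y" "legs_of (side1 D) = {turn G c x, turn G c y}"
    by (rule rung_of_edges[OF G xyH xy(3) real])
  have "vertex G x \<subseteq> S" "vertex G y \<subseteq> S"
    using vertex_least[OF rs xyH(1) xy(1)] vertex_least[OF rs xyH(2) xy(2)] turn_closedD(2)[OF tS] by blast+
  moreover have "fst (side1 D) = p \<and> snd (side1 D) = q \<or> fst (side1 D) = q \<and> snd (side1 D) = p"
    using D(3) set by (auto simp: legs_of_def doubleton_eq_iff)
  then have "two_cut G (halves G - S) (mate G (fst (side1 D))) (mate G (snd (side1 D)))"
    using two_cut_complement[OF G cut] two_cut_commute by metis
  ultimately have "sep_chain G [D] (halves G - S)"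
    using D(2) chain_single[OF D(1), of UNIV] by (auto simp: sep_chain_def)
  then show ?thesis by blast
qed

lemma two_PR_decomposition:
  assumes F: "feynman_graph G" and mf: "melon_free G" and PR: "two_PR G"
  shows "\<exists>G1 G2. melon_free_split G G1 G2"
proof (cases "\<exists>ds S. sep_chain G ds S")
  case True
  then show ?thesis using separating_decomposition[OF F mf] by blast
next
  case False
  have G: "is_fmap G" using F by (simp add: feynman_iff)
  note rs = fmapD(1)[OF G]
  let ?H = "halves G"
  obtain S p q where cut0: "two_cut G S p q" using PR two_PR_iff[OF G] by blast
  \<comment> \<open>The ends of the cut edges in \<open>S\<close> have opposite directions. The
    outgoing one is named \<open>p\<close>, as \<open>two_edge_connection\<close> cuts edges at
    outgoing half-edges.\<close>
  obtain p q where cut: "two_cut G S p q" and po: "p \<in> outs G" "q \<notin> outs G"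
    using cut0 two_cut_out[OF G cut0] two_cut_commute by metis
  let ?T = "?H - S" and ?x = "mate G p" and ?y = "mate G q"
  have cutT: "two_cut G ?T ?x ?y" by (rule two_cut_complement[OF G cut])
  have tS: "turn_closed G S" "turn_closed G ?T" using cut cutT by (auto simp: two_cut_def)
  have SH: "S \<subseteq> ?H" using turn_closedD(1)[OF tS(1)] .
  have pS: "p \<in> S" "q \<in> S" "p \<noteq> q" "?x \<in> ?T" "?y \<in> ?T" "?x \<noteq> ?y" using cut cutT by (auto simp: two_cut_def)
  have pH: "p \<in> ?H" "q \<in> ?H" using pS SH by auto
  have inv: "mate G ?x = p" "mate G ?y = q" using mateD(2)[OF G] pH by auto
  define m where "m = flip p q (mate G)"
  have mv: "m p = q" "m q = p" "m ?x = ?y" "m ?y = ?x" using pS by (auto simp: m_def flip_def)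
  have mr: "m d = mate G d" if "d \<notin> {p, q, ?x, ?y}" for d using that by (simp add: m_def flip_def)
  have mH: "fpf_inv ?H m" unfolding m_def by (rule fpf_inv_flip[OF fmapD(6)[OF G] pH pS(3)])
  have mo: "m d \<in> outs G \<longleftrightarrow> d \<notin> outs G" if "d \<in> ?H" for d
    unfolding m_def by (rule flip_out[OF fmapD(6)[OF G]]) (use that mateD(4)[OF G] pH po in auto)
  have mS: "m d \<in> S" if "d \<in> S" for d
  proof (cases "d \<in> {p, q}")
    case False
    then have "m d = mate G d" "mate G d \<in> S" using mr[of d] that pS cut by (auto simp: two_cut_def)
    then show ?thesis by simp
  qed (use mv pS in auto)
  have fS: "fpf_inv S m" using mH mS SH by (auto simp: fpf_inv_def)
  have fT: "fpf_inv ?T m" using mH fpf_invD[OF fS] unfolding fpf_inv_def by (metis DiffD1 DiffD2 DiffI)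
  have circ: "circles G = 0" using feynman_circles[OF F] pH by blast
  define G1 where "G1 = submap G S m 0"
  define G2 where "G2 = submap G ?T m 0"
  have F1: "is_fmap G1" unfolding G1_def by (rule submap_fmap[OF rs tS(1) fS]) (use mo SH in auto)
  have F2: "is_fmap G2" unfolding G2_def by (rule submap_fmap[OF rs tS(2) fT]) (use mo in auto)
  have H12: "halves G1 = S" "halves G2 = ?T" "outs G1 = outs G \<inter> S" "outs G2 = outs G \<inter> ?T" by (simp_all add: G1_def G2_def)
  have e: "ccount G1 A + ccount G2 A = Suc (ccount G A)" if "A \<noteq> {}" for A
  proof -
    have "ncc ?H (gr ?H (insert m (turn G ` A))) = ncc S (gr S (insert m (turn G ` A))) + ncc ?T (gr ?T (insert m (turn G ` A)))"
      by (rule ncc_split[OF fmapD(2)[OF G]]) (use mH turn_fpf[OF rs] SH mS turn_closedD(2)[OF tS(1)] in auto)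
    then show ?thesis using two_cut_flip[OF G cut that] circ
      unfolding G1_def G2_def submap_ccount[OF tS(1)] submap_ccount[OF tS(2)] m_def by (simp add: ccount_def)
  qed
  have fin: "finite S" "finite ?T" using fmapD(2)[OF G] SH by (auto intro: finite_subset)
  have pos: "0 < ccount G1 UNIV" "0 < ccount G2 UNIV"
    using ncc_pos[of S] ncc_pos[of ?T] fin pS by (auto simp: ccount_def H12 card_gt_0_iff)
  have Fe: "feynman_graph G1" "feynman_graph G2" using F1 F2 e[of UNIV] pos F by (auto simp: feynman_iff)
  have "card ?H = card S + card ?T" using fin SH by (metis card_Un_disjoint Diff_disjoint Un_Diff_cancel sup.absorb2)
  then have V: "num_vertices G1 + num_vertices G2 = num_vertices G"
    using card_halves[OF fmapD(1)[OF F1]] card_halves[OF fmapD(1)[OF F2]] card_halves[OF rs] H12 by simp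
  have gs: "genus G1 + genus G2 = genus G" "grade G1 + grade G2 = grade G"
    using genus_ccount[OF F1] genus_ccount[OF F2] genus_ccount[OF G] grade_ccount[OF F1] grade_ccount[OF F2] grade_ccount[OF G]
      V e[of "{LS}"] e[of "{RS}"] e[of "{NS}"] by simp_all
  have mf1: "melon_free G1" unfolding G1_def
  proof (rule submap_melon[OF G tS(1) F1[unfolded G1_def]])
    fix x y assume "x \<in> S" "y \<in> S" "y \<notin> vertex G x" "\<And>c. m (turn G c x) = turn G c y"
    then show False using False two_cut_melon[OF G mf cut mv(1,2), of x y] mr pS by auto
  qed
  have mf2: "melon_free G2" unfolding G2_def
  proof (rule submap_melon[OF G tS(2) F2[unfolded G2_def]])
    fix x y assume "x \<in> ?T" "y \<in> ?T" "y \<notin> vertex G x" "\<And>c. m (turn G c x) = turn G c y"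
    moreover have "m d = mate G d" if "d \<in> ?T - {?x, ?y}" for d using mr[of d] that pS by auto
    ultimately show False using False two_cut_melon[OF G mf cutT mv(3,4), of x y] by blast
  qed
  have "two_edge_connection G G1 G2"
  proof -
    let ?U = "disjoint_union G1 G2"
    \<comment> \<open>The closing edge joins \<open>p\<close> with \<open>q\<close> in
      \<open>G1\<close> and the far ends in \<open>G2\<close>; cutting both at their outgoing
      half-edges \<open>p\<close> and \<open>?y\<close> restores \<open>G\<close>.\<close>
    have yo: "?y \<in> outs G2" using po mateD(4)[OF G pH(2)] pS by (simp add: H12)
    have p1: "p \<in> outs G1" using po pS by (simp add: H12)
    have mm: "mate G1 p = q" "mate G2 ?y = ?x" using mv pS by (simp_all add: G1_def G2_def)
    have off: "rot G d = d" "mate G d = d" if "d \<notin> ?H" for d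
      using that G permutes_not_in[of "rot G"] permutes_not_in[of "mate G"] by (auto simp: is_fmap_def)
    have "G = ?U\<lparr>mate := (mate ?U)(p := mate G2 ?y, mate G2 ?y := p, ?y := mate G1 p, mate G1 p := ?y)\<rparr>"
    proof (rule fmap.equality)
      show "mate G = mate (?U\<lparr>mate := (mate ?U)(p := mate G2 ?y, mate G2 ?y := p, ?y := mate G1 p, mate G1 p := ?y)\<rparr>)"
      proof
        fix d
        have "mate ?U d = mate G d" if "d \<notin> {p, q, ?x, ?y}"
          using mr[OF that] off(2)[of d] by (simp add: disjoint_union_def G1_def G2_def submap_def)
        then show "mate G d = mate (?U\<lparr>mate := (mate ?U)(p := mate G2 ?y, mate G2 ?y := p, ?y := mate G1 p, mate G1 p := ?y)\<rparr>) d"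
          unfolding mm using pS inv by auto
      qed
      show "rot G = rot (?U\<lparr>mate := (mate ?U)(p := mate G2 ?y, mate G2 ?y := p, ?y := mate G1 p, mate G1 p := ?y)\<rparr>)"
        using off(1) by (auto simp: disjoint_union_def G1_def G2_def submap_def)
    qed (use SH circ G in \<open>auto simp: disjoint_union_def H12 G1_def G2_def is_fmap_def\<close>)
    then show ?thesis unfolding two_edge_connection_def Let_def
      using p1 yo by (intro conjI bexI[of _ p] bexI[of _ ?y]) (auto simp: H12)
  qed
  moreover have "card S < card ?H" "card ?T < card ?H"
  proof -
    have "S \<subset> ?H" "?T \<subset> ?H" using SH pS by blast+
    then show "card S < card ?H" "card ?T < card ?H" using fmapD(2)[OF G] by (simp_all add: psubset_card_mono)
  qed
  moreover have "S \<noteq> {}" "?T \<noteq> {}" using pS by blast+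
  ultimately have "melon_free_split G G1 G2"
    unfolding melon_free_split_def obtained_between_def H12 using Fe mf1 mf2 gs by blast
  then show ?thesis by blast
qed

section \<open>Graphs without two-edge-cut\<close>

lemma longest_chain:
  assumes G: "is_fmap G" and mf: "melon_free G" and ex: "chain T G ds0"
  obtains ds where "chain T G ds" "\<And>es. chain T G es \<Longrightarrow> length es \<le> length ds"
proof -
  let ?P = "\<lambda>n. \<exists>es. chain T G es \<and> length es = n"
  have "?P (length ds0)" using ex by blast
  moreover have "\<forall>n. ?P n \<longrightarrow> n \<le> card (halves G)" using chain_length_bound[OF G mf] by blast
  ultimately have ex: "?P (GREATEST n. ?P n)" and le: "\<And>n. ?P n \<Longrightarrow> n \<le> (GREATEST n. ?P n)"
    using GreatestI_nat[of ?P] Greatest_le_nat[of ?P] by blast+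
  from ex obtain es where "chain T G es" "length es = (GREATEST n. ?P n)" by blast
  then show ?thesis using le by (intro that[of es]) auto
qed

context contraction
begin

text \<open>Legs of the same side are not attached to each other, so a leg leading back into the
  body is attached to a leg of the other side. If the two remaining legs lead out, they form a
  two-edge-cut; if they do not, the body is the whole graph.\<close>

lemma attached_outside:
  assumes F: "feynman_graph G" and PI: "two_PI G" and ne: "H \<noteq> B" and uv: "mate G u \<noteq> v"
  shows "mate G a \<notin> B" "mate G b \<notin> B" "mate G u \<notin> B" "mate G v \<notin> B"
proof -
  have inv: "mate G (mate G x) = x" if "x \<in> {a, b, u, v}" for x using that mateD(2)[OF G] legsH by auto
  have fp: "mate G x \<noteq> x" if "x \<in> {a, b, u, v}" for x using that mateD(3)[OF G] legsH by auto
  have leg: "mate G x \<in> {a, b, u, v}" if "x \<in> {a, b, u, v}" "mate G x \<in> B" for x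
    using inner[of "mate G x"] that inv[OF that(1)] by auto
  have ba: "mate G b \<noteq> a" using ab inv[of b] by auto
  have key: "mate G x \<notin> B" if xy: "x \<in> {a, b}" "y \<in> {a, b}" "x \<noteq> y" for x y
  proof
    assume xB: "mate G x \<in> B"
    have "mate G x \<in> {u, v}" using leg[of x] xB xy fp[of x] ab ba by auto
    then obtain s t where st: "mate G x = s" "{s, t} = {u, v}" "s \<noteq> t" using legs(6) by blast
    have sx: "mate G s = x" using inv[of x] st xy by auto
    have xsB: "x \<in> B" "s \<in> B" using xB st(1) xy legs by auto
    have in1: "mate G d \<in> B" if "d \<in> B - {y, t}" for d
    proof (cases "d \<in> {x, s}")
      case True
      then show ?thesis using st(1) sx xsB by (elim insertE) simp_all
    next
      case False
      have "{a, b, u, v} = {x, s, y, t}" using xy st(2) by auto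
      then have "d \<in> B - {a, b, u, v}" using that False by auto
      then show ?thesis using inner by blast
    qed
    show False
    proof (cases "mate G y \<in> B")
      case True
      moreover have four: "{a, b, u, v} = {x, s, y, t}" using xy st(2) by auto
      moreover have "y \<in> {a, b, u, v}" using xy(2) by auto
      ultimately have "mate G y \<in> {x, s, y, t}" using leg[of y] by simp
      moreover have "mate G y \<noteq> s" using sx inv[of y] xy by auto
      moreover have "mate G y \<noteq> y" using fp[of y] xy(2) by auto
      moreover have "mate G y \<noteq> x"
      proof
        assume "mate G y = x"
        then have "s = y" using inv[of y] st(1) xy(2) by auto
        then show False using st(2) xy(2) legs by auto
      qed
      ultimately have yt: "mate G y = t" by blast
      then have "mate G t = y" using inv[of y] xy by auto
      moreover have "y \<in> B" using xy(2) legs by auto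
      ultimately have "mate G d \<in> B" if "d \<in> B" for d
        using in1[of d] that True by (cases "d = y"; cases "d = t") simp_all
      then have "B = H" using feynman_connected[OF F BC(1)] legs by blast
      then show False using ne by simp
    next
      case False
      have tuv: "t \<in> {u, v}" using st(2) by auto
      have "mate G t \<notin> B"
      proof
        assume tB: "mate G t \<in> B"
        then have "mate G t \<in> {a, b, u, v}" using leg[of t] tuv by auto
        moreover have "mate G t \<noteq> x" using st sx inv[of x] inv[of t] tuv xy by auto
        moreover have "mate G t \<noteq> y" using inv[of t] False tuv legs by auto
        moreover have "mate G t \<noteq> s" using st(1) sx inv[of t] tuv xy legs by auto
        moreover have "mate G t \<noteq> t" using fp[of t] tuv by auto
        ultimately show False using xy st(2) by auto
      qed
      then have "two_cut G B y t"
        unfolding two_cut_def using BC(1) in1 False tuv xy legs by auto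
      then show False using PI two_PR_iff[OF G] by blast
    qed
  qed
  show aB: "mate G a \<notin> B" using key[of a b] legs by auto
  show bB: "mate G b \<notin> B" using key[of b a] legs by auto
  have vu: "mate G v \<noteq> u" using uv inv[of v] by auto
  show "mate G u \<notin> B" "mate G v \<notin> B"
    using leg[of u] leg[of v] fp[of u] fp[of v] uv vu inv[of u] inv[of v] aB bB legs by auto
qed

end

text \<open>All half-edges of the two vertices are joined in parallel, so a strand cycle through
  \<open>x\<close> contains only \<open>x\<close>, \<open>y\<close> and their turns along
  \<open>k\<close>, and misses every other turn. Two faces of each kind on two vertices leave genus
  at most 0.\<close>

lemma two_vertices_two_cycles:
  assumes G: "is_fmap G" and x: "x \<in> halves G" "y \<in> halves G" "y \<notin> vertex G x"
    and m: "\<And>c. m (turn G c x) = turn G c y" "m x = y" "fpf_inv (halves G) m"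
    and S: "S = vertex G x \<union> vertex G y"
  shows "2 \<le> ncc S (gr S {m, turn G k})"
proof -
  note rs = fmapD(1)[OF G]
  have mi: "m (turn G c y) = turn G c x" "m y = x" for c
    using m(1)[of c] m(2) fpf_invD(2)[OF m(3) turn_in[OF rs x(1), of c]] fpf_invD(2)[OF m(3) x(1)] by auto
  let ?K = "{x, y, turn G k x, turn G k y}"
  have tS: "turn_closed G S" unfolding S by (intro turn_closed_Un turn_closed_vertex rs x)
  have SH: "S \<subseteq> halves G" by (rule turn_closedD(1)[OF tS])
  have vx: "vertex G x = insert x (range (\<lambda>c. turn G c x))" "vertex G y = insert y (range (\<lambda>c. turn G c y))"
    using vertex_turn[OF rs] x by auto
  have xS: "x \<in> S" "y \<in> S" "turn G c x \<in> S" "turn G c y \<in> S" for c unfolding S vx by auto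
  have mS: "m d \<in> S" if "d \<in> S" for d
    using that m mi xS unfolding S vx by auto
  have fS: "fpf_inv S f" if "f \<in> {m, turn G k}" for f
    using that mS m(3) turn_closedD(2)[OF tS] turn_fpf[OF rs, of k] SH by (auto simp: fpf_inv_def)
  have cl: "eqc (gr S {m, turn G k}) `` {x} \<subseteq> ?K"
    by (rule gr_closed_class[OF fS]) (use xS m mi rs x in auto)
  obtain j where j: "j \<noteq> k" by (cases k) auto
  have "turn G j x \<notin> ?K"
  proof -
    have "turn G j x \<in> vertex G x" "y \<in> vertex G y" "turn G k y \<in> vertex G y" unfolding vx by auto
    then have "turn G j x \<noteq> y" "turn G j x \<noteq> turn G k y" using vertex_disjoint[OF rs x] by auto
    then show ?thesis using j turn_eq_iff[OF rs x(1)] rs x by auto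
  qed
  then have "ncc S (gr S {m, turn G k}) \<noteq> 1"
    using ncc_oneD[of S "gr S {m, turn G k}" x "turn G j x"] cl xS by blast
  moreover have "0 < ncc S (gr S {m, turn G k})"
    using xS SH fmapD(2)[OF G] by (intro ncc_pos) (auto intro: finite_subset)
  ultimately show ?thesis by linarith
qed

lemma no_vertices: "halves G = {} \<Longrightarrow> num_vertices G = 0"
  by (simp add: num_vertices_def)

lemma two_PI_contraction:
  assumes F: "feynman_graph G" and mf: "melon_free G" and PI: "two_PI G" and gen: "2 \<le> genus G" and gra: "grade G \<le> 2"
  shows "\<exists>X. (N_dipole G X \<or> N_ladder G X) \<and> \<not> separating G X \<and> feynman_graph (contract G X) \<and>
    melon_free (contract G X) \<and> genus (contract G X) = genus G - 1 \<and>
    (sigma G X = -1 \<and> grade (contract G X) = grade G \<or> sigma G X = 0 \<and> grade (contract G X) = grade G - 2)"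
proof -
  have G: "is_fmap G" using F by (simp add: feynman_iff)
  have "halves G \<noteq> {}" using gen genus_ccount[OF G] no_vertices[of G] by auto
  then have "\<exists>D. rung G NS D" by (rule exists_N_rung[OF F]) (use gen gra in auto)
  then obtain D where D: "rung G NS D" by blast
  obtain ds where ch: "chain {NS} G ds" and mx: "\<And>es. chain {NS} G es \<Longrightarrow> length es \<le> length ds"
    using longest_chain[OF G mf chain_single[OF D, of "{NS}"]] by blast
  let ?X = "ladder_piece ds"
  obtain a b u v where s1: "side1 ?X = (a, b)" and s2: "side2 ?X = (u, v)" by force
  interpret contraction G ?X a b u v by (rule chain_contraction[OF G mf ch s1 s2])
  let ?G' = "contract G ?X"
  have hd: "rung G NS (hd ds)" "side1 (hd ds) = (a, b)" using ch s1 by (auto simp: chain_def ladder_piece_def)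
  note ff = rung_first_flip[OF G hd ab]
  have no_cut: "\<not> two_cut G S p q" for S p q using PI two_PR_iff[OF G] by blast
  have C: "ncc H (gr H (insert (flip a b (mate G)) (range (turn G)))) = ncc H (gr H (insert (mate G) (range (turn G))))"
    using ff(3) no_cut by blast
  define \<delta> where "\<delta> = real (ncc H (gr H {flip a b (mate G), turn G NS})) - real (ncc H (gr H {mate G, turn G NS}))"
  note c = N_chain_contract[OF F mf ch s1 C, folded \<delta>_def]
  have \<delta>: "\<delta> \<le> 0" using feynman_bounds(2)[OF c(1)] c(3) gra by linarith
  then have sig: "sigma G ?X = -1 \<or> sigma G ?X = 0" using c(4,6) by linarith
  have uv: "mate G u \<noteq> v" by (rule chain_sides_open(2)[OF G mf ch s2])
  have H': "halves ?G' = H - B" by (simp add: contract_submap)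
  \<comment> \<open>If the ladder were the whole graph, its contraction would be a circle, of genus
    0 instead of \<open>genus G - 1\<close>, which is at least 1.\<close>
  have neB: "H \<noteq> B"
  proof
    assume "H = B"
    then have e: "halves ?G' = {}" using H' by simp
    then have "ccount ?G' A = circles ?G'" for A by (simp add: ccount_def)
    then have "ccount ?G' A = 1" for A using c(1) unfolding feynman_iff by metis
    then show False using genus_ccount[OF contract_fmap] no_vertices[OF e] c(2) gen by simp
  qed
  note att = attached_outside[OF F PI neB uv]
  \<comment> \<open>The half-edges outside to which the legs are attached; \<open>x\<close>,
    \<open>y\<close> form one reconnected edge and \<open>z\<close>, \<open>w\<close> the
    other.\<close>
  define x y z w where xyzw: "x = mate G a" "y = mate G b" "z = mate G u" "w = mate G v"
  let ?Z = "{x, y, z, w}"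
  have inv: "mate G x = a" "mate G y = b" "mate G z = u" "mate G w = v" using mateD(2)[OF G] legsH by (simp_all add: xyzw)
  have ZH: "x \<in> H" "y \<in> H" "z \<in> H" "w \<in> H" using mateD(1)[OF G] legsH by (simp_all add: xyzw)
  have ZB: "x \<notin> B" "y \<notin> B" "z \<notin> B" "w \<notin> B" using att by (simp_all add: xyzw)
  have Zd: "distinct [x, y, z, w]" using inv legs by auto
  have Zl: "d \<notin> {u, v}" "d \<notin> {a, b}" if "d \<in> ?Z" for d using that ZB legs by auto
  have m1v: "m1 x = y" "m1 y = x" "m1 u = z" "m1 v = w" "m1 z = u" "m1 w = v"
  proof -
    have e: "m1 d = (if d = a then b else if d = b then a else if d = y then x else if d = x then y else mate G d)" for d
      using legs by (auto simp: m1_def flip_def xyzw)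
    then show "m1 x = y" "m1 y = x" "m1 u = z" "m1 v = w" "m1 z = u" "m1 w = v"
    proof -
      have ng: "x \<noteq> a" "x \<noteq> b" "y \<noteq> a" "y \<noteq> b" "z \<noteq> a" "z \<noteq> b" "w \<noteq> a" "w \<noteq> b"
        "u \<noteq> x" "u \<noteq> y" "v \<noteq> x" "v \<noteq> y"
        using ZB legs(1-4) by metis+
      have nd: "x \<noteq> y" "z \<noteq> x" "z \<noteq> y" "w \<noteq> x" "w \<noteq> y" using Zd by auto
      show "m1 x = y" "m1 y = x" using ng nd by (simp_all add: e)
      show "m1 u = z" "m1 v = w" using ng legs xyzw by (simp_all add: e)
      show "m1 z = u" "m1 w = v" using ng nd inv by (simp_all add: e)
    qed
  qed
  have m2v: "m2 x = y" "m2 y = x" "m2 z = w" "m2 w = z"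
  proof -
    have "m2 d = (if d = u then v else if d = v then u else if d = w then z else if d = z then w else m1 d)" for d
      using legs m1v by (auto simp: m2_def flip_def)
    then show "m2 x = y" "m2 y = x" "m2 z = w" "m2 w = z" using Zd Zl m1v legs ZB by auto
  qed
  have m2r: "m2 d = mate G d" if d: "d \<in> H - B" "d \<notin> ?Z" for d
  proof (rule m2_outer[OF d(1)])
    show "mate G d \<notin> B"
    proof
      assume B: "mate G d \<in> B"
      have dd: "mate G (mate G d) = d" using mateD(2)[OF G] d by simp
      show False
      proof (cases "mate G d \<in> {a, b, u, v}")
        case True
        then have "d \<in> ?Z" using dd unfolding xyzw by auto
        then show False using d by simp
      next
        case False
        then have "mate G (mate G d) \<in> B" using inner[of "mate G d"] B by blast
        then show False using dd d by simp
      qed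
    qed
  qed
  have nolong: "\<not> chain {NS} G es" if "length es = Suc (length ds)" for es using mx that by fastforce
  have mf': "melon_free ?G'" unfolding contract_submap
  proof (rule submap_melon[OF G outside_closed contract_fmap[unfolded contract_submap]])
    fix p q assume pq: "p \<in> H - B" "q \<in> H - B" "q \<notin> vertex G p" and mm: "\<And>c. m2 (turn G c p) = turn G c q"
    have pqH: "p \<in> H" "q \<in> H" using pq by auto
    have vv: "vertex G p \<inter> vertex G q = {}" by (rule vertex_disjoint[OF rs pqH pq(3)])
    have vt: "vertex G p = insert p (range (\<lambda>c. turn G c p))" "vertex G q = insert q (range (\<lambda>c. turn G c q))"
      using vertex_turn[OF rs] pqH by auto
    have apart: "turn G c p \<noteq> turn G k q" "p \<noteq> q" "p \<noteq> turn G k q" "q \<noteq> turn G k p" for c k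
    proof -
      have "turn G c p \<in> vertex G p" "turn G k p \<in> vertex G p" "turn G k q \<in> vertex G q" "p \<in> vertex G p" "q \<in> vertex G q"
        unfolding vt by auto
      then show "turn G c p \<noteq> turn G k q" "p \<noteq> q" "p \<noteq> turn G k q" "q \<noteq> turn G k p" using vv by auto
    qed
    have vB: "vertex G p \<subseteq> H - B" "vertex G q \<subseteq> H - B"
      using vertex_least[OF rs pqH(1) pq(1)] vertex_least[OF rs pqH(2) pq(2)] turn_closedD(2)[OF outside_closed] by blast+
    have tB: "turn G k p \<in> H - B" "turn G k q \<in> H - B" for k using vB unfolding vt by auto
    have real: "mate G (turn G k p) = turn G k q" if "turn G k p \<notin> ?Z" for k
      using m2r[OF tB(1) that] mm[of k] by simp
    have new: "{turn G k p, turn G k q} = {x, y} \<or> {turn G k p, turn G k q} = {z, w}" if "turn G k p \<in> ?Z" for k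
      using that mm[of k] m2v by auto
    have "\<not> melon G p q" using mf melon_free_iff[OF G] by blast
    then obtain c where "mate G (turn G c p) \<noteq> turn G c q" using pqH pq(3) by (auto simp: melon_def)
    then have cZ: "turn G c p \<in> ?Z" using real by blast
    have sep: "{turn G k p, turn G k q} \<inter> {turn G c p, turn G c q} = {}" if "k \<noteq> c" for k
      using apart(1) apart(1)[symmetric] turn_eq_iff[OF rs pqH(1), of k c] turn_eq_iff[OF rs pqH(2), of k c] that by auto
    \<comment> \<open>If the melon used both reconnected edges, its third edge would join the same
      two vertices in \<open>G\<close>, so that the ladder and these vertices together could be left
      only through \<open>p\<close> and \<open>q\<close>.\<close>
    have unique: "turn G k p \<notin> ?Z" if kc: "k \<noteq> c" for k
    proof
      assume kZ: "turn G k p \<in> ?Z"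
      have Zeq: "?Z = {turn G k p, turn G k q, turn G c p, turn G c q}"
        using new[OF kZ] new[OF cZ] sep[OF kc] by (elim disjE) (auto simp: doubleton_eq_iff)
      define j where "j = third k c"
      have j: "j \<noteq> k" "j \<noteq> c" unfolding j_def using kc by auto
      have all: "i = k \<or> i = c \<or> i = j" for i using j kc by (cases i; cases k; cases c; cases j; simp)
      have jZ: "turn G j p \<notin> ?Z" "turn G j q \<notin> ?Z"
        using j apart(1) apart(1)[symmetric] turn_eq_iff[OF rs pqH(1)] turn_eq_iff[OF rs pqH(2)] unfolding Zeq by auto
      have jr: "mate G (turn G j p) = turn G j q" "mate G (turn G j q) = turn G j p"
        using real[OF jZ(1)] mateD(2)[OF G turn_in[OF rs pqH(1)], of j] by auto
      let ?S = "B \<union> (vertex G p \<union> vertex G q)"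
      have tS: "turn_closed G ?S" by (intro turn_closed_Un BC(1) turn_closed_vertex rs pqH)
      have Sx: "d \<in> B \<or> d \<in> ?Z \<or> d = turn G j p \<or> d = turn G j q" if "d \<in> ?S - {p, q}" for d
        using that all unfolding vt Zeq by auto metis+
      have pZ: "p \<notin> ?Z" "q \<notin> ?Z" unfolding Zeq using apart turn_neq[OF rs pqH(1)] turn_neq[OF rs pqH(2)] by (metis empty_iff insert_iff)+
      have ZS: "?Z \<subseteq> ?S - {p, q}" using pZ unfolding Zeq vt by auto
      have BS: "B \<subseteq> ?S - {p, q}" using pq by auto
      have jS: "turn G j p \<in> ?S - {p, q}" "turn G j q \<in> ?S - {p, q}"
        unfolding vt using apart turn_neq[OF rs pqH(1)] turn_neq[OF rs pqH(2)] by auto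
      have in1: "mate G d \<in> ?S - {p, q}" if dS: "d \<in> ?S - {p, q}" for d
      proof -
        consider "d \<in> B - {a, b, u, v}" | "d \<in> {a, b, u, v}" | "d \<in> ?Z" | "d = turn G j p" | "d = turn G j q"
          using Sx[OF dS] by blast
        then show ?thesis
        proof cases
          case 1 then show ?thesis using inner BS by blast
        next
          case 2
          then have "mate G d \<in> ?Z" unfolding xyzw by auto
          then show ?thesis using ZS by blast
        next
          case 3
          then have "mate G d \<in> B" using inv legs by auto
          then show ?thesis using BS by blast
        qed (use jr jS in simp_all)
      qed
      show False
      \<comment> \<open>If \<open>p\<close> and \<open>q\<close> are joined, the ladder and the two
        vertices make up the whole graph, and the contraction has at most two vertices and at least
        two faces of each kind, too many for its genus. Otherwise \<open>p\<close> and
        \<open>q\<close> give a two-edge-cut.\<close>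
      proof (cases "mate G p = q")
        case True
        then have qp: "mate G q = p" using mateD(2)[OF G pqH(1)] by simp
        have "?S = H"
        proof (rule feynman_connected[OF F tS])
          show "mate G d \<in> ?S" if "d \<in> ?S" for d
            using in1[of d] that True qp pqH vertex_self[OF rs] by (cases "d \<in> {p, q}") auto
        qed (use legs in auto)
        then have HB: "H - B = vertex G p \<union> vertex G q" using vB by auto
        have "m2 p = q" using m2r[OF pq(1) pZ(1)] True by simp
        then have "2 \<le> ncc (H - B) (gr (H - B) {m2, turn G i})" for i
          by (rule two_vertices_two_cycles[OF G pqH pq(3) mm _ m2H HB])
        then have E: "2 \<le> ccount ?G' {i}" for i
          using submap_ccount[OF outside_closed, of m2 _ "{i}"] by (simp add: contract_submap trans_le_add1)
        have "card (vertex G p \<union> vertex G q) \<le> 4 + 4"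
          using card_Un_le[of "vertex G p" "vertex G q"] rs pqH by (simp add: rotsys_def)
        then have "num_vertices ?G' \<le> 2" using card_halves[OF fmapD(1)[OF contract_fmap]] H' HB by simp
        then show False using genus_ccount[OF contract_fmap] c(2) gen E[of LS] E[of RS] by linarith
      next
        case False
        have qp: "mate G q \<noteq> p" using False mateD(2)[OF G pqH(2)] by auto
        have "mate G p \<notin> ?S" "mate G q \<notin> ?S"
          using in1[of "mate G p"] in1[of "mate G q"] mateD(2,3)[OF G pqH(1)] mateD(2,3)[OF G pqH(2)] False qp by auto
        then have "two_cut G ?S p q"
          unfolding two_cut_def using tS in1 apart(2) vertex_self[OF rs] pqH by auto
        then show False using no_cut by blast
      qed
    qed
    have real': "mate G (turn G k p) = turn G k q" if "k \<noteq> c" for k using real[OF unique[OF that]] .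
    show False
    proof (cases "c = NS")
      case True
      from new[OF cZ] show False
      proof
        assume e: "{turn G c p, turn G c q} = {z, w}"
        have l: "mate G ` legs_of (side2 ?X) = {turn G c p, turn G c q}" unfolding e by (simp add: s2 legs_of_def xyzw)
        obtain D where "chain {NS} G (ds @ [D])"
          by (rule chain_extend[OF G ch pqH pq(3) _ real' _ l]) (use vB True in auto)
        then show False using nolong[of "ds @ [D]"] by simp
      next
        assume e: "{turn G c p, turn G c q} = {x, y}"
        note ta = turn_around_chain[OF G ch]
        have l: "mate G ` legs_of (side2 (ladder_piece (rev (map turn_around ds)))) = {turn G c p, turn G c q}"
          unfolding e ta(2) by (simp add: s1 legs_of_def xyzw insert_commute)
        have d: "body (ladder_piece (rev (map turn_around ds))) \<inter> (vertex G p \<union> vertex G q) = {}"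
          unfolding ta(2) using vB by auto
        obtain D where "chain {NS} G (rev (map turn_around ds) @ [D])"
          by (rule chain_extend[OF G ta(1) pqH pq(3) _ real' d l]) (use True in auto)
        then show False using nolong[of "rev (map turn_around ds) @ [D]"] by simp
      qed
    next
      case False
      define j where "j = third NS c"
      have j: "j \<noteq> NS" "j \<noteq> c" "third NS c = j" "third NS j = c"
        unfolding j_def using False by (cases c; simp)+
      \<comment> \<open>The half-edges for \<open>c\<close> and \<open>j\<close> are opposite at
        both vertices, so the reconnected edge and the edge along \<open>j\<close> form an O(D)-loop
        of the contraction. The segment it comes from in \<open>G\<close> makes the first flip
        create an O(D)-loop, against \<open>\<delta> \<le> 0\<close>.\<close>
      let ?S = "{turn G c p, turn G j p, turn G c q, turn G j q}"
      have tS: "turn G NS d \<in> ?S" if "d \<in> ?S" for d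
        using that turn_third[OF rs pqH(1), of NS c] turn_third[OF rs pqH(2), of NS c]
          turn_third[OF rs pqH(1), of NS j] turn_third[OF rs pqH(2), of NS j] False j by auto
      have SB: "?S \<inter> B = {}" using tB by auto
      have jr: "mate G (turn G j p) = turn G j q" "mate G (turn G j q) = turn G j p"
        using real'[OF j(2)] mateD(2)[OF G turn_in[OF rs pqH(1)], of j] by auto
      interpret f: flip_setting H "mate G" "turn G ` {NS}" a b using ff(2)[of "{NS}"] by simp
      have "ncc H (gr H (insert (flip a b (mate G)) (turn G ` {NS}))) = Suc (ncc H (gr H (insert (mate G) (turn G ` {NS}))))"
        using new[OF cZ]
      proof
        assume e: "{turn G c p, turn G c q} = {x, y}"
        show ?thesis
        proof (rule f.flip_split'[where S = ?S])
          show "mate G a \<in> ?S" "mate G b \<in> ?S" using e unfolding xyzw by auto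
          show "a \<notin> ?S" "b \<notin> ?S" using SB legs by auto
          show "f d \<in> ?S" if "f \<in> turn G ` {NS}" "d \<in> ?S \<inter> H" for f d using that tS by blast
          show "mate G d \<in> ?S" if "d \<in> ?S \<inter> H - {mate G a, mate G b}" for d
          proof -
            have "d \<notin> {turn G c p, turn G c q}" using that e unfolding xyzw by blast
            then show ?thesis using that jr by auto
          qed
        qed
      next
        assume e: "{turn G c p, turn G c q} = {z, w}"
        have zS: "z \<in> ?S" "w \<in> ?S" using e by blast+
        have xS: "x \<notin> ?S" "y \<notin> ?S"
        proof -
          have "d \<notin> ?S" if d: "d \<in> {x, y}" for d
          proof
            assume "d \<in> ?S"
            moreover have "d \<notin> {turn G c p, turn G c q}" unfolding e using d Zd by auto
            ultimately have "mate G d \<in> ?S" using jr by auto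
            moreover have "mate G d \<in> B" using d inv legs by auto
            ultimately show False using SB by blast
          qed
          then show "x \<notin> ?S" "y \<notin> ?S" by blast+
        qed
        \<comment> \<open>At the second side the segment runs on through the ladder, so the body is
          added to the set; it can then be left only at \<open>a\<close> and
          \<open>b\<close>.\<close>
        show ?thesis
        proof (rule f.flip_split[where S = "?S \<union> B"])
          show "a \<in> ?S \<union> B" "b \<in> ?S \<union> B" using legs by auto
          show "mate G a \<notin> ?S \<union> B" "mate G b \<notin> ?S \<union> B" using xS ZB unfolding xyzw by auto
          show "f d \<in> ?S \<union> B" if "f \<in> turn G ` {NS}" "d \<in> (?S \<union> B) \<inter> H" for f d
            using that tS turn_closedD(2)[OF BC(1)] by blast
          show "mate G d \<in> ?S \<union> B" if dS: "d \<in> (?S \<union> B) \<inter> H - {a, b}" for d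
          proof -
            have "d \<in> B - {a, b} \<or> d \<in> {turn G c p, turn G c q} \<or> d = turn G j p \<or> d = turn G j q"
              using dS by auto
            then have "d \<in> B - {a, b} \<or> d \<in> {z, w} \<or> d = turn G j p \<or> d = turn G j q" unfolding e .
            then
            consider "d \<in> B - {a, b, u, v}" | "d = u" | "d = v" | "d \<in> {z, w}" | "d = turn G j p" | "d = turn G j q"
              by blast
            then show ?thesis
            proof cases
              case 1 then show ?thesis using inner by blast
            next
              case 2
              then have "mate G d = z" by (simp add: xyzw)
              then show ?thesis using zS(1) by blast
            next
              case 3
              then have "mate G d = w" by (simp add: xyzw)
              then show ?thesis using zS(2) by blast
            next
              case 4 then show ?thesis using inv legs by auto
            qed (use jr in simp_all)
          qed
        qed
      qed
      then have "\<delta> = 1" by (simp add: \<delta>_def)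
      then show False using \<delta> by simp
    qed
  qed
  have "N_dipole G ?X \<or> N_ladder G ?X"
    unfolding N_ladder_def by (rule chain_ladder_of[of "{NS}" G "N_dipole G"]) (use ch rung_N_dipole[OF G] in auto)
  moreover have "sigma G ?X = -1 \<and> grade ?G' = grade G \<or> sigma G ?X = 0 \<and> grade ?G' = grade G - 2"
    using sig c(3,4) by auto
  ultimately show ?thesis using c(1,2,5) mf' by blast
qed

section \<open>The case distinction by grade and by the existence of a two-edge-cut\<close>

theorem theorem4:
  fixes G :: "'h fmap" and g :: real
  assumes "feynman_graph G" and "melon_free G" and "genus G = g" and "g \<ge> 2"
  shows
    "(grade G = 1 \<longrightarrow>
        (two_PI G \<longrightarrow>
           (\<exists>X G'. (N_dipole G X \<or> N_ladder G X) \<and> connecting G X \<and> inserted_into G X G' \<and>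
              feynman_graph G' \<and> melon_free G' \<and> grade G' = 1 \<and> genus G' = g - 1)) \<and>
        (two_PR G \<longrightarrow>
           (\<exists>G1 G2. obtained_between G G1 G2 \<and>
              feynman_graph G1 \<and> melon_free G1 \<and> feynman_graph G2 \<and> melon_free G2 \<and>
              grade G1 = 1 \<and> grade G2 = 0 \<and>
              0 \<le> genus G1 \<and> genus G1 < g \<and> 0 < genus G2 \<and> genus G2 \<le> g \<and>
              genus G1 + genus G2 = g))) \<and>
     (grade G = 2 \<longrightarrow>
        (two_PI G \<longrightarrow>
           (\<exists>X G'. (N_dipole G X \<or> N_ladder G X) \<and> connecting G X \<and> inserted_into G X G' \<and>
              feynman_graph G' \<and> melon_free G' \<and> grade G' = 2 \<and> genus G' = g - 1) \<or>
           (\<exists>X G'. (N_dipole G X \<or> N_ladder G X) \<and> rearranging G X \<and> inserted_into G X G' \<and>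
              feynman_graph G' \<and> melon_free G' \<and> grade G' = 0 \<and> genus G' = g - 1)) \<and>
        (two_PR G \<longrightarrow>
           (\<exists>G1 G2. obtained_between G G1 G2 \<and>
              feynman_graph G1 \<and> melon_free G1 \<and> feynman_graph G2 \<and> melon_free G2 \<and>
              grade G1 = 2 \<and> grade G2 = 0 \<and>
              0 \<le> genus G1 \<and> genus G1 \<le> g - 1 \<and> 0 < genus G2 \<and> genus G2 \<le> g \<and>
              genus G1 + genus G2 = g) \<or>
           (\<exists>G1 G2. obtained_between G G1 G2 \<and>
              feynman_graph G1 \<and> melon_free G1 \<and> feynman_graph G2 \<and> melon_free G2 \<and>
              grade G1 = 1 \<and> grade G2 = 1 \<and> genus G1 + genus G2 = g)))"
proof (intro conjI impI)
  note F = assms(1) and mf = assms(2)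
  have gen: "2 \<le> genus G" using assms by simp
  show "\<exists>X G'. (N_dipole G X \<or> N_ladder G X) \<and> connecting G X \<and> inserted_into G X G' \<and>
          feynman_graph G' \<and> melon_free G' \<and> grade G' = 1 \<and> genus G' = g - 1" if g1: "grade G = 1" and PI: "two_PI G"
  proof -
    obtain X where X: "N_dipole G X \<or> N_ladder G X" "\<not> separating G X" "feynman_graph (contract G X)"
      "melon_free (contract G X)" "genus (contract G X) = genus G - 1"
      "sigma G X = -1 \<and> grade (contract G X) = grade G \<or> sigma G X = 0 \<and> grade (contract G X) = grade G - 2"
      using two_PI_contraction[OF F mf PI gen] g1 by auto
    \<comment> \<open>The other alternative would give a contraction of grade
      \<open>-1\<close>.\<close>
    have "sigma G X = -1 \<and> grade (contract G X) = 1" using X(6) feynman_bounds(2)[OF X(3)] g1 by auto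
    then show ?thesis using X assms(3)
      by (intro exI[of _ X] exI[of _ "contract G X"]) (simp add: connecting_def inserted_into_def)
  qed
  show "(\<exists>X G'. (N_dipole G X \<or> N_ladder G X) \<and> connecting G X \<and> inserted_into G X G' \<and>
          feynman_graph G' \<and> melon_free G' \<and> grade G' = 2 \<and> genus G' = g - 1) \<or>
        (\<exists>X G'. (N_dipole G X \<or> N_ladder G X) \<and> rearranging G X \<and> inserted_into G X G' \<and>
          feynman_graph G' \<and> melon_free G' \<and> grade G' = 0 \<and> genus G' = g - 1)" if g2: "grade G = 2" and PI: "two_PI G"
  proof -
    obtain X where X: "N_dipole G X \<or> N_ladder G X" "\<not> separating G X" "feynman_graph (contract G X)"
      "melon_free (contract G X)" "genus (contract G X) = genus G - 1"
      "sigma G X = -1 \<and> grade (contract G X) = grade G \<or> sigma G X = 0 \<and> grade (contract G X) = grade G - 2"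
      using two_PI_contraction[OF F mf PI gen] g2 by auto
    from X(6) show ?thesis
    proof
      assume "sigma G X = -1 \<and> grade (contract G X) = grade G"
      then show ?thesis using X assms(3) g2
        by (intro disjI1 exI[of _ X] exI[of _ "contract G X"]) (simp add: connecting_def inserted_into_def)
    next
      assume "sigma G X = 0 \<and> grade (contract G X) = grade G - 2"
      then show ?thesis using X assms(3) g2
        by (intro disjI2 exI[of _ X] exI[of _ "contract G X"]) (simp add: rearranging_def inserted_into_def)
    qed
  qed
  have split: "\<exists>G1 G2. melon_free_split G G1 G2 \<and> grade G2 \<le> grade G1" if PR: "two_PR G"
  proof -
    obtain G1 G2 where "melon_free_split G G1 G2" using two_PR_decomposition[OF F mf PR] by blast
    then show ?thesis using melon_free_split_commute[of G G1 G2] linear[of "grade G1" "grade G2"] by metis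
  qed
  \<comment> \<open>Grades are non-negative integers, so a sum of 1 or 2 with the larger grade first
    splits only as 1 + 0, 2 + 0 or 1 + 1.\<close>
  have int: "grade K = 0 \<or> 1 \<le> grade K" if "feynman_graph K" for K :: "'h fmap"
    using feynman_bounds(2,3)[OF that] by (metis Ints_cases le_less of_int_0_less_iff of_int_1_le_iff zless_iff_Suc_zadd int_one_le_iff_zero_less)
  show "\<exists>G1 G2. obtained_between G G1 G2 \<and>
          feynman_graph G1 \<and> melon_free G1 \<and> feynman_graph G2 \<and> melon_free G2 \<and>
          grade G1 = 1 \<and> grade G2 = 0 \<and>
          0 \<le> genus G1 \<and> genus G1 < g \<and> 0 < genus G2 \<and> genus G2 \<le> g \<and>
          genus G1 + genus G2 = g" if g1: "grade G = 1" and PR: "two_PR G"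
  proof -
    obtain G1 G2 where sp: "melon_free_split G G1 G2" "grade G2 \<le> grade G1" using split[OF PR] by blast
    note s = sp(1)[unfolded melon_free_split_def]
    have "grade G2 = 0" "grade G1 = 1" using s sp(2) g1 int[of G2] by auto
    moreover from this have "1 \<le> genus G2" using s grade_zero_genus[of G2] by auto
    moreover have "0 \<le> genus G1" using s feynman_bounds(1)[of G1] by auto
    ultimately show ?thesis using s assms(3) by (intro exI[of _ G1] exI[of _ G2]) auto
  qed
  show "(\<exists>G1 G2. obtained_between G G1 G2 \<and>
          feynman_graph G1 \<and> melon_free G1 \<and> feynman_graph G2 \<and> melon_free G2 \<and>
          grade G1 = 2 \<and> grade G2 = 0 \<and>
          0 \<le> genus G1 \<and> genus G1 \<le> g - 1 \<and> 0 < genus G2 \<and> genus G2 \<le> g \<and>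
          genus G1 + genus G2 = g) \<or>
        (\<exists>G1 G2. obtained_between G G1 G2 \<and>
          feynman_graph G1 \<and> melon_free G1 \<and> feynman_graph G2 \<and> melon_free G2 \<and>
          grade G1 = 1 \<and> grade G2 = 1 \<and> genus G1 + genus G2 = g)" if g2: "grade G = 2" and PR: "two_PR G"
  proof -
    obtain G1 G2 where sp: "melon_free_split G G1 G2" "grade G2 \<le> grade G1" using split[OF PR] by blast
    note s = sp(1)[unfolded melon_free_split_def]
    from int[of G2] s consider "grade G2 = 0" | "1 \<le> grade G2" by blast
    then show ?thesis
    proof cases
      case 1
      then have "1 \<le> genus G2" using s grade_zero_genus[of G2] by auto
      moreover have "0 \<le> genus G1" using s feynman_bounds(1)[of G1] by auto
      ultimately show ?thesis using s assms(3) g2 1 by (intro disjI1 exI[of _ G1] exI[of _ G2]) auto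
    next
      case 2
      then have "grade G1 = 1" "grade G2 = 1" using s sp(2) g2 by auto
      then show ?thesis using s assms(3) by (intro disjI2 exI[of _ G1] exI[of _ G2]) auto
    qed
  qed
qed

end
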